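(* Let $n\ge 2$ and let $(S_1,\dots,S_{n-1},P)$ be a c.n.u. $\Gamma_n$-contraction on a Hilbert space $\mathcal H$. Let $\mathcal H=\mathcal H_1\oplus\mathcal H_2$ be the unique orthogonal decomposition into subspaces reducing $P$ such that $P|_{\mathcal H_1}$ is a c.n.u. isometry and $P|_{\mathcal H_2}$ is a c.n.i. contraction (Levan's decomposition of the c.n.u. contraction $P$). If either $P^*$ commutes with each $S_i$ ($1\le i\le n-1$), or $\mathcal H_1$ is the maximal invariant subspace for $P$ on which $P$ is an isometry, then: (1) $\mathcal H_1$ and $\mathcal H_2$ reduce $S_1,\dots,S_{n-1}$; (2) $(S_1|_{\mathcal H_1},\dots,S_{n-1}|_{\mathcal H_1},P|_{\mathcal H_1})$ is a c.n.u. $\Gamma_n$-isometry; (3) $(S_1|_{\mathcal H_2},\dots,S_{n-1}|_{\mathcal H_2},P|_{\mathcal H_2})$ is a c.n.i. $\Gamma_n$-contraction. Either of $\mathcal H_1,\mathcal H_2$ may be the trivial subspace $\{0\}$.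
   Context: All operators are bounded linear operators on complex Hilbert spaces; subspaces are closed. A subspace reduces $T$ if it is invariant under $T$ and $T^*$. A compact set $K\subset\mathbb C^n$ is a spectral set for a commuting $n$-tuple $\underline T$ if the Taylor joint spectrum of $\underline T$ lies in $K$ and $\|f(\underline T)\|\le\sup_{K}|f|$ for every rational function $f$ with poles off $K$. The closed symmetrized polydisc is $\Gamma_n=\pi_n(\overline{\mathbb D}^n)$, where $\pi_n(z_1,\dots,z_n)=(\sum_i z_i,\sum_{i<j}z_iz_j,\dots,\prod_i z_i)$, and $b\Gamma_n=\pi_n(\mathbb T^n)$. A $\Gamma_n$-contraction is a commuting $n$-tuple $(S_1,\dots,S_{n-1},P)$ having $\Gamma_n$ as a spectral set (then $P$ is a contraction). A $\Gamma_n$-unitary is a commuting tuple of normal operators with Taylor joint spectrum contained in $b\Gamma_n$. A $\Gamma_n$-isometry is the restriction of a $\Gamma_n$-unitary to a joint invariant subspace. A contraction is c.n.u. (completely non-unitary) if no nonzero reducing subspace exists on which it is unitary; it is c.n.i. (completely non-isometry) if no nonzero reducing subspace exists on which it is an isometry. A $\Gamma_n$-contraction $(S_1,\dots,S_{n-1},P)$ is called c.n.u. (resp. c.n.i.) if $P$ is a c.n.u. (resp. c.n.i.) contraction. Levan's theorem: for a c.n.u. contraction $P$ on $\mathcal H$ there is a unique orthogonal decomposition $\mathcal H=\mathcal H_1\oplus\mathcal H_2$ into subspaces reducing $P$ with $P|_{\mathcal H_1}$ a c.n.u. isometry and $P|_{\mathcal H_2}$ a c.n.i. contraction. *)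

theory Defs
  imports "HOL-Analysis.Analysis" "HOL-Library.Poly_Mapping"
begin

section \<open>Complex Hilbert spaces\<close>

text \<open>The inner product is linear in its first argument.\<close>

class complex_hilbert = banach +
  fixes scaleC :: "complex \<Rightarrow> 'a \<Rightarrow> 'a" (infixr "*\<^sub>C" 75)
    and cinner :: "'a \<Rightarrow> 'a \<Rightarrow> complex"
  assumes scaleC_add_right: "a *\<^sub>C (x + y) = a *\<^sub>C x + a *\<^sub>C y"
    and scaleC_add_left: "(a + b) *\<^sub>C x = a *\<^sub>C x + b *\<^sub>C x"
    and scaleC_scaleC: "a *\<^sub>C b *\<^sub>C x = (a * b) *\<^sub>C x"
    and scaleR_scaleC: "r *\<^sub>R x = complex_of_real r *\<^sub>C x"
    and cinner_commute: "cinner x y = cnj (cinner y x)"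
    and cinner_add_left: "cinner (x + y) z = cinner x z + cinner y z"
    and cinner_scaleC_left: "cinner (a *\<^sub>C x) y = a * cinner x y"
    and cinner_self: "cinner x x = complex_of_real ((norm x)\<^sup>2)"

lemma norm_scaleC: "norm (a *\<^sub>C x) = cmod a * norm (x :: 'a :: complex_hilbert)"
proof -
  have "complex_of_real ((norm (a *\<^sub>C x))\<^sup>2) = a * cnj a * complex_of_real ((norm x)\<^sup>2)"
    by (metis cinner_self cinner_scaleC_left cinner_commute complex_cnj_mult mult.assoc
        complex_cnj_complex_of_real)
  also have "\<dots> = complex_of_real ((cmod a * norm x)\<^sup>2)"
    by (simp add: complex_norm_square[symmetric] power_mult_distrib)
  finally have "(norm (a *\<^sub>C x))\<^sup>2 = (cmod a * norm x)\<^sup>2"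
    using of_real_eq_iff by blast
  then show ?thesis by simp
qed

lemma Re_cinner_le: "\<bar>Re (cinner x y)\<bar> \<le> norm x * norm (y :: 'a :: complex_hilbert)"
proof -
  have main: "Re (cinner x y) \<le> norm x * norm y" for x y :: 'a
  proof -
    have add_right: "cinner u (v + w) = cinner u v + cinner u w" for u v w :: 'a
      by (metis cinner_add_left cinner_commute complex_cnj_add)
    have "complex_of_real ((norm (x + y))\<^sup>2)
        = complex_of_real ((norm x)\<^sup>2 + (norm y)\<^sup>2) + (cinner x y + cnj (cinner x y))"
      unfolding of_real_add cinner_self[symmetric] cinner_commute[of y x, symmetric]
      by (simp add: cinner_add_left add_right)
    also have "\<dots> = complex_of_real ((norm x)\<^sup>2 + (norm y)\<^sup>2 + 2 * Re (cinner x y))"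
      by (simp add: complex_add_cnj)
    finally have "(norm (x + y))\<^sup>2 = (norm x)\<^sup>2 + (norm y)\<^sup>2 + 2 * Re (cinner x y)"
      using of_real_eq_iff by blast
    moreover have "(norm (x + y))\<^sup>2 \<le> (norm x + norm y)\<^sup>2"
      by (simp add: norm_triangle_ineq power_mono)
    ultimately show ?thesis by (simp add: power2_sum)
  qed
  have "cinner (- x) y = - cinner x y"
    using cinner_scaleC_left[of "-1" x y] scaleR_scaleC[of "-1" x] by simp
  then show ?thesis using main[of x y] main[of "- x" y] by simp
qed

lemma cmod_cinner_le: "cmod (cinner x y) \<le> 2 * (norm x * norm (y :: 'a :: complex_hilbert))"
proof -
  have "cinner (\<i> *\<^sub>C x) y = \<i> * cinner x y" by (rule cinner_scaleC_left)
  then have "\<bar>Im (cinner x y)\<bar> \<le> norm x * norm y"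
    using Re_cinner_le[of "\<i> *\<^sub>C x" y] by (simp add: norm_scaleC)
  then show ?thesis
    using Re_cinner_le[of x y] cmod_le[of "cinner x y"] by linarith
qed


section \<open>The Hilbert space of square-summable sequences\<close>

typedef (overloaded) 'a ell2 =
  "{f :: nat \<Rightarrow> 'a :: complex_hilbert. summable (\<lambda>i. (norm (f i))\<^sup>2)}"
  by (rule exI[of _ "\<lambda>_. 0"]) simp

setup_lifting type_definition_ell2

lemma square_sum_le_L2:
  fixes f :: "nat \<Rightarrow> 'a :: real_normed_vector"
  assumes "summable (\<lambda>i. (norm (f i))\<^sup>2)"
  shows "L2_set (\<lambda>i. norm (f i)) {..<n} \<le> sqrt (suminf (\<lambda>i. (norm (f i))\<^sup>2))"
  unfolding L2_set_def using assms by (simp add: sum_le_suminf)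

lemma square_summable_boundI:
  fixes f :: "nat \<Rightarrow> 'a :: real_normed_vector"
  assumes "\<And>n. L2_set (\<lambda>i. norm (f i)) {..<n} \<le> c"
  shows "summable (\<lambda>i. (norm (f i))\<^sup>2)" and "sqrt (suminf (\<lambda>i. (norm (f i))\<^sup>2)) \<le> c"
proof -
  have c: "0 \<le> c" using assms[of 0] by simp
  have b: "(\<Sum>i<n. (norm (f i))\<^sup>2) \<le> c\<^sup>2" for n
    using assms[of n] unfolding L2_set_def by (rule sqrt_le_D)
  show s: "summable (\<lambda>i. (norm (f i))\<^sup>2)"
    by (rule summableI_nonneg_bounded[of _ "c\<^sup>2"]) (use b in auto)
  have "(suminf (\<lambda>i. (norm (f i))\<^sup>2)) \<le> c\<^sup>2"
    by (rule suminf_le_const[OF s]) (use b in auto)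
  then show "sqrt (suminf (\<lambda>i. (norm (f i))\<^sup>2)) \<le> c"
    using c by (simp add: real_le_lsqrt suminf_nonneg[OF s])
qed

lemma square_summable_add:
  fixes f g :: "nat \<Rightarrow> 'a :: real_normed_vector"
  assumes f: "summable (\<lambda>i. (norm (f i))\<^sup>2)" and g: "summable (\<lambda>i. (norm (g i))\<^sup>2)"
  shows "summable (\<lambda>i. (norm (f i + g i))\<^sup>2)"
    and "sqrt (suminf (\<lambda>i. (norm (f i + g i))\<^sup>2))
      \<le> sqrt (suminf (\<lambda>i. (norm (f i))\<^sup>2)) + sqrt (suminf (\<lambda>i. (norm (g i))\<^sup>2))"
proof -
  have "L2_set (\<lambda>i. norm (f i + g i)) {..<n}
      \<le> sqrt (suminf (\<lambda>i. (norm (f i))\<^sup>2)) + sqrt (suminf (\<lambda>i. (norm (g i))\<^sup>2))" for n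
  proof -
    have "L2_set (\<lambda>i. norm (f i + g i)) {..<n} \<le> L2_set (\<lambda>i. norm (f i) + norm (g i)) {..<n}"
      by (rule L2_set_mono) (auto intro: norm_triangle_ineq)
    also have "\<dots> \<le> L2_set (\<lambda>i. norm (f i)) {..<n} + L2_set (\<lambda>i. norm (g i)) {..<n}"
      by (rule L2_set_triangle_ineq)
    also have "\<dots> \<le> sqrt (suminf (\<lambda>i. (norm (f i))\<^sup>2)) + sqrt (suminf (\<lambda>i. (norm (g i))\<^sup>2))"
      by (intro add_mono square_sum_le_L2 f g)
    finally show ?thesis .
  qed
  then show "summable (\<lambda>i. (norm (f i + g i))\<^sup>2)"
    and "sqrt (suminf (\<lambda>i. (norm (f i + g i))\<^sup>2))
      \<le> sqrt (suminf (\<lambda>i. (norm (f i))\<^sup>2)) + sqrt (suminf (\<lambda>i. (norm (g i))\<^sup>2))"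
    by (rule square_summable_boundI)+
qed

lemma square_summable_uminus:
  fixes f :: "nat \<Rightarrow> 'a :: real_normed_vector"
  assumes "summable (\<lambda>i. (norm (f i))\<^sup>2)"
  shows "summable (\<lambda>i. (norm (- f i))\<^sup>2)"
  using assms by simp

lemma square_summable_diff:
  fixes f g :: "nat \<Rightarrow> 'a :: real_normed_vector"
  assumes "summable (\<lambda>i. (norm (f i))\<^sup>2)" and "summable (\<lambda>i. (norm (g i))\<^sup>2)"
  shows "summable (\<lambda>i. (norm (f i - g i))\<^sup>2)"
  using square_summable_add(1)[OF assms(1) square_summable_uminus[OF assms(2)]] by simp

lemma summable_cinner:
  fixes f g :: "nat \<Rightarrow> 'a :: complex_hilbert"
  assumes "summable (\<lambda>i. (norm (f i))\<^sup>2)" and "summable (\<lambda>i. (norm (g i))\<^sup>2)"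
  shows "summable (\<lambda>i. cinner (f i) (g i))"
proof (rule summable_comparison_test')
  show "summable (\<lambda>i. (norm (f i))\<^sup>2 + (norm (g i))\<^sup>2)"
    using assms by (rule summable_add)
  show "norm (cinner (f i) (g i)) \<le> (norm (f i))\<^sup>2 + (norm (g i))\<^sup>2" for i
    using cmod_cinner_le[of "f i" "g i"] sum_squares_bound[of "norm (f i)" "norm (g i)"]
    by simp
qed

instantiation ell2 :: (complex_hilbert) real_normed_vector
begin

lift_definition zero_ell2 :: "'a ell2" is "\<lambda>_. 0" by simp
lift_definition plus_ell2 :: "'a ell2 \<Rightarrow> 'a ell2 \<Rightarrow> 'a ell2" is "\<lambda>f g i. f i + g i"
  by (rule square_summable_add(1))
lift_definition minus_ell2 :: "'a ell2 \<Rightarrow> 'a ell2 \<Rightarrow> 'a ell2" is "\<lambda>f g i. f i - g i"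
  by (rule square_summable_diff)
lift_definition uminus_ell2 :: "'a ell2 \<Rightarrow> 'a ell2" is "\<lambda>f i. - f i"
  by (rule square_summable_uminus)
lift_definition scaleR_ell2 :: "real \<Rightarrow> 'a ell2 \<Rightarrow> 'a ell2" is "\<lambda>r f i. r *\<^sub>R f i"
  by (simp add: power_mult_distrib summable_mult)
lift_definition norm_ell2 :: "'a ell2 \<Rightarrow> real"
  is "\<lambda>f. sqrt (suminf (\<lambda>i. (norm (f i))\<^sup>2))" .
definition dist_ell2 :: "'a ell2 \<Rightarrow> 'a ell2 \<Rightarrow> real" where
  "dist_ell2 x y = norm (x - y)"
definition sgn_ell2 :: "'a ell2 \<Rightarrow> 'a ell2" where
  "sgn_ell2 x = inverse (norm x) *\<^sub>R x"
definition uniformity_ell2 :: "('a ell2 \<times> 'a ell2) filter" where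
  "uniformity_ell2 = (INF e\<in>{0<..}. principal {(x, y). dist x y < e})"
definition open_ell2 :: "'a ell2 set \<Rightarrow> bool" where
  "open_ell2 U = (\<forall>x\<in>U. \<forall>\<^sub>F (x', y) in uniformity. x' = x \<longrightarrow> y \<in> U)"

instance
proof
  fix x y z :: "'a ell2" and a b :: real
  show "x + y + z = x + (y + z)" by transfer (simp add: add.assoc)
  show "x + y = y + x" by transfer (simp add: add.commute)
  show "0 + x = x" by transfer simp
  show "- x + x = 0" by transfer simp
  show "x - y = x + - y" by transfer simp
  show "a *\<^sub>R (x + y) = a *\<^sub>R x + a *\<^sub>R y" by transfer (simp add: scaleR_add_right)
  show "(a + b) *\<^sub>R x = a *\<^sub>R x + b *\<^sub>R x" by transfer (simp add: scaleR_add_left)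
  show "a *\<^sub>R b *\<^sub>R x = (a * b) *\<^sub>R x" by transfer simp
  show "1 *\<^sub>R x = x" by transfer simp
  show "dist x y = norm (x - y)" by (rule dist_ell2_def)
  show "sgn x = inverse (norm x) *\<^sub>R x" by (rule sgn_ell2_def)
  show "uniformity = (INF e\<in>{0<..}. principal {(x :: 'a ell2, y). dist x y < e})"
    by (rule uniformity_ell2_def)
  show "open U = (\<forall>x\<in>U. \<forall>\<^sub>F (x', y) in uniformity. x' = x \<longrightarrow> y \<in> U)" for U :: "'a ell2 set"
    by (rule open_ell2_def)
  show "(norm x = 0) = (x = 0)"
    by transfer (auto simp: suminf_eq_zero_iff)
  show "norm (x + y) \<le> norm x + norm y"
    by transfer (rule square_summable_add(2))
  show "norm (a *\<^sub>R x) = \<bar>a\<bar> * norm x"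
    by transfer (simp add: power_mult_distrib suminf_mult real_sqrt_mult)
qed

end

instance ell2 :: (complex_hilbert) banach
proof
  fix X :: "nat \<Rightarrow> 'a ell2"
  assume X: "Cauchy X"
  define F where "F k = Rep_ell2 (X k)" for k
  have F: "summable (\<lambda>i. (norm (F k i))\<^sup>2)" for k
    using Rep_ell2[of "X k"] by (simp add: F_def)
  have fin: "L2_set (\<lambda>i. norm (F k i - F m i)) {..<n} \<le> norm (X k - X m)" for k m n
    using square_sum_le_L2[OF square_summable_diff[OF F[of k] F[of m]], of n]
    by (simp add: norm_ell2.rep_eq minus_ell2.rep_eq F_def)
  have coord: "norm (F k i - F m i) \<le> norm (X k - X m)" for k m i
    using member_le_L2_set[of "{..<Suc i}" i "\<lambda>i. norm (F k i - F m i)"] fin[of k m "Suc i"]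
    by simp
  have "Cauchy (\<lambda>k. F k i)" for i
    unfolding Cauchy_iff
  proof (intro allI impI)
    fix e :: real assume "0 < e"
    then obtain M where "\<And>k m. M \<le> k \<Longrightarrow> M \<le> m \<Longrightarrow> norm (X k - X m) < e"
      using X unfolding Cauchy_iff by blast
    then show "\<exists>M. \<forall>k\<ge>M. \<forall>m\<ge>M. norm (F k i - F m i) < e"
      by (meson coord le_less_trans)
  qed
  then have "\<exists>l. (\<lambda>k. F k i) \<longlonglongrightarrow> l" for i
    by (simp add: Cauchy_convergent_iff convergent_def)
  then obtain L where L: "\<And>i. (\<lambda>k. F k i) \<longlonglongrightarrow> L i" by metis
  have tail: "\<exists>M. \<forall>k\<ge>M. \<forall>n. L2_set (\<lambda>i. norm (F k i - L i)) {..<n} \<le> e" if "0 < e" for e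
  proof -
    obtain M where M: "\<And>k m. M \<le> k \<Longrightarrow> M \<le> m \<Longrightarrow> norm (X k - X m) < e"
      using X \<open>0 < e\<close> unfolding Cauchy_iff by blast
    have "L2_set (\<lambda>i. norm (F k i - L i)) {..<n} \<le> e" if "M \<le> k" for k n
    proof (rule LIMSEQ_le_const2)
      show "(\<lambda>m. L2_set (\<lambda>i. norm (F k i - F m i)) {..<n})
          \<longlonglongrightarrow> L2_set (\<lambda>i. norm (F k i - L i)) {..<n}"
        unfolding L2_set_def by (intro tendsto_intros L)
      show "\<exists>N. \<forall>m\<ge>N. L2_set (\<lambda>i. norm (F k i - F m i)) {..<n} \<le> e"
        using fin M[OF that] by (meson less_imp_le order_trans)
    qed
    then show ?thesis by blast
  qed
  obtain M where "\<And>n. L2_set (\<lambda>i. norm (F M i - L i)) {..<n} \<le> 1"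
    using tail[of 1] by auto
  then have "summable (\<lambda>i. (norm (F M i - L i))\<^sup>2)" by (rule square_summable_boundI)
  from square_summable_diff[OF F[of M] this]
  have sL: "summable (\<lambda>i. (norm (L i))\<^sup>2)" by simp
  define l where "l = Abs_ell2 L"
  have l: "Rep_ell2 l = L" using sL by (simp add: l_def Abs_ell2_inverse)
  have "X \<longlonglongrightarrow> l"
    unfolding LIMSEQ_iff
  proof (intro allI impI)
    fix e :: real assume e: "0 < e"
    then obtain M where M: "\<And>k n. M \<le> k \<Longrightarrow> L2_set (\<lambda>i. norm (F k i - L i)) {..<n} \<le> e / 2"
      using tail[of "e / 2"] by auto
    have "norm (X k - l) \<le> e / 2" if "M \<le> k" for k
      using square_summable_boundI(2)[OF M[OF that]]
      by (simp add: norm_ell2.rep_eq minus_ell2.rep_eq F_def l)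
    then show "\<exists>M. \<forall>k\<ge>M. norm (X k - l) < e"
      using e by (intro exI[of _ M]) (auto intro: le_less_trans[of _ "e / 2"])
  qed
  then show "convergent X" by (auto simp: convergent_def)
qed

instantiation ell2 :: (complex_hilbert) complex_hilbert
begin

lift_definition scaleC_ell2 :: "complex \<Rightarrow> 'a ell2 \<Rightarrow> 'a ell2" is "\<lambda>c f i. c *\<^sub>C f i"
  by (simp add: norm_scaleC power_mult_distrib summable_mult)
lift_definition cinner_ell2 :: "'a ell2 \<Rightarrow> 'a ell2 \<Rightarrow> complex"
  is "\<lambda>f g. suminf (\<lambda>i. cinner (f i) (g i))" .

instance
proof
  fix x y z :: "'a ell2" and a b :: complex and r :: real
  show "a *\<^sub>C (x + y) = a *\<^sub>C x + a *\<^sub>C y" by transfer (simp add: scaleC_add_right)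
  show "(a + b) *\<^sub>C x = a *\<^sub>C x + b *\<^sub>C x" by transfer (simp add: scaleC_add_left)
  show "a *\<^sub>C b *\<^sub>C x = (a * b) *\<^sub>C x" by transfer (simp add: scaleC_scaleC)
  show "r *\<^sub>R x = complex_of_real r *\<^sub>C x" by transfer (simp add: scaleR_scaleC)
  show "cinner x y = cnj (cinner y x)"
  proof transfer
    fix f g :: "nat \<Rightarrow> 'a"
    assume "summable (\<lambda>i. (norm (f i))\<^sup>2)" "summable (\<lambda>i. (norm (g i))\<^sup>2)"
    then have "(\<lambda>i. cnj (cinner (g i) (f i))) sums cnj (suminf (\<lambda>i. cinner (g i) (f i)))"
      by (simp add: sums_cnj summable_cinner summable_sums)
    then show "suminf (\<lambda>i. cinner (f i) (g i)) = cnj (suminf (\<lambda>i. cinner (g i) (f i)))"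
      by (metis (no_types, lifting) cinner_commute sums_unique suminf_cong)
  qed
  show "cinner (x + y) z = cinner x z + cinner y z"
    by transfer (simp add: cinner_add_left suminf_add summable_cinner)
  show "cinner (a *\<^sub>C x) y = a * cinner x y"
    by transfer (simp add: cinner_scaleC_left suminf_mult summable_cinner)
  show "cinner x x = complex_of_real ((norm x)\<^sup>2)"
    by transfer (simp add: cinner_self suminf_nonneg suminf_of_real del: of_real_power)
qed

end


section \<open>Operators on closed subspaces\<close>

text \<open>
  A Hilbert space is rendered as a closed subspace \<open>M\<close> of a type of class \<open>complex_hilbert\<close>, and an
  operator on \<open>M\<close> as a function of which only the values on \<open>M\<close> matter.  The restriction of an
  operator \<open>T\<close> to a subspace \<open>M\<close> is therefore the same function \<open>T\<close>, regarded as an operator on \<open>M\<close>.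
\<close>

definition closed_csubspace :: "'a :: complex_hilbert set \<Rightarrow> bool" where
  "closed_csubspace M \<longleftrightarrow> closed M \<and> 0 \<in> M \<and> (\<forall>x\<in>M. \<forall>y\<in>M. x + y \<in> M) \<and>
     (\<forall>c. \<forall>x\<in>M. c *\<^sub>C x \<in> M)"

definition clinear_on :: "'a :: complex_hilbert set \<Rightarrow> ('a \<Rightarrow> 'b :: complex_hilbert) \<Rightarrow> bool" where
  "clinear_on M T \<longleftrightarrow> (\<forall>x\<in>M. \<forall>y\<in>M. T (x + y) = T x + T y) \<and> (\<forall>c. \<forall>x\<in>M. T (c *\<^sub>C x) = c *\<^sub>C T x)"

definition bounded_op_on :: "'a :: complex_hilbert set \<Rightarrow> ('a \<Rightarrow> 'a) \<Rightarrow> bool" where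
  "bounded_op_on M T \<longleftrightarrow> T \<in> M \<rightarrow> M \<and> clinear_on M T \<and> (\<exists>C. \<forall>x\<in>M. norm (T x) \<le> C * norm x)"

definition adjoint_on :: "'a :: complex_hilbert set \<Rightarrow> ('a \<Rightarrow> 'a) \<Rightarrow> 'a \<Rightarrow> 'a" where
  "adjoint_on M T y = (THE z. z \<in> M \<and> (\<forall>x\<in>M. cinner (T x) y = cinner x z))"

definition normal_on :: "'a :: complex_hilbert set \<Rightarrow> ('a \<Rightarrow> 'a) \<Rightarrow> bool" where
  "normal_on M T \<longleftrightarrow> bounded_op_on M T \<and>
     (\<forall>x\<in>M. adjoint_on M T (T x) = T (adjoint_on M T x))"

definition contraction_on :: "'a :: complex_hilbert set \<Rightarrow> ('a \<Rightarrow> 'a) \<Rightarrow> bool" where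
  "contraction_on M T \<longleftrightarrow> bounded_op_on M T \<and> (\<forall>x\<in>M. norm (T x) \<le> norm x)"

definition isometry_on :: "'a :: complex_hilbert set \<Rightarrow> ('a \<Rightarrow> 'a) \<Rightarrow> bool" where
  "isometry_on M T \<longleftrightarrow> bounded_op_on M T \<and> (\<forall>x\<in>M. norm (T x) = norm x)"

definition unitary_on :: "'a :: complex_hilbert set \<Rightarrow> ('a \<Rightarrow> 'a) \<Rightarrow> bool" where
  "unitary_on M T \<longleftrightarrow> bounded_op_on M T \<and>
     (\<forall>x\<in>M. adjoint_on M T (T x) = x \<and> T (adjoint_on M T x) = x)"

definition reduces_on :: "'a :: complex_hilbert set \<Rightarrow> ('a \<Rightarrow> 'a) \<Rightarrow> 'a set \<Rightarrow> bool" where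
  "reduces_on M T N \<longleftrightarrow> closed_csubspace N \<and> N \<subseteq> M \<and> T ` N \<subseteq> N \<and> adjoint_on M T ` N \<subseteq> N"

definition cnu_contraction_on :: "'a :: complex_hilbert set \<Rightarrow> ('a \<Rightarrow> 'a) \<Rightarrow> bool" where
  "cnu_contraction_on M T \<longleftrightarrow> contraction_on M T \<and>
     \<not> (\<exists>N. reduces_on M T N \<and> N \<noteq> {0} \<and> unitary_on N T)"

definition cni_contraction_on :: "'a :: complex_hilbert set \<Rightarrow> ('a \<Rightarrow> 'a) \<Rightarrow> bool" where
  "cni_contraction_on M T \<longleftrightarrow> contraction_on M T \<and>
     \<not> (\<exists>N. reduces_on M T N \<and> N \<noteq> {0} \<and> isometry_on N T)"

definition orthogonal_decomposition :: "'a :: complex_hilbert set \<Rightarrow> 'a set \<Rightarrow> 'a set \<Rightarrow> bool" where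
  "orthogonal_decomposition M M1 M2 \<longleftrightarrow>
     closed_csubspace M1 \<and> closed_csubspace M2 \<and> M1 \<subseteq> M \<and> M2 \<subseteq> M \<and>
     (\<forall>x\<in>M1. \<forall>y\<in>M2. cinner x y = 0) \<and> (\<forall>x\<in>M. \<exists>y\<in>M1. \<exists>z\<in>M2. x = y + z)"

definition levan_decomposition ::
    "'a :: complex_hilbert set \<Rightarrow> ('a \<Rightarrow> 'a) \<Rightarrow> 'a set \<Rightarrow> 'a set \<Rightarrow> bool" where
  "levan_decomposition M P M1 M2 \<longleftrightarrow> orthogonal_decomposition M M1 M2 \<and>
     reduces_on M P M1 \<and> reduces_on M P M2 \<and>
     cnu_contraction_on M1 P \<and> isometry_on M1 P \<and> cni_contraction_on M2 P"

text \<open>The maximal invariant subspace is the one containing every other.\<close>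

definition maximal_isometric_subspace ::
    "'a :: complex_hilbert set \<Rightarrow> ('a \<Rightarrow> 'a) \<Rightarrow> 'a set \<Rightarrow> bool" where
  "maximal_isometric_subspace M P N \<longleftrightarrow>
     closed_csubspace N \<and> N \<subseteq> M \<and> P ` N \<subseteq> N \<and> isometry_on N P \<and>
     (\<forall>L. closed_csubspace L \<and> L \<subseteq> M \<and> P ` L \<subseteq> L \<and> isometry_on L P \<longrightarrow> L \<subseteq> N)"


section \<open>The Taylor joint spectrum\<close>

text \<open>
  An \<open>n\<close>-tuple is indexed by \<open>{1..n}\<close>: operators \<open>T 1, \<dots>, T n\<close>, and points of \<open>\<complex>\<^sup>n\<close> as elements of
  the set below, whose topology is that of the product space \<open>nat \<Rightarrow> complex\<close>.
\<close>

definition Cn :: "nat \<Rightarrow> (nat \<Rightarrow> complex) set" where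
  "Cn n = {1..n} \<rightarrow>\<^sub>E UNIV"

definition commuting_tuple_on ::
    "nat \<Rightarrow> 'a :: complex_hilbert set \<Rightarrow> (nat \<Rightarrow> 'a \<Rightarrow> 'a) \<Rightarrow> bool" where
  "commuting_tuple_on n M T \<longleftrightarrow> (\<forall>i\<in>{1..n}. bounded_op_on M (T i)) \<and>
     (\<forall>i\<in>{1..n}. \<forall>j\<in>{1..n}. \<forall>x\<in>M. T i (T j x) = T j (T i x))"

text \<open>
  The Koszul complex \<open>M \<otimes> \<Lambda>\<^sup>k \<complex>\<^sup>n\<close>.  The chain \<open>x\<close> stands for the sum of \<open>x I \<otimes> e\<^sub>I\<close> over the
  \<open>k\<close>-subsets \<open>I\<close> of \<open>{1..n}\<close>, where \<open>e\<^sub>I\<close> is the wedge product of the \<open>e\<^sub>i\<close> with \<open>i \<in> I\<close> in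
  increasing order; the differential is the sum of \<open>T i \<otimes> (e\<^sub>i \<and> _)\<close>.
\<close>

definition koszul_chain :: "nat \<Rightarrow> nat \<Rightarrow> 'a :: complex_hilbert set \<Rightarrow> (nat set \<Rightarrow> 'a) set" where
  "koszul_chain n k M =
     {x. \<forall>I. if I \<subseteq> {1..n} \<and> card I = k then x I \<in> M else x I = 0}"

definition koszul_diff ::
    "nat \<Rightarrow> (nat \<Rightarrow> 'a :: complex_hilbert \<Rightarrow> 'a) \<Rightarrow> (nat set \<Rightarrow> 'a) \<Rightarrow> nat set \<Rightarrow> 'a" where
  "koszul_diff n T x = (\<lambda>I. if I \<subseteq> {1..n}
     then (\<Sum>i\<in>I. (- 1) ^ card {j \<in> I. j < i} *\<^sub>R T i (x (I - {i}))) else 0)"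

definition koszul_exact :: "nat \<Rightarrow> 'a :: complex_hilbert set \<Rightarrow> (nat \<Rightarrow> 'a \<Rightarrow> 'a) \<Rightarrow> bool" where
  "koszul_exact n M T \<longleftrightarrow>
     (\<forall>x\<in>koszul_chain n 0 M. koszul_diff n T x = (\<lambda>_. 0) \<longrightarrow> x = (\<lambda>_. 0)) \<and>
     (\<forall>k<n. \<forall>x\<in>koszul_chain n (Suc k) M. koszul_diff n T x = (\<lambda>_. 0) \<longrightarrow>
        (\<exists>y\<in>koszul_chain n k M. koszul_diff n T y = x))"

definition taylor_spectrum ::
    "nat \<Rightarrow> 'a :: complex_hilbert set \<Rightarrow> (nat \<Rightarrow> 'a \<Rightarrow> 'a) \<Rightarrow> (nat \<Rightarrow> complex) set" where
  "taylor_spectrum n M T = {z \<in> Cn n. \<not> koszul_exact n M (\<lambda>i x. T i x - z i *\<^sub>C x)}"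


section \<open>Spectral sets\<close>

text \<open>Polynomials in \<open>z\<^sub>1, \<dots>, z\<^sub>n\<close>, as finitely supported maps from exponents to coefficients.\<close>

type_synonym cpoly = "(nat \<Rightarrow>\<^sub>0 nat) \<Rightarrow>\<^sub>0 complex"

definition cpolys :: "nat \<Rightarrow> cpoly set" where
  "cpolys n = {p. \<forall>m\<in>Poly_Mapping.keys p. Poly_Mapping.keys m \<subseteq> {1..n}}"

definition poly_at :: "nat \<Rightarrow> cpoly \<Rightarrow> (nat \<Rightarrow> complex) \<Rightarrow> complex" where
  "poly_at n p z = (\<Sum>m\<in>Poly_Mapping.keys p. Poly_Mapping.lookup p m *
     (\<Prod>i\<in>{1..n}. z i ^ Poly_Mapping.lookup m i))"

definition poly_op ::
    "nat \<Rightarrow> cpoly \<Rightarrow> (nat \<Rightarrow> 'a :: complex_hilbert \<Rightarrow> 'a) \<Rightarrow> 'a \<Rightarrow> 'a" where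
  "poly_op n p T x =
     (\<Sum>m\<in>Poly_Mapping.keys p. Poly_Mapping.lookup p m *\<^sub>C
        foldr (\<lambda>i. T i ^^ Poly_Mapping.lookup m i) [1..<Suc n] x)"

text \<open>
  A rational function with poles off \<open>K\<close> is \<open>p / q\<close> with \<open>q\<close> zero-free on \<open>K\<close>, and its value at \<open>T\<close>
  is \<open>p(T) q(T)\<inverse>\<close>.  That \<open>q(T)\<close> is invertible is automatic when \<open>K\<close> contains the joint spectrum
  (spectral mapping theorem); the clause \<open>bij_betw\<close> records that the rational function can be
  evaluated at \<open>T\<close>, so that \<open>inv_into\<close> is the inverse operator.
\<close>

definition spectral_set ::
    "nat \<Rightarrow> 'a :: complex_hilbert set \<Rightarrow> (nat \<Rightarrow> 'a \<Rightarrow> 'a) \<Rightarrow> (nat \<Rightarrow> complex) set \<Rightarrow> bool" where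
  "spectral_set n M T K \<longleftrightarrow> K \<subseteq> Cn n \<and> compact K \<and> taylor_spectrum n M T \<subseteq> K \<and>
     (\<forall>p\<in>cpolys n. \<forall>q\<in>cpolys n. (\<forall>z\<in>K. poly_at n q z \<noteq> 0) \<longrightarrow>
        bij_betw (poly_op n q T) M M \<and>
        (\<forall>x\<in>M. norm (poly_op n p T (inv_into M (poly_op n q T) x))
           \<le> (SUP z\<in>K. cmod (poly_at n p z / poly_at n q z)) * norm x))"


section \<open>The symmetrized polydisc and its operator classes\<close>

definition symm_map :: "nat \<Rightarrow> (nat \<Rightarrow> complex) \<Rightarrow> nat \<Rightarrow> complex" where
  "symm_map n z = (\<lambda>k\<in>{1..n}. \<Sum>I | I \<subseteq> {1..n} \<and> card I = k. \<Prod>i\<in>I. z i)"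

definition Gamma_set :: "nat \<Rightarrow> (nat \<Rightarrow> complex) set" where
  "Gamma_set n = symm_map n ` ({1..n} \<rightarrow>\<^sub>E cball 0 1)"

definition bGamma_set :: "nat \<Rightarrow> (nat \<Rightarrow> complex) set" where
  "bGamma_set n = symm_map n ` ({1..n} \<rightarrow>\<^sub>E sphere 0 1)"

text \<open>
  In the following tuples the last entry \<open>T n\<close> plays the role of \<open>P\<close>, the others being
  \<open>S\<^sub>1, \<dots>, S\<^sub>n\<^sub>-\<^sub>1\<close>.
\<close>

definition Gamma_contraction ::
    "nat \<Rightarrow> 'a :: complex_hilbert set \<Rightarrow> (nat \<Rightarrow> 'a \<Rightarrow> 'a) \<Rightarrow> bool" where
  "Gamma_contraction n M T \<longleftrightarrow> closed_csubspace M \<and> commuting_tuple_on n M T \<and>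
     spectral_set n M T (Gamma_set n)"

definition Gamma_unitary ::
    "nat \<Rightarrow> 'a :: complex_hilbert set \<Rightarrow> (nat \<Rightarrow> 'a \<Rightarrow> 'a) \<Rightarrow> bool" where
  "Gamma_unitary n M T \<longleftrightarrow> closed_csubspace M \<and> commuting_tuple_on n M T \<and>
     (\<forall>i\<in>{1..n}. normal_on M (T i)) \<and> taylor_spectrum n M T \<subseteq> bGamma_set n"

text \<open>
  The extension space \<open>K\<close> of a \<open>\<Gamma>\<^sub>n\<close>-isometry contains \<open>M\<close> up to the isometric identification \<open>V\<close>.
  Taking \<open>K\<close> inside \<open>'a ell2\<close> is no loss of generality: any extension may be cut down to the smallest
  subspace containing \<open>M\<close> and reducing every \<open>N i\<close>, which is again a \<open>\<Gamma>\<^sub>n\<close>-unitary extension and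
  is spanned by countably many images of \<open>M\<close>, hence embeds isometrically into \<open>'a ell2\<close>.
\<close>

definition Gamma_isometry ::
    "nat \<Rightarrow> 'a :: complex_hilbert set \<Rightarrow> (nat \<Rightarrow> 'a \<Rightarrow> 'a) \<Rightarrow> bool" where
  "Gamma_isometry n M T \<longleftrightarrow> closed_csubspace M \<and> (\<forall>i\<in>{1..n}. bounded_op_on M (T i)) \<and>
     (\<exists>(K :: 'a ell2 set) N V. Gamma_unitary n K N \<and>
        V \<in> M \<rightarrow> K \<and> clinear_on M V \<and> (\<forall>x\<in>M. norm (V x) = norm x) \<and>
        (\<forall>i\<in>{1..n}. \<forall>x\<in>M. N i (V x) = V (T i x)))"

definition cnu_Gamma_contraction ::
    "nat \<Rightarrow> 'a :: complex_hilbert set \<Rightarrow> (nat \<Rightarrow> 'a \<Rightarrow> 'a) \<Rightarrow> bool" where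
  "cnu_Gamma_contraction n M T \<longleftrightarrow> Gamma_contraction n M T \<and> cnu_contraction_on M (T n)"

definition cni_Gamma_contraction ::
    "nat \<Rightarrow> 'a :: complex_hilbert set \<Rightarrow> (nat \<Rightarrow> 'a \<Rightarrow> 'a) \<Rightarrow> bool" where
  "cni_Gamma_contraction n M T \<longleftrightarrow> Gamma_contraction n M T \<and> cni_contraction_on M (T n)"

definition cnu_Gamma_isometry ::
    "nat \<Rightarrow> 'a :: complex_hilbert set \<Rightarrow> (nat \<Rightarrow> 'a \<Rightarrow> 'a) \<Rightarrow> bool" where
  "cnu_Gamma_isometry n M T \<longleftrightarrow> Gamma_isometry n M T \<and> cnu_contraction_on M (T n)"

end

theory Submission
  imports Defs "HOL-Complex_Analysis.Conformal_Mappings"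
    "HOL-Computational_Algebra.Fundamental_Theorem_Algebra"
begin

text \<open>
  The proof rests on one inequality for scalars.  Write \<open>s\<^sub>1, \<dots>, s\<^sub>n\<close> for the elementary symmetric
  functions of \<open>z \<in> \<complex>\<^sup>n\<close>.  On the torus \<open>s\<^bsub>n-i\<^esub>\<close> is \<open>s\<^sub>n\<close> times the conjugate of \<open>s\<^sub>i\<close>, so for large
  \<open>k\<close> and \<open>\<bar>b\<bar> = 1\<close> the quotient \<open>(k b s\<^sub>n - s\<^bsub>n-i\<^esub>) / (k - b s\<^sub>i)\<close> is unimodular there, and by the maximum
  principle it is bounded by \<open>1\<close> on the symmetrized polydisc (\<open>esym_moebius_bound\<close>).  Applied to a
  contraction \<open>(S\<^sub>1, \<dots>, S\<^bsub>n-1\<^esub>, P)\<close> this gives, with \<open>\<phi>(x, y) = \<langle>S\<^sub>i x, y\<rangle> - \<langle>P x, S\<^bsub>n-i\<^esub> y\<rangle>\<close>, the estimate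
  \<open>\<bar>\<phi>(x, x)\<bar> \<le> k (\<parallel>x\<parallel>\<^sup>2 - \<parallel>P x\<parallel>\<^sup>2)\<close> (\<open>defect_bound\<close>).  Where \<open>P* P x = x\<close> the right-hand side vanishes to
  second order, so the first-order terms of the left-hand side vanish as well:
  \<open>S\<^sub>i x = S\<^bsub>n-i\<^esub>* P x\<close> and \<open>S\<^sub>i* x = P* S\<^bsub>n-i\<^esub> x\<close> (\<open>fundamental_relation\<close>).  This holds in particular on the
  isometric summand \<open>H1\<close>, and replaces the fundamental operators of the contraction.

  That \<open>H1\<close> reduces \<open>S\<^sub>i\<close> follows from the fact that \<open>H1\<close> absorbs isometric subspaces.  If \<open>P*\<close>
  commutes with the \<open>S\<^sub>i\<close>, then \<open>S\<^sub>i H1\<close> and \<open>S\<^sub>i* H1\<close> are invariant under \<open>P\<close> and \<open>P*\<close> and \<open>P\<close> is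
  isometric on them, and a subspace of this kind lies in \<open>H1\<close> because its projection to \<open>H2\<close> would
  otherwise reduce \<open>P\<close> to an isometry (\<open>levan_isometric_part_contains\<close>).  If \<open>H1\<close> is maximal among all
  isometric invariant subspaces, invariance of \<open>S\<^sub>i H1\<close> under \<open>P\<close> alone is enough, and the isometry
  property \<open>P* P S\<^sub>i x = S\<^sub>i x\<close> comes from the relation (\<open>maximal_isometric_part_reduces\<close>).

  The property of having a given spectral set, Taylor spectrum included, passes to a reducing subspace
  by projecting (\<open>spectral_set_restrict\<close>); this settles the summand \<open>H2\<close>.

  On \<open>H1\<close> a unitary extension of the whole tuple over the distinguished boundary is needed.  Let \<open>U\<close> be
  the minimal unitary extension of the isometry \<open>P\<close>.  Every operator commuting with \<open>P\<close> extends, in a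
  multiplicative way, to one commuting with \<open>U\<close>, namely as the limit of \<open>U\<^sup>-\<^sup>k X U\<^sup>k\<close> in a suitable sense
  (\<open>extend_tendsto\<close>).  The relation turns the adjoint of the extension of \<open>S\<^sub>i\<close> into \<open>U\<inverse>\<close> times the
  extension of \<open>S\<^bsub>n-i\<^esub>\<close>, so the extended tuple is a commuting tuple of normal operators.  Its Taylor
  spectrum is computed by algebra: the Koszul complex is exact as soon as one linear combination of the
  operators is invertible (\<open>koszul_exact_if_combination_invertible\<close>), and for a point off the
  distinguished boundary either \<open>U - z\<^sub>n\<close> or the value of an affine form \<open>\<Prod>(w - z\<^sub>i)\<close> with \<open>\<bar>w\<bar> > 1\<close> is such a
  combination (\<open>extend_Gamma_unitary\<close>).
\<close>


section \<open>Complex Hilbert spaces\<close>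

lemma cinner_add_right: "cinner x (y + z) = cinner x y + cinner x (z :: 'a :: complex_hilbert)"
  by (metis cinner_add_left cinner_commute complex_cnj_add)

lemma cinner_scaleC_right: "cinner x (a *\<^sub>C y) = cnj a * cinner x (y :: 'a :: complex_hilbert)"
  by (metis cinner_scaleC_left cinner_commute complex_cnj_mult)

lemma scaleC_one [simp]: "1 *\<^sub>C x = (x :: 'a :: complex_hilbert)"
  using scaleR_scaleC[of 1 x] by simp

lemma scaleC_zero_left [simp]: "0 *\<^sub>C x = (0 :: 'a :: complex_hilbert)"
  using scaleR_scaleC[of 0 x] by simp

lemma scaleC_minus_one: "(- 1) *\<^sub>C x = - (x :: 'a :: complex_hilbert)"
  using scaleR_scaleC[of "- 1" x] by simp

lemma scaleC_zero_right [simp]: "a *\<^sub>C 0 = (0 :: 'a :: complex_hilbert)"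
  by (metis scaleC_scaleC scaleC_zero_left mult_zero_right)

lemma scaleC_minus_left: "(- a) *\<^sub>C x = - (a *\<^sub>C x :: 'a :: complex_hilbert)"
  by (metis add.commute add.right_inverse minus_unique scaleC_add_left scaleC_zero_left)

lemma scaleC_minus_right: "a *\<^sub>C (- x) = - (a *\<^sub>C x :: 'a :: complex_hilbert)"
  by (metis add.right_inverse minus_unique scaleC_add_right scaleC_zero_right)

lemma scaleC_diff_right: "a *\<^sub>C (x - y) = a *\<^sub>C x - a *\<^sub>C (y :: 'a :: complex_hilbert)"
  by (metis diff_conv_add_uminus scaleC_add_right scaleC_minus_right)

lemma scaleC_sum_right: "a *\<^sub>C (\<Sum>i\<in>I. f i) = (\<Sum>i\<in>I. a *\<^sub>C (f i :: 'a :: complex_hilbert))"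
  by (induction I rule: infinite_finite_induct) (auto simp: scaleC_add_right)

lemma cinner_zero_left [simp]: "cinner 0 (x :: 'a :: complex_hilbert) = 0"
  using cinner_add_left[of 0 0 x] by simp

lemma cinner_zero_right [simp]: "cinner (x :: 'a :: complex_hilbert) 0 = 0"
  using cinner_add_right[of x 0 0] by simp

lemma cinner_minus_left: "cinner (- x) y = - cinner x (y :: 'a :: complex_hilbert)"
  using cinner_scaleC_left[of "- 1" x y] by (simp add: scaleC_minus_one)

lemma cinner_minus_right: "cinner x (- y) = - cinner x (y :: 'a :: complex_hilbert)"
  using cinner_scaleC_right[of x "- 1" y] by (simp add: scaleC_minus_one)

lemma cinner_diff_left: "cinner (x - y) z = cinner x z - cinner y (z :: 'a :: complex_hilbert)"
  by (metis cinner_add_left cinner_minus_left diff_conv_add_uminus)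

lemma cinner_diff_right: "cinner x (y - z) = cinner x y - cinner x (z :: 'a :: complex_hilbert)"
  by (metis cinner_add_right cinner_minus_right diff_conv_add_uminus)

lemmas cinner_expand = cinner_add_left cinner_add_right cinner_diff_left cinner_diff_right
  cinner_scaleC_left cinner_scaleC_right cinner_minus_left cinner_minus_right

lemma Re_cinner_self: "Re (cinner x x) = (norm (x :: 'a :: complex_hilbert))\<^sup>2"
  by (simp add: cinner_self)

lemma cinner_self_eq_0 [simp]: "cinner x x = 0 \<longleftrightarrow> (x :: 'a :: complex_hilbert) = 0"
  by (simp add: cinner_self)

lemma cinner_ext_right:
  fixes y z :: "'a :: complex_hilbert"
  assumes "\<And>x. cinner x y = cinner x z"
  shows "y = z"
proof -
  have "cinner (y - z) (y - z) = 0" using assms[of "y - z"] by (simp add: cinner_diff_right)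
  then show ?thesis by simp
qed

lemma cinner_ext_left:
  fixes y z :: "'a :: complex_hilbert"
  assumes "\<And>x. cinner y x = cinner z x"
  shows "y = z"
proof -
  have "cinner (y - z) (y - z) = 0" using assms[of "y - z"] by (simp add: cinner_diff_left)
  then show ?thesis by simp
qed

lemma norm_add_square:
  "(norm (x + y))\<^sup>2 = (norm x)\<^sup>2 + 2 * Re (cinner x y) + (norm (y :: 'a :: complex_hilbert))\<^sup>2"
proof -
  have "Re (cinner y x) = Re (cinner x y)" by (subst cinner_commute) simp
  then show ?thesis
    unfolding Re_cinner_self[symmetric] by (simp add: cinner_expand)
qed

lemma norm_diff_square:
  "(norm (x - y))\<^sup>2 = (norm x)\<^sup>2 - 2 * Re (cinner x y) + (norm (y :: 'a :: complex_hilbert))\<^sup>2"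
  using norm_add_square[of x "- y"] by (simp add: cinner_minus_right)

lemma bounded_bilinear_cinner: "bounded_bilinear (cinner :: 'a :: complex_hilbert \<Rightarrow> 'a \<Rightarrow> complex)"
proof
  show "\<exists>K. \<forall>a b :: 'a. norm (cinner a b) \<le> norm a * norm b * K"
    by (rule exI[of _ 2]) (metis cmod_cinner_le mult.commute)
qed (simp_all add: cinner_expand scaleR_scaleC scaleR_conv_of_real)

lemmas tendsto_cinner = bounded_bilinear.tendsto[OF bounded_bilinear_cinner]

lemma bounded_linear_scaleC: "bounded_linear (\<lambda>x :: 'a :: complex_hilbert. c *\<^sub>C x)"
proof
  show "\<exists>K. \<forall>x :: 'a. norm (c *\<^sub>C x) \<le> norm x * K"
    by (rule exI[of _ "cmod c"]) (simp add: norm_scaleC)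
qed (simp_all add: scaleC_add_right scaleR_scaleC scaleC_scaleC mult.commute)

lemmas tendsto_scaleC = bounded_linear.tendsto[OF bounded_linear_scaleC]


section \<open>Adjoints\<close>

text \<open>
  Riesz' theorem by the Dirichlet principle: the representing vector is the minimiser of
  \<open>J x = \<parallel>x\<parallel>\<^sup>2 - 2 Re (f x)\<close>.  The parallelogram law turns a minimising sequence into a Cauchy
  sequence, and the first variation of \<open>J\<close> at the minimiser is the representation.
\<close>

lemma riesz_representation:
  fixes f :: "'a :: complex_hilbert \<Rightarrow> complex"
  assumes add: "\<And>x y. f (x + y) = f x + f y"
    and scale: "\<And>c x. f (c *\<^sub>C x) = c * f x"
    and bnd: "\<And>x. cmod (f x) \<le> C * norm x"
  shows "\<exists>z. \<forall>x. f x = cinner x z"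
proof -
  interpret f: bounded_linear f
    by (rule bounded_linear_intro[of _ C])
      (use add scale bnd in \<open>auto simp: scaleR_scaleC scaleR_conv_of_real mult.commute\<close>)
  define J where "J x = (norm x)\<^sup>2 - 2 * Re (f x)" for x
  have J_bdd: "- C\<^sup>2 \<le> J x" for x
  proof -
    have "Re (f x) \<le> C * norm x" using bnd[of x] complex_Re_le_cmod[of "f x"] by linarith
    moreover have "0 \<le> (norm x - C)\<^sup>2" by simp
    ultimately show ?thesis unfolding J_def power2_diff by (simp add: mult.commute)
  qed
  define m where "m = Inf (range J)"
  have bdd: "bdd_below (range J)" by (rule bdd_belowI2[OF J_bdd])
  have m_le: "m \<le> J x" for x unfolding m_def by (rule cInf_lower[OF _ bdd]) auto
  have "\<exists>x. J x < m + 1 / real (Suc k)" for k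
    using cInf_lessD[of "range J" "m + 1 / real (Suc k)"] unfolding m_def by auto
  then obtain X where X: "\<And>k. J (X k) < m + 1 / real (Suc k)" by metis
  have par: "(norm (x - y))\<^sup>2 \<le> 2 * (J x + J y - 2 * m)" for x y
  proof -
    have half: "f ((1/2) *\<^sub>R (x + y)) = (f x + f y) / 2"
      by (simp add: f.scaleR add scaleR_conv_of_real)
    have "(norm (x - y))\<^sup>2 = 2 * (J x + J y - 2 * J ((1/2) *\<^sub>R (x + y)))"
      unfolding J_def half norm_diff_square norm_scaleR power_mult_distrib norm_add_square
      by (simp add: field_simps power2_eq_square)
    then show ?thesis using m_le[of "(1/2) *\<^sub>R (x + y)"] by simp
  qed
  have "Cauchy X"
    unfolding Cauchy_iff
  proof (intro allI impI)
    fix e :: real assume e: "0 < e"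
    obtain M :: nat where M: "4 / e\<^sup>2 < M" using reals_Archimedean2 by blast
    have "norm (X k - X l) < e" if "M \<le> k" "M \<le> l" for k l
    proof -
      have "0 < real M" using M e by (smt (verit) zero_less_power divide_pos_pos)
      have le: "1 / real (Suc j) < e\<^sup>2 / 4" if "M \<le> j" for j
      proof -
        have "4 / e\<^sup>2 < real (Suc j)" using M that by linarith
        then show ?thesis using e by (simp add: field_simps)
      qed
      have "(norm (X k - X l))\<^sup>2 < e\<^sup>2"
        using par[of "X k" "X l"] X[of k] X[of l] le[OF that(1)] le[OF that(2)] by argo
      then show ?thesis using e by (simp add: power_less_imp_less_base)
    qed
    then show "\<exists>M. \<forall>k\<ge>M. \<forall>l\<ge>M. norm (X k - X l) < e" by blast
  qed
  then obtain z where z: "X \<longlonglongrightarrow> z" using Cauchy_convergent_iff convergent_def by blast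
  have "J z \<le> m"
  proof (rule LIMSEQ_le)
    show "(\<lambda>k. J (X k)) \<longlonglongrightarrow> J z" unfolding J_def by (intro tendsto_intros f.tendsto z)
    show "(\<lambda>k. m + 1 / real (Suc k)) \<longlonglongrightarrow> m"
      using tendsto_add[OF tendsto_const LIMSEQ_Suc[OF lim_1_over_n], of m] by simp
    show "\<exists>N. \<forall>k\<ge>N. J (X k) \<le> m + 1 / real (Suc k)" using X less_imp_le by blast
  qed
  then have min: "J z \<le> J x" for x using m_le[of x] by linarith
  have re: "Re (cinner x z) = Re (f x)" for x
  proof -
    define d where "d = Re (cinner x z) - Re (f x)"
    have quad: "0 \<le> t\<^sup>2 * (norm x)\<^sup>2 + 2 * t * d" for t :: real
    proof -
      have "Re (cinner z x) = Re (cinner x z)" by (subst cinner_commute) simp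
      then have "J (z + t *\<^sub>R x) = J z + (t\<^sup>2 * (norm x)\<^sup>2 + 2 * t * d)"
        unfolding J_def d_def norm_add_square
        by (simp add: f.add scale scaleR_scaleC cinner_scaleC_right norm_scaleC
            power_mult_distrib algebra_simps)
      then show ?thesis using min[of "z + t *\<^sub>R x"] by simp
    qed
    have "d = 0"
    proof (rule ccontr)
      assume d: "d \<noteq> 0"
      \<comment> \<open>The step \<open>t = - d / N\<close> nearly minimises the quadratic; adding \<open>1\<close> keeps \<open>N\<close> positive for \<open>x = 0\<close>.\<close>
      define N where "N = (norm x)\<^sup>2 + 1"
      have N: "0 < N" unfolding N_def by (simp add: add_nonneg_pos)
      have "0 \<le> (- d / N)\<^sup>2 * (norm x)\<^sup>2 + 2 * (- d / N) * d" by (rule quad)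
      also have "\<dots> \<le> (- d / N)\<^sup>2 * N + 2 * (- d / N) * d"
        unfolding N_def by (intro add_right_mono mult_left_mono) auto
      also have "\<dots> = - d\<^sup>2 / N" using N by (simp add: power2_eq_square field_simps)
      finally show False using N d by (simp add: field_simps)
    qed
    then show ?thesis unfolding d_def by simp
  qed
  have "f x = cinner x z" for x
  proof (rule complex_eqI)
    show "Re (f x) = Re (cinner x z)" using re by simp
    show "Im (f x) = Im (cinner x z)"
      using re[of "\<i> *\<^sub>C x"] by (simp add: scale cinner_scaleC_left)
  qed
  then show ?thesis by blast
qed

lemma adjoint_on_eqI:
  assumes "closed_csubspace M" "z \<in> M" "\<And>x. x \<in> M \<Longrightarrow> cinner (T x) y = cinner x z"
  shows "adjoint_on M T y = z"
  unfolding adjoint_on_def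
proof (rule the_equality)
  show "z \<in> M \<and> (\<forall>x\<in>M. cinner (T x) y = cinner x z)" using assms by blast
  fix w assume w: "w \<in> M \<and> (\<forall>x\<in>M. cinner (T x) y = cinner x w)"
  have "w - z \<in> M"
    using assms(1,2) w scaleC_minus_one[of z] unfolding closed_csubspace_def
    by (metis diff_conv_add_uminus)
  then have "cinner (w - z) w = cinner (w - z) z" using w assms(3) by metis
  then show "w = z" by (metis cinner_diff_right cinner_self_eq_0 right_minus_eq)
qed

lemma closed_csubspace_UNIV [simp]: "closed_csubspace UNIV"
  by (simp add: closed_csubspace_def)

lemma bounded_op_on_UNIV_bounded_linear:
  "bounded_op_on UNIV T \<Longrightarrow> bounded_linear T"
proof -
  assume T: "bounded_op_on UNIV T"
  then obtain C where C: "\<And>x. norm (T x) \<le> C * norm x" unfolding bounded_op_on_def by blast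
  show ?thesis
    by (rule bounded_linear_intro[of _ C])
      (use T C in \<open>auto simp: bounded_op_on_def clinear_on_def scaleR_scaleC mult.commute\<close>)
qed

lemma cinner_adjoint_UNIV:
  assumes T: "bounded_op_on UNIV T"
  shows "cinner (T x) y = cinner x (adjoint_on UNIV T y)"
proof -
  obtain C where C: "\<And>x. norm (T x) \<le> C * norm x" using T unfolding bounded_op_on_def by blast
  have "\<exists>z. \<forall>x. cinner (T x) y = cinner x z"
  proof (rule riesz_representation)
    show "cinner (T (u + v)) y = cinner (T u) y + cinner (T v) y" for u v
      using T by (simp add: bounded_op_on_def clinear_on_def cinner_add_left)
    show "cinner (T (c *\<^sub>C u)) y = c * cinner (T u) y" for c u
      using T by (simp add: bounded_op_on_def clinear_on_def cinner_scaleC_left)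
    show "cmod (cinner (T u) y) \<le> (2 * C * norm y) * norm u" for u
      using order_trans[OF cmod_cinner_le mult_left_mono[OF mult_right_mono[OF C[of u] norm_ge_zero[of y]]]]
      by (simp add: mult_ac)
  qed
  then obtain z where z: "\<And>x. cinner (T x) y = cinner x z" by blast
  then have "adjoint_on UNIV T y = z" by (intro adjoint_on_eqI) auto
  then show ?thesis using z by simp
qed

lemma cinner_adjoint_UNIV_left:
  assumes "bounded_op_on UNIV T"
  shows "cinner (adjoint_on UNIV T x) y = cinner x (T y)"
  using cinner_adjoint_UNIV[OF assms, of y x]
  by (subst cinner_commute, subst cinner_commute[of x]) simp

lemma bounded_op_on_adjoint_UNIV:
  assumes T: "bounded_op_on UNIV T"
  shows "bounded_op_on UNIV (adjoint_on UNIV T)"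
proof -
  let ?A = "adjoint_on UNIV T"
  note adj = cinner_adjoint_UNIV[OF T, symmetric]
  obtain C where C: "\<And>x. norm (T x) \<le> C * norm x" using T unfolding bounded_op_on_def by blast
  have "norm (?A y) \<le> C * norm y" for y
  proof (cases "?A y = 0")
    case True
    then show ?thesis using order_trans[OF norm_ge_zero C[of y]] by simp
  next
    case False
    have "(norm (?A y))\<^sup>2 = Re (cinner (T (?A y)) y)" unfolding Re_cinner_self[symmetric] adj ..
    also have "\<dots> \<le> norm (T (?A y)) * norm y" using Re_cinner_le[of "T (?A y)" y] by linarith
    also have "\<dots> \<le> C * norm (?A y) * norm y" by (intro mult_right_mono C) auto
    finally show ?thesis using False by (simp add: power2_eq_square mult_ac)
  qed
  moreover have "?A (x + y) = ?A x + ?A y" for x y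
    by (rule cinner_ext_right) (simp add: adj cinner_add_right)
  moreover have "?A (c *\<^sub>C x) = c *\<^sub>C ?A x" for c x
    by (rule cinner_ext_right) (simp add: adj cinner_scaleC_right)
  ultimately show ?thesis unfolding bounded_op_on_def clinear_on_def by blast
qed

section \<open>Elementary symmetric functions\<close>

definition esym :: "nat \<Rightarrow> nat \<Rightarrow> (nat \<Rightarrow> complex) \<Rightarrow> complex" where
  "esym n k z = (\<Sum>I | I \<subseteq> {1..n} \<and> card I = k. \<Prod>i\<in>I. z i)"

lemma symm_map_esym: "k \<in> {1..n} \<Longrightarrow> symm_map n z k = esym n k z"
  by (simp add: symm_map_def esym_def)

lemma finite_card_subsets [simp]: "finite {I. I \<subseteq> {1..n::nat} \<and> card I = k}"
  by (rule finite_subset[of _ "Pow {1..n}"]) auto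

lemma esym_0 [simp]: "esym n 0 z = 1"
proof -
  have "{I. I \<subseteq> {1..n} \<and> card I = 0} = {{}}" by (auto dest: finite_subset[OF _ finite_atLeastAtMost])
  then show ?thesis by (simp add: esym_def)
qed

lemma esym_n: "esym n n z = (\<Prod>i\<in>{1..n}. z i)"
proof -
  have "I = {1..n}" if "I \<subseteq> {1..n}" "card I = n" for I
    using card_subset_eq[of "{1..n}" I] that by simp
  then have "{I. I \<subseteq> {1..n} \<and> card I = n} = {{1..n}}" by auto
  then show ?thesis by (simp add: esym_def)
qed

lemma norm_esym_le:
  assumes "\<And>i. i \<in> {1..n} \<Longrightarrow> cmod (z i) \<le> 1"
  shows "cmod (esym n k z) \<le> 2 ^ n"
proof -
  have "cmod (esym n k z) \<le> (\<Sum>I | I \<subseteq> {1..n} \<and> card I = k. 1)"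
    unfolding esym_def
    by (rule sum_norm_le) (use assms in \<open>auto simp: prod_norm[symmetric] subset_iff intro!: prod_le_1\<close>)
  also have "\<dots> \<le> real (card (Pow {1..n}))"
    by (simp, rule card_mono) auto
  finally show ?thesis by (simp add: card_Pow)
qed

text \<open>On the torus, the product over a set of indices is the full product times the conjugate of
  the product over the complement.\<close>

lemma esym_torus:
  assumes z: "\<And>i. i \<in> {1..n} \<Longrightarrow> cmod (z i) = 1" and k: "k \<le> n"
  shows "esym n (n - k) z = cnj (esym n k z) * esym n n z"
proof -
  have "cnj (esym n k z) * esym n n z
      = (\<Sum>I | I \<subseteq> {1..n} \<and> card I = k. cnj (\<Prod>i\<in>I. z i) * (\<Prod>i\<in>{1..n}. z i))"
    unfolding esym_n by (simp only: esym_def cnj_sum sum_distrib_right)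
  also have "\<dots> = (\<Sum>J | J \<subseteq> {1..n} \<and> card J = n - k. \<Prod>i\<in>J. z i)"
  proof (rule sum.reindex_bij_witness[of _ "\<lambda>J. {1..n} - J" "\<lambda>I. {1..n} - I"])
    fix I assume "I \<in> {I. I \<subseteq> {1..n} \<and> card I = k}"
    then have I: "I \<subseteq> {1..n}" "card I = k" "finite I" by (auto intro: finite_subset)
    show "{1..n} - ({1..n} - I) = I" using I by auto
    show "{1..n} - I \<in> {J. J \<subseteq> {1..n} \<and> card J = n - k}" using I by (simp add: card_Diff_subset)
    have "cnj (\<Prod>i\<in>I. z i) * (\<Prod>i\<in>I. z i) = (\<Prod>i\<in>I. cnj (z i) * z i)"
      by (simp add: prod.distrib)
    also have "\<dots> = 1"
      using z I by (intro prod.neutral) (auto simp: complex_norm_square[symmetric] mult.commute)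
    finally have one: "cnj (\<Prod>i\<in>I. z i) * (\<Prod>i\<in>I. z i) = 1" .
    have "(\<Prod>i\<in>{1..n}. z i) = (\<Prod>i\<in>{1..n} - I. z i) * (\<Prod>i\<in>I. z i)"
      using I by (intro prod.subset_diff) auto
    then have "cnj (\<Prod>i\<in>I. z i) * (\<Prod>i\<in>{1..n}. z i)
        = (\<Prod>i\<in>{1..n} - I. z i) * (cnj (\<Prod>i\<in>I. z i) * (\<Prod>i\<in>I. z i))"
      by (simp only: mult.left_commute)
    then show "(\<Prod>i\<in>{1..n} - I. z i) = cnj (\<Prod>i\<in>I. z i) * (\<Prod>i\<in>{1..n}. z i)"
      unfolding one by simp
  next
    fix J assume "J \<in> {J. J \<subseteq> {1..n} \<and> card J = n - k}"
    then have J: "J \<subseteq> {1..n}" "card J = n - k" "finite J" by (auto intro: finite_subset)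
    show "{1..n} - ({1..n} - J) = J" using J by auto
    show "{1..n} - J \<in> {I. I \<subseteq> {1..n} \<and> card I = k}" using J k by (simp add: card_Diff_subset)
  qed
  finally show ?thesis by (simp add: esym_def)
qed

text \<open>Vieta's formula.\<close>

lemma prod_diff_esym:
  "(\<Prod>i\<in>{1..n}. w - z i) = (\<Sum>k\<le>n. (- 1) ^ k * w ^ (n - k) * esym n k z)"
proof -
  have "(\<Prod>i\<in>{1..n}. w - z i) = (\<Prod>i\<in>{1..n}. - z i + w)" by simp
  also have "\<dots> = (\<Sum>I\<in>Pow {1..n}. (\<Prod>i\<in>I. - z i) * (\<Prod>i\<in>{1..n} - I. w))"
    by (rule prod_add) simp
  also have "\<dots> = (\<Sum>I\<in>Pow {1..n}. (- 1) ^ card I * w ^ (n - card I) * (\<Prod>i\<in>I. z i))"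
    by (intro sum.cong refl) (auto simp: prod_uminus card_Diff_subset finite_subset)
  also have "\<dots> = (\<Sum>k\<le>n. \<Sum>I | I \<in> Pow {1..n} \<and> card I = k.
      (- 1) ^ card I * w ^ (n - card I) * (\<Prod>i\<in>I. z i))"
    by (rule sum.group[symmetric]) (auto dest: card_mono[OF finite_atLeastAtMost])
  also have "\<dots> = (\<Sum>k\<le>n. (- 1) ^ k * w ^ (n - k) * esym n k z)"
    unfolding esym_def sum_distrib_left by (intro sum.cong refl) auto
  finally show ?thesis .
qed

text \<open>The symmetrization map is onto: the coordinates of a preimage are the roots of the monic
  polynomial with the prescribed coefficients.\<close>

lemma symm_map_surj:
  assumes l: "l \<in> Cn n"
  shows "\<exists>z \<in> {1..n} \<rightarrow>\<^sub>E UNIV. symm_map n z = l"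
proof -
  define c where "c k = (if k = 0 then 1 else l k)" for k
  define p where "p = (\<Sum>k\<le>n. monom ((- 1) ^ k * c k) (n - k))"
  have coeff_p: "coeff p (n - k) = (- 1) ^ k * c k" if "k \<le> n" for k
  proof -
    have "coeff p (n - k) = (\<Sum>j\<le>n. if j = k then (- 1) ^ j * c j else 0)"
      unfolding p_def coeff_sum coeff_monom using that by (intro sum.cong) auto
    then show ?thesis using that by simp
  qed
  have "degree p \<le> n" unfolding p_def by (intro degree_sum_le) (auto intro: order_trans[OF degree_monom_le])
  moreover have lead: "coeff p n = 1" using coeff_p[of 0] by (simp add: c_def)
  ultimately have deg: "degree p = n" by (simp add: le_antisym le_degree)
  then have "p \<noteq> 0" using lead by auto
  then obtain A where A: "size A = n" "p = (\<Prod>x\<in>#A. [:- x, 1:])"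
    using alg_closed_imp_factorization[of p] deg lead by auto
  obtain xs where xs: "mset xs = A" using ex_mset by blast
  then have len: "length xs = n" using A(1) by auto
  define z where "z = (\<lambda>i\<in>{1..n}. xs ! (i - 1))"
  have poly_p: "poly p w = (\<Prod>i\<in>{1..n}. w - z i)" for w
  proof -
    have "p = (\<Prod>x\<leftarrow>xs. [:- x, 1:])" unfolding A(2) xs[symmetric] by (simp flip: prod_mset_prod_list)
    moreover have "poly (\<Prod>x\<leftarrow>ys. [:- x, 1:]) w = (\<Prod>x\<leftarrow>ys. w - x)" for ys
      by (induction ys) (auto simp: algebra_simps)
    ultimately have "poly p w = (\<Prod>x\<leftarrow>xs. w - x)" by simp
    also have "\<dots> = (\<Prod>j<n. w - xs ! j)" by (simp add: prod.list_conv_set_nth len atLeast0LessThan)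
    also have "\<dots> = (\<Prod>i\<in>{1..n}. w - z i)"
      by (rule prod.reindex_bij_witness[of _ "\<lambda>i. i - 1" Suc]) (auto simp: z_def)
    finally show ?thesis .
  qed
  define q where "q = (\<Sum>k\<le>n. monom ((- 1) ^ k * esym n k z) (n - k))"
  have coeff_q: "coeff q (n - k) = (- 1) ^ k * esym n k z" if "k \<le> n" for k
  proof -
    have "coeff q (n - k) = (\<Sum>j\<le>n. if j = k then (- 1) ^ j * esym n j z else 0)"
      unfolding q_def coeff_sum coeff_monom using that by (intro sum.cong) auto
    then show ?thesis using that by simp
  qed
  have "poly p w = poly q w" for w
    unfolding poly_p prod_diff_esym q_def poly_sum poly_monom by (simp add: mult_ac)
  then have "p = q" by (simp add: poly_eq_poly_eq_iff[symmetric] fun_eq_iff)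
  then have "esym n k z = c k" if "k \<le> n" for k
    using coeff_p[OF that] coeff_q[OF that] by simp
  then have "symm_map n z k = l k" for k
    using l symm_map_esym[of k n z] by (cases "k \<in> {1..n}") (auto simp: c_def Cn_def symm_map_def PiE_def extensional_def)
  then have "symm_map n z = l" by auto
  moreover have "z \<in> {1..n} \<rightarrow>\<^sub>E UNIV" by (simp add: z_def)
  ultimately show ?thesis by blast
qed


lemma esym_holomorphic_in_coordinate: "(\<lambda>w. esym n k (z(j := w))) holomorphic_on A"
proof -
  have "(\<lambda>w. (z(j := w)) i) holomorphic_on A" for i
    by (cases "i = j") (auto intro: holomorphic_intros)
  then show ?thesis unfolding esym_def by (intro holomorphic_intros)
qed

text \<open>
  Maximum modulus on the polydisc: a bound on the torus is carried to the interior one coordinate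
  at a time, \<open>A\<close> being the set of coordinates that have been freed.
\<close>

lemma polydisc_maximum_modulus:
  fixes g h :: "(nat \<Rightarrow> complex) \<Rightarrow> complex"
  assumes hol: "\<And>z j. (\<lambda>w. g (z(j := w))) holomorphic_on UNIV" "\<And>z j. (\<lambda>w. h (z(j := w))) holomorphic_on UNIV"
    and h: "\<And>z. \<forall>i\<in>{1..n}. cmod (z i) \<le> 1 \<Longrightarrow> h z \<noteq> 0"
    and torus: "\<And>z. \<forall>i\<in>{1..n}. cmod (z i) = 1 \<Longrightarrow> cmod (g z) \<le> cmod (h z)"
    and z: "\<forall>i\<in>{1..n}. cmod (z i) \<le> 1"
  shows "cmod (g z) \<le> cmod (h z)"
proof -
  have "finite A \<Longrightarrow> A \<subseteq> {1..n} \<Longrightarrow> \<forall>i\<in>{1..n}. cmod (z i) \<le> 1 \<Longrightarrow>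
      \<forall>i\<in>{1..n} - A. cmod (z i) = 1 \<Longrightarrow> cmod (g z) \<le> cmod (h z)" for A z
  proof (induction A arbitrary: z rule: finite_induct)
    case empty
    then show ?case using torus by simp
  next
    case (insert j A)
    define F where "F w = g (z(j := w)) / h (z(j := w))" for w
    have nz: "h (z(j := w)) \<noteq> 0" if "cmod w \<le> 1" for w
      by (rule h) (use insert.prems that in auto)
    have hF: "F holomorphic_on cball 0 1"
      unfolding F_def
      by (rule holomorphic_on_divide[OF holomorphic_on_subset[OF hol(1)[of z j]]
            holomorphic_on_subset[OF hol(2)[of z j]]]) (simp_all add: nz)
    have "cmod (F (z j)) \<le> 1"
    proof (rule maximum_modulus_frontier[of F "cball 0 1"])
      show "cmod (F w) \<le> 1" if "w \<in> frontier (cball 0 1)" for w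
      proof -
        have w: "cmod w = 1" using that by simp
        have "cmod (g (z(j := w))) \<le> cmod (h (z(j := w)))"
          by (rule insert.IH) (use insert.prems w in auto)
        then show ?thesis using nz[of w] w by (simp add: F_def norm_divide)
      qed
      show "z j \<in> cball 0 1" using insert.prems by auto
      show "continuous_on (closure (cball 0 1)) F"
        using hF by (simp add: holomorphic_on_imp_continuous_on)
      show "F holomorphic_on interior (cball 0 1)"
        by (rule holomorphic_on_subset[OF hF]) auto
    qed auto
    then show ?case using h[OF insert.prems(2)] by (simp add: F_def norm_divide)
  qed
  from this[of "{1..n}" z] show ?thesis using z by simp
qed

text \<open>
  The two sides agree on the torus, because there \<open>esym n (n - i) = cnj (esym n i) * esym n n\<close>.
  The constant \<open>2 ^ n + 1\<close> only has to exceed \<open>\<bar>esym n i\<bar>\<close> on the polydisc, so that the right-hand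
  side has no zero there.
\<close>

lemma esym_moebius_bound:
  assumes z: "\<forall>j\<in>{1..n}. cmod (z j) \<le> 1" and i: "i \<le> n" and b: "cmod b = 1"
  defines "k \<equiv> 2 ^ n + 1"
  shows "cmod (k * b * esym n n z - esym n (n - i) z) \<le> cmod (k - b * esym n i z)"
proof (rule polydisc_maximum_modulus[OF _ _ _ _ z])
  show "k - b * esym n i z \<noteq> 0" if "\<forall>j\<in>{1..n}. cmod (z j) \<le> 1" for z
  proof
    assume "k - b * esym n i z = 0"
    then have "cmod (b * esym n i z) = cmod (of_real (2 ^ n + 1))" by (simp add: k_def)
    also have "\<dots> = 2 ^ n + 1" unfolding norm_of_real by simp
    finally have "cmod (esym n i z) = 2 ^ n + 1" using b by (simp add: norm_mult)
    then show False using norm_esym_le[of n z i] that by auto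
  qed
  show "cmod (k * b * esym n n z - esym n (n - i) z) \<le> cmod (k - b * esym n i z)"
    if "\<forall>j\<in>{1..n}. cmod (z j) = 1" for z
  proof -
    have one: "cmod (esym n n z) = 1"
      unfolding esym_n prod_norm[symmetric] using that by (intro prod.neutral) auto
    have bb: "cnj b * b = 1" using b by (simp add: complex_norm_square[symmetric] mult.commute)
    have "k * b * esym n n z - esym n (n - i) z = b * esym n n z * cnj (k - b * esym n i z)"
      using esym_torus[of n z i] that i bb by (simp add: k_def algebra_simps)
    then show ?thesis by (simp only: norm_mult complex_mod_cnj one b)
  qed
qed (intro holomorphic_intros esym_holomorphic_in_coordinate)+


section \<open>The affine part of the polynomial calculus\<close>

definition affine_poly :: "nat \<Rightarrow> complex \<Rightarrow> (nat \<Rightarrow> complex) \<Rightarrow> cpoly" where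
  "affine_poly n a c =
     Poly_Mapping.single 0 a + (\<Sum>i\<in>{1..n}. Poly_Mapping.single (Poly_Mapping.single i 1) (c i))"

text \<open>Polynomials are evaluated by sums over their support; over a larger index set the same sums
  are additive in the polynomial.\<close>

lemma poly_at_superset:
  assumes "finite A" "Poly_Mapping.keys p \<subseteq> A"
  shows "poly_at n p z = (\<Sum>m\<in>A. Poly_Mapping.lookup p m * (\<Prod>i\<in>{1..n}. z i ^ Poly_Mapping.lookup m i))"
  unfolding poly_at_def by (rule sum.mono_neutral_left) (use assms in \<open>auto simp: in_keys_iff\<close>)

lemma poly_op_superset:
  assumes "finite A" "Poly_Mapping.keys p \<subseteq> A"
  shows "poly_op n p T x = (\<Sum>m\<in>A. Poly_Mapping.lookup p m *\<^sub>C
        foldr (\<lambda>i. T i ^^ Poly_Mapping.lookup m i) [1..<Suc n] x)"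
  unfolding poly_op_def by (rule sum.mono_neutral_left) (use assms in \<open>auto simp: in_keys_iff\<close>)

lemma poly_at_add: "poly_at n (p + q) z = poly_at n p z + poly_at n q z"
proof -
  define A where "A = Poly_Mapping.keys p \<union> Poly_Mapping.keys q"
  have "finite A" "Poly_Mapping.keys p \<subseteq> A" "Poly_Mapping.keys q \<subseteq> A" "Poly_Mapping.keys (p + q) \<subseteq> A"
    using Poly_Mapping.keys_add[of p q] by (auto simp: A_def)
  then show ?thesis
    by (simp add: poly_at_superset[of A] lookup_add distrib_right sum.distrib)
qed

lemma poly_op_add: "poly_op n (p + q) T x = poly_op n p T x + poly_op n q T x"
proof -
  define A where "A = Poly_Mapping.keys p \<union> Poly_Mapping.keys q"
  have "finite A" "Poly_Mapping.keys p \<subseteq> A" "Poly_Mapping.keys q \<subseteq> A" "Poly_Mapping.keys (p + q) \<subseteq> A"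
    using Poly_Mapping.keys_add[of p q] by (auto simp: A_def)
  then show ?thesis
    by (simp add: poly_op_superset[of A] lookup_add scaleC_add_left sum.distrib)
qed

lemma poly_at_single:
  "poly_at n (Poly_Mapping.single m a) z = a * (\<Prod>i\<in>{1..n}. z i ^ Poly_Mapping.lookup m i)"
  by (subst poly_at_superset[of "{m}"]) (auto simp: lookup_single)

lemma poly_op_single:
  "poly_op n (Poly_Mapping.single m a) T x =
     a *\<^sub>C foldr (\<lambda>i. T i ^^ Poly_Mapping.lookup m i) [1..<Suc n] x"
  by (subst poly_op_superset[of "{m}"]) (auto simp: lookup_single)

lemma poly_at_sum: "finite I \<Longrightarrow> poly_at n (\<Sum>i\<in>I. p i) z = (\<Sum>i\<in>I. poly_at n (p i) z)"
  by (induction I rule: finite_induct) (auto simp: poly_at_add, simp add: poly_at_def)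

lemma poly_op_sum: "finite I \<Longrightarrow> poly_op n (\<Sum>i\<in>I. p i) T x = (\<Sum>i\<in>I. poly_op n (p i) T x)"
  by (induction I rule: finite_induct) (auto simp: poly_op_add, simp add: poly_op_def)

lemma poly_at_affine: "poly_at n (affine_poly n a c) z = a + (\<Sum>i\<in>{1..n}. c i * z i)"
proof -
  have "(\<Prod>j\<in>{1..n}. z j ^ Poly_Mapping.lookup (Poly_Mapping.single i 1) j) = z i" if "i \<in> {1..n}" for i
  proof -
    have "(\<Prod>j\<in>{1..n}. z j ^ Poly_Mapping.lookup (Poly_Mapping.single i 1) j)
        = (\<Prod>j\<in>{1..n}. if j = i then z i else 1)"
      by (rule prod.cong) (auto simp: lookup_single when_def)
    then show ?thesis using that by simp
  qed
  then show ?thesis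
    unfolding affine_poly_def poly_at_add poly_at_sum[OF finite_atLeastAtMost] poly_at_single by simp
qed

lemma poly_op_affine: "poly_op n (affine_poly n a c) T x = a *\<^sub>C x + (\<Sum>i\<in>{1..n}. c i *\<^sub>C T i x)"
proof -
  have none: "foldr (\<lambda>j. T j ^^ Poly_Mapping.lookup (Poly_Mapping.single i 1) j) xs y = y"
    if "i \<notin> set xs" for i xs y
    using that by (induction xs) (auto simp: lookup_single when_def)
  have one: "foldr (\<lambda>j. T j ^^ Poly_Mapping.lookup (Poly_Mapping.single i 1) j) xs y = T i y"
    if "i \<in> set xs" "distinct xs" for i xs y
    using that
  proof (induction xs)
    case (Cons j xs)
    show ?case
    proof (cases "j = i")
      case True
      then show ?thesis using none[of i xs y] Cons.prems by simp
    next
      case False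
      then show ?thesis using Cons by (simp add: lookup_single_not_eq)
    qed
  qed simp
  have zero: "foldr (\<lambda>j. T j ^^ Poly_Mapping.lookup 0 j) xs y = y" for xs y
    by (induction xs) auto
  have "foldr (\<lambda>j. T j ^^ Poly_Mapping.lookup (Poly_Mapping.single i 1) j) [1..<Suc n] x = T i x"
    if "i \<in> {1..n}" for i
    using that by (intro one) auto
  then show ?thesis
    unfolding affine_poly_def poly_op_add poly_op_sum[OF finite_atLeastAtMost] poly_op_single zero
    by simp
qed

lemma affine_poly_in_cpolys: "affine_poly n a c \<in> cpolys n"
proof -
  have "Poly_Mapping.keys (affine_poly n a c) \<subseteq> {0} \<union> (\<Union>i\<in>{1..n}. {Poly_Mapping.single i 1})"
    unfolding affine_poly_def
    by (rule order_trans[OF Poly_Mapping.keys_add Un_mono]) (auto dest!: subsetD[OF Poly_Mapping.keys_sum] split: if_splits)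
  then show ?thesis unfolding cpolys_def by fastforce
qed

section \<open>Closed subspaces and orthogonal decompositions\<close>

lemma closed_csubspace_zero: "closed_csubspace M \<Longrightarrow> 0 \<in> M"
  and closed_csubspace_add: "closed_csubspace M \<Longrightarrow> x \<in> M \<Longrightarrow> y \<in> M \<Longrightarrow> x + y \<in> M"
  and closed_csubspace_scaleC: "closed_csubspace M \<Longrightarrow> x \<in> M \<Longrightarrow> c *\<^sub>C x \<in> M"
  and closed_csubspace_closed: "closed_csubspace M \<Longrightarrow> closed M"
  by (auto simp: closed_csubspace_def)

lemma closed_csubspace_uminus: "closed_csubspace M \<Longrightarrow> x \<in> M \<Longrightarrow> - x \<in> M"
  using closed_csubspace_scaleC[of M x "- 1"] by (simp add: scaleC_minus_one)

lemma closed_csubspace_diff: "closed_csubspace M \<Longrightarrow> x \<in> M \<Longrightarrow> y \<in> M \<Longrightarrow> x - y \<in> M"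
  using closed_csubspace_add[of M x "- y"] closed_csubspace_uminus[of M y] by simp

lemma closed_csubspace_sum:
  "closed_csubspace M \<Longrightarrow> (\<And>i. i \<in> I \<Longrightarrow> f i \<in> M) \<Longrightarrow> (\<Sum>i\<in>I. f i) \<in> M"
  by (induction I rule: infinite_finite_induct) (auto intro: closed_csubspace_add closed_csubspace_zero)

lemma bounded_linear_image_closure:
  assumes T: "bounded_linear T" and L: "T ` L \<subseteq> N"
  shows "T ` closure L \<subseteq> closure N"
proof (rule image_closure_subset)
  show "continuous_on (closure L) T"
    by (rule linear_continuous_on[OF T])
  show "T ` L \<subseteq> closure N" using L closure_subset[of N] by blast
qed simp

lemma closed_csubspace_closure:
  fixes L :: "'a :: complex_hilbert set"
  assumes "0 \<in> L" and add: "\<And>x y. x \<in> L \<Longrightarrow> y \<in> L \<Longrightarrow> x + y \<in> L"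
    and scale: "\<And>c x. x \<in> L \<Longrightarrow> c *\<^sub>C x \<in> L"
  shows "closed_csubspace (closure L)"
  unfolding closed_csubspace_def
proof (intro conjI ballI allI)
  show "0 \<in> closure L" using assms(1) closure_subset by blast
  fix x assume x: "x \<in> closure L"
  show "c *\<^sub>C x \<in> closure L" for c
    using bounded_linear_image_closure[OF bounded_linear_scaleC[of c], of L L] scale x by blast
  fix y assume y: "y \<in> closure L"
  obtain X Y where X: "\<And>k. X k \<in> L" "X \<longlonglongrightarrow> x" and Y: "\<And>k. Y k \<in> L" "Y \<longlonglongrightarrow> y"
    using x y unfolding closure_sequential by blast
  then have "(\<lambda>k. X k + Y k) \<longlonglongrightarrow> x + y" "\<And>k. X k + Y k \<in> L"
    by (auto intro: tendsto_add add)
  then show "x + y \<in> closure L" unfolding closure_sequential by (intro exI[of _ "\<lambda>k. X k + Y k"]) simp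
qed simp

lemma orthogonal_decomposition_sym:
  assumes "orthogonal_decomposition M A B"
  shows "orthogonal_decomposition M B A"
proof -
  have "cinner y x = 0" if "x \<in> A" "y \<in> B" for x y
    using assms that by (subst cinner_commute) (simp add: orthogonal_decomposition_def)
  moreover have "\<exists>y\<in>B. \<exists>z\<in>A. x = y + z" if "x \<in> M" for x
    using assms that unfolding orthogonal_decomposition_def by (metis add.commute)
  ultimately show ?thesis using assms unfolding orthogonal_decomposition_def by blast
qed

lemma orthogonal_complement_subset:
  assumes D: "orthogonal_decomposition UNIV A B" and w: "\<And>x. x \<in> A \<Longrightarrow> cinner w x = 0"
  shows "w \<in> B"
proof -
  obtain y z where yz: "y \<in> A" "z \<in> B" "w = y + z"
    using D unfolding orthogonal_decomposition_def by blast
  have "cinner z y = 0"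
    using orthogonal_decomposition_sym[OF D] yz unfolding orthogonal_decomposition_def by blast
  then have "cinner y y = 0" using w[OF yz(1)] yz(3) by (simp add: cinner_add_left)
  then show ?thesis using yz by simp
qed

text \<open>The orthogonal projection onto the first summand, with the properties by which it transports
  statements about operators leaving both summands invariant.\<close>

lemma orthogonal_projection_exists:
  fixes A B :: "'a :: complex_hilbert set"
  assumes D: "orthogonal_decomposition UNIV A B"
  obtains E where "\<And>x. E x \<in> A" "\<And>x. x - E x \<in> B" "bounded_linear E"
    "\<And>x. x \<in> A \<Longrightarrow> E x = x" "\<And>c x. E (c *\<^sub>C x) = c *\<^sub>C E x"
    "\<And>T x. bounded_linear T \<Longrightarrow> T ` A \<subseteq> A \<Longrightarrow> T ` B \<subseteq> B \<Longrightarrow> E (T x) = T (E x)"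
proof -
  have A: "closed_csubspace A" and B: "closed_csubspace B"
    and orth: "\<And>x y. x \<in> A \<Longrightarrow> y \<in> B \<Longrightarrow> cinner x y = 0"
    using D unfolding orthogonal_decomposition_def by auto
  have "\<exists>y. y \<in> A \<and> x - y \<in> B" for x
    using D unfolding orthogonal_decomposition_def by (metis UNIV_I add_diff_cancel_left')
  then obtain E where E: "\<And>x. E x \<in> A" "\<And>x. x - E x \<in> B" by metis
  have uniq: "E x = y" if y: "y \<in> A" "x - y \<in> B" for x y
  proof -
    have "E x - y \<in> A" by (rule closed_csubspace_diff[OF A E(1) y(1)])
    moreover have "(x - y) - (x - E x) \<in> B" by (rule closed_csubspace_diff[OF B y(2) E(2)])
    then have "E x - y \<in> B" by simp
    ultimately show ?thesis using orth[of "E x - y" "E x - y"] by simp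
  qed
  have add: "E (x + y) = E x + E y" for x y
  proof (rule uniq)
    have "(x - E x) + (y - E y) \<in> B" by (rule closed_csubspace_add[OF B E(2) E(2)])
    then show "x + y - (E x + E y) \<in> B" by (simp add: algebra_simps)
  qed (rule closed_csubspace_add[OF A E(1) E(1)])
  have scale: "E (c *\<^sub>C x) = c *\<^sub>C E x" for c x
  proof (rule uniq)
    show "c *\<^sub>C x - c *\<^sub>C E x \<in> B" using closed_csubspace_scaleC[OF B E(2)] by (simp add: scaleC_diff_right)
  qed (rule closed_csubspace_scaleC[OF A E(1)])
  have "norm (E x) \<le> norm x" for x
  proof -
    have "(norm x)\<^sup>2 = (norm (E x + (x - E x)))\<^sup>2" by simp
    also have "\<dots> = (norm (E x))\<^sup>2 + (norm (x - E x))\<^sup>2"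
      unfolding norm_add_square using orth[OF E(1) E(2)] by simp
    finally show ?thesis by (smt (verit) norm_ge_zero power2_le_imp_le zero_le_power2)
  qed
  then have "bounded_linear E"
    by (intro bounded_linear_intro[of _ 1]) (auto simp: add scale scaleR_scaleC)
  moreover have "E (T x) = T (E x)" if "bounded_linear T" "T ` A \<subseteq> A" "T ` B \<subseteq> B" for T x
  proof (rule uniq)
    have "T (x - E x) \<in> B" using that E by blast
    then show "T x - T (E x) \<in> B" using that(1) by (simp add: bounded_linear.linear linear_diff)
  qed (use that E in blast)
  moreover have "E x = x" if "x \<in> A" for x
    using that by (intro uniq) (auto intro: closed_csubspace_zero B)
  ultimately show ?thesis using E scale that by blast
qed

lemma bounded_op_on_subspace:
  assumes "bounded_op_on UNIV T" "T ` N \<subseteq> N"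
  shows "bounded_op_on N T"
  using assms unfolding bounded_op_on_def clinear_on_def by auto

lemma reduces_on_UNIV_orthogonal:
  assumes T: "bounded_op_on UNIV T" and D: "orthogonal_decomposition UNIV A B"
    and A: "reduces_on UNIV T A"
  shows "reduces_on UNIV T B"
proof -
  let ?Ta = "adjoint_on UNIV T"
  have orth: "\<And>x y. x \<in> B \<Longrightarrow> y \<in> A \<Longrightarrow> cinner x y = 0" and B: "closed_csubspace B"
    using orthogonal_decomposition_sym[OF D] unfolding orthogonal_decomposition_def by auto
  have "T y \<in> B" if "y \<in> B" for y
  proof (rule orthogonal_complement_subset[OF D])
    show "cinner (T y) x = 0" if "x \<in> A" for x
      using orth[OF \<open>y \<in> B\<close>, of "?Ta x"] that A cinner_adjoint_UNIV[OF T, of y x]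
      unfolding reduces_on_def by auto
  qed
  moreover have "?Ta y \<in> B" if "y \<in> B" for y
  proof (rule orthogonal_complement_subset[OF D])
    show "cinner (?Ta y) x = 0" if "x \<in> A" for x
      using orth[OF \<open>y \<in> B\<close>, of "T x"] that A cinner_adjoint_UNIV_left[OF T, of y x]
      unfolding reduces_on_def by auto
  qed
  ultimately show ?thesis using B unfolding reduces_on_def by blast
qed


section \<open>Restriction of a spectral set to a reducing subspace\<close>

lemma funpow_commute: "(\<And>x. E (f x) = f (E x)) \<Longrightarrow> (f ^^ m) (E x) = E ((f ^^ m) x)"
  by (induction m) auto

lemma foldr_commute:
  "(\<And>i x. i \<in> set xs \<Longrightarrow> f i (E x) = E (f i x)) \<Longrightarrow> foldr f xs (E x) = E (foldr f xs x)"
  by (induction xs) auto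

lemma poly_op_commute:
  assumes E: "bounded_linear E" "\<And>c x. E (c *\<^sub>C x) = c *\<^sub>C E x"
    and T: "\<And>i x. i \<in> {1..n} \<Longrightarrow> E (T i x) = T i (E x)"
  shows "poly_op n p T (E x) = E (poly_op n p T x)"
proof -
  interpret E: bounded_linear E by (rule E(1))
  have "foldr (\<lambda>i. T i ^^ f i) [1..<Suc n] (E x) = E (foldr (\<lambda>i. T i ^^ f i) [1..<Suc n] x)" for f
    by (rule foldr_commute, rule funpow_commute, rule T) auto
  then show ?thesis unfolding poly_op_def by (simp add: E.sum E(2) del: upt_Suc)
qed

lemma koszul_exact_restrict:
  assumes E: "bounded_linear E" "\<And>x. E x \<in> M" "\<And>x. x \<in> M \<Longrightarrow> E x = x"
    and T: "\<And>i x. i \<in> {1..n} \<Longrightarrow> E (T i x) = T i (E x)"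
    and ex: "koszul_exact n UNIV T"
  shows "koszul_exact n M T"
proof -
  interpret E: bounded_linear E by (rule E(1))
  have sub: "koszul_chain n k M \<subseteq> koszul_chain n k UNIV" for k
    by (auto simp: koszul_chain_def split: if_splits)
  have "E (koszul_diff n T y I) = koszul_diff n T (\<lambda>I. E (y I)) I" for y I
    unfolding koszul_diff_def
    by (auto simp: E.sum E.scaleR E.zero T subset_iff intro!: sum.cong)
  then have diff: "koszul_diff n T (\<lambda>I. E (y I)) = (\<lambda>I. E (koszul_diff n T y I))" for y by auto
  have "\<exists>y\<in>koszul_chain n k M. koszul_diff n T y = x"
    if k: "k < n" and x: "x \<in> koszul_chain n (Suc k) M" "koszul_diff n T x = (\<lambda>_. 0)" for k x
  proof -
    obtain y where y: "y \<in> koszul_chain n k UNIV" "koszul_diff n T y = x"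
      using ex k x sub[of "Suc k"] unfolding koszul_exact_def by blast
    have "(\<lambda>I. E (y I)) \<in> koszul_chain n k M"
      using y(1) E(2) by (auto simp: koszul_chain_def E.zero)
    moreover have "E (x I) = x I" for I
    proof -
      have "if I \<subseteq> {1..n} \<and> card I = Suc k then x I \<in> M else x I = 0"
        using x(1) unfolding koszul_chain_def by blast
      then show ?thesis
        by (cases "I \<subseteq> {1..n} \<and> card I = Suc k") (simp_all add: E(3) E.zero)
    qed
    then have "koszul_diff n T (\<lambda>I. E (y I)) = x" unfolding diff y(2) by auto
    ultimately show ?thesis by blast
  qed
  then show ?thesis using ex sub[of 0] unfolding koszul_exact_def by blast
qed

text \<open>
  Everything in the definition of a spectral set is compatible with a projection \<open>E\<close> commuting with
  the operators: it maps solutions of an equation in the whole space to solutions in the range.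
\<close>

lemma spectral_set_restrict:
  fixes A :: "'a :: complex_hilbert set"
  assumes D: "orthogonal_decomposition UNIV A B"
    and T: "\<And>i. i \<in> {1..n} \<Longrightarrow> bounded_op_on UNIV (T i)"
    and inv: "\<And>i. i \<in> {1..n} \<Longrightarrow> T i ` A \<subseteq> A" "\<And>i. i \<in> {1..n} \<Longrightarrow> T i ` B \<subseteq> B"
    and S: "spectral_set n UNIV T K"
  shows "spectral_set n A T K"
proof -
  obtain E where E: "\<And>x. E x \<in> A" and "\<And>x. x - E x \<in> B" and E': "bounded_linear E"
    "\<And>x. x \<in> A \<Longrightarrow> E x = x" "\<And>c x. E (c *\<^sub>C x) = c *\<^sub>C E x"
    and comm: "\<And>T x. bounded_linear T \<Longrightarrow> T ` A \<subseteq> A \<Longrightarrow> T ` B \<subseteq> B \<Longrightarrow> E (T x) = T (E x)"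
    by (rule orthogonal_projection_exists[OF D]) (rule that)
  note E = E E'
  interpret E: bounded_linear E by (rule E(2))
  have ET: "E (T i x) = T i (E x)" if "i \<in> {1..n}" for i x
    using comm bounded_op_on_UNIV_bounded_linear[OF T[OF that]] inv that by blast
  have "taylor_spectrum n A T \<subseteq> taylor_spectrum n UNIV T"
    unfolding taylor_spectrum_def
    using koszul_exact_restrict[OF E(2) E(1) E(3), where n = n] ET
    by (auto simp: E.diff E(4))
  moreover have "bij_betw (poly_op n q T) A A \<and> (\<forall>x\<in>A. norm (poly_op n p T (inv_into A (poly_op n q T) x))
           \<le> (SUP z\<in>K. cmod (poly_at n p z / poly_at n q z)) * norm x)"
    if pq: "p \<in> cpolys n" "q \<in> cpolys n" "\<forall>z\<in>K. poly_at n q z \<noteq> 0" for p q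
  proof -
    let ?q = "poly_op n q T"
    have bij: "bij_betw ?q UNIV UNIV"
      and bnd: "\<And>x. norm (poly_op n p T (inv_into UNIV ?q x))
           \<le> (SUP z\<in>K. cmod (poly_at n p z / poly_at n q z)) * norm x"
      using S pq unfolding spectral_set_def by auto
    have qE: "?q (E x) = E (?q x)" for x by (rule poly_op_commute) (use E(2,4) ET in auto)
    have inj: "inj ?q" using bij by (simp add: bij_betw_def)
    have inv_A: "inv_into UNIV ?q x \<in> A" "?q (inv_into UNIV ?q x) = x" if "x \<in> A" for x
    proof -
      show y: "?q (inv_into UNIV ?q x) = x"
        using bij by (simp add: bij_betw_def surj_f_inv_f)
      then have "?q (E (inv_into UNIV ?q x)) = ?q (inv_into UNIV ?q x)"
        unfolding qE using E(3)[OF that] by simp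
      then have "E (inv_into UNIV ?q x) = inv_into UNIV ?q x" using inj by (simp add: inj_eq)
      then show "inv_into UNIV ?q x \<in> A" using E(1) by metis
    qed
    have "?q x \<in> A" if "x \<in> A" for x
      using qE[of x] E(1)[of "?q x"] E(3)[OF that] by simp
    then have "bij_betw ?q A A"
      unfolding bij_betw_def using inj inv_A by (auto intro: inj_on_subset) (metis image_eqI)
    moreover have "inv_into A ?q x = inv_into UNIV ?q x" if "x \<in> A" for x
      using inv_A[OF that] inj by (intro inv_into_f_eq) (auto intro: inj_on_subset)
    ultimately show ?thesis using bnd by simp
  qed
  ultimately show ?thesis using S unfolding spectral_set_def by blast
qed

section \<open>The fundamental relation of a symmetrized-polydisc contraction\<close>

lemma Gamma_set_nonempty: "Gamma_set n \<noteq> {}"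
  unfolding Gamma_set_def using PiE_eq_empty_iff[of "{1..n}" "\<lambda>_. cball (0 :: complex) 1"] by auto

lemma spectral_set_affine_bound:
  assumes S: "spectral_set n M T (Gamma_set n)"
    and q: "\<And>z. z \<in> Gamma_set n \<Longrightarrow> d + (\<Sum>i\<in>{1..n}. e i * z i) \<noteq> 0"
    and pq: "\<And>z. z \<in> Gamma_set n \<Longrightarrow>
      cmod (a + (\<Sum>i\<in>{1..n}. c i * z i)) \<le> C * cmod (d + (\<Sum>i\<in>{1..n}. e i * z i))"
    and x: "x \<in> M"
  shows "norm (a *\<^sub>C x + (\<Sum>i\<in>{1..n}. c i *\<^sub>C T i x)) \<le> C * norm (d *\<^sub>C x + (\<Sum>i\<in>{1..n}. e i *\<^sub>C T i x))"
proof -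
  let ?p = "affine_poly n a c" and ?q = "affine_poly n d e"
  let ?Q = "poly_op n ?q T"
  have nz: "\<forall>z\<in>Gamma_set n. poly_at n ?q z \<noteq> 0" using q by (simp add: poly_at_affine)
  then have bij: "bij_betw ?Q M M"
    and bnd: "\<And>y. y \<in> M \<Longrightarrow> norm (poly_op n ?p T (inv_into M ?Q y))
           \<le> (SUP z\<in>Gamma_set n. cmod (poly_at n ?p z / poly_at n ?q z)) * norm y"
    using S affine_poly_in_cpolys unfolding spectral_set_def by blast+
  have Qx: "?Q x \<in> M" using bij x by (simp add: bij_betw_apply)
  have inv: "inv_into M ?Q (?Q x) = x" using bij x by (simp add: bij_betw_inv_into_left)
  have "(SUP z\<in>Gamma_set n. cmod (poly_at n ?p z / poly_at n ?q z)) \<le> C"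
  proof (rule cSUP_least[OF Gamma_set_nonempty])
    show "cmod (poly_at n ?p z / poly_at n ?q z) \<le> C" if "z \<in> Gamma_set n" for z
      using pq[OF that] q[OF that] by (simp add: poly_at_affine norm_divide divide_le_eq)
  qed
  then have "(SUP z\<in>Gamma_set n. cmod (poly_at n ?p z / poly_at n ?q z)) * norm (?Q x) \<le> C * norm (?Q x)"
    by (rule mult_right_mono) simp
  then have "norm (poly_op n ?p T x) \<le> C * norm (?Q x)"
    using bnd[OF Qx] unfolding inv by linarith
  then show ?thesis unfolding poly_op_affine .
qed

lemma sum_two_coordinates:
  fixes f :: "nat \<Rightarrow> complex"
  assumes "m \<in> {1..n}" "l \<in> {1..n}"
  shows "(\<Sum>j\<in>{1..n}. ((if j = m then a else 0) + (if j = l then b else 0)) * f j) = a * f m + b * f l"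
proof -
  have "((if j = m then a else 0) + (if j = l then b else 0)) * f j
      = (if j = m then a * f j else 0) + (if j = l then b * f j else 0)" for j
    by (simp add: distrib_right)
  then show ?thesis using assms by (simp add: sum.distrib)
qed

lemma sum_two_coordinates_scaleC:
  fixes f :: "nat \<Rightarrow> 'a :: complex_hilbert"
  assumes "m \<in> {1..n}" "l \<in> {1..n}"
  shows "(\<Sum>j\<in>{1..n}. ((if j = m then a else 0) + (if j = l then b else 0)) *\<^sub>C f j) = a *\<^sub>C f m + b *\<^sub>C f l"
proof -
  have "((if j = m then a else 0) + (if j = l then b else 0)) *\<^sub>C f j
      = (if j = m then a *\<^sub>C f j else 0) + (if j = l then b *\<^sub>C f j else 0)" for j
    by (simp add: scaleC_add_left)
  then show ?thesis using assms by (simp add: sum.distrib)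
qed

lemma unimodular_rotation: "\<exists>b. cmod b = 1 \<and> b * w = complex_of_real (cmod w)"
proof (cases "w = 0")
  case False
  then show ?thesis
    by (intro exI[of _ "cnj w / cmod w"])
      (simp add: norm_divide power2_eq_square mult.commute complex_norm_square[symmetric])
qed (auto intro: exI[of _ 1])

text \<open>
  The operator form of the inequality \<open>\<bar>k b p - s\<^bsub>n-i\<^esub>\<bar> \<le> \<bar>k - b s\<^sub>i\<bar>\<close> on the symmetrized polydisc.
  After squaring the norms, \<open>b\<close> enters only through \<open>Re (b \<phi>)\<close> with \<open>\<phi> = \<langle>S\<^sub>i x, x\<rangle> - \<langle>P x, S\<^bsub>n-i\<^esub> x\<rangle>\<close>, and the
  best choice of \<open>b\<close> makes this \<open>\<bar>\<phi>\<bar>\<close>.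
\<close>

lemma moebius_operator_bound:
  fixes T :: "nat \<Rightarrow> 'a \<Rightarrow> 'a :: complex_hilbert"
  assumes S: "spectral_set n M T (Gamma_set n)" and i: "1 \<le> i" "i < n" and x: "x \<in> M"
  defines "k \<equiv> 2 ^ n + 1"
  shows "2 * cmod (cinner (T i x) x - cinner (T n x) (T (n - i) x)) * k
    \<le> k\<^sup>2 * ((norm x)\<^sup>2 - (norm (T n x))\<^sup>2) + ((norm (T i x))\<^sup>2 - (norm (T (n - i) x))\<^sup>2)"
proof -
  define w where "w = cinner (T i x) x - cinner (T n x) (T (n - i) x)"
  obtain b where b: "cmod b = 1" "b * w = complex_of_real (cmod w)"
    using unimodular_rotation by blast
  have k0: "k > 0" unfolding k_def by (simp add: add_pos_pos)
  define c e where "c j = (if j = n then of_real k * b else 0) + (if j = n - i then - 1 else 0)"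
    and "e j = (if j = i then - b else 0) + (if j = n then 0 else 0)" for j
  have mem: "n \<in> {1..n}" "n - i \<in> {1..n}" "i \<in> {1..n}" using i by auto
  have c_sum: "(\<Sum>j\<in>{1..n}. c j * f j) = of_real k * b * f n - f (n - i)" for f
    unfolding c_def sum_two_coordinates[OF mem(1,2)] by simp
  have e_sum: "(\<Sum>j\<in>{1..n}. e j * f j) = - (b * f i)" for f
    unfolding e_def sum_two_coordinates[OF mem(3,1)] by simp
  have c_op: "(\<Sum>j\<in>{1..n}. c j *\<^sub>C T j x) = (of_real k * b) *\<^sub>C T n x - T (n - i) x"
    unfolding c_def sum_two_coordinates_scaleC[OF mem(1,2)] by (simp add: scaleC_minus_one)
  have e_op: "(\<Sum>j\<in>{1..n}. e j *\<^sub>C T j x) = - (b *\<^sub>C T i x)"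
    unfolding e_def sum_two_coordinates_scaleC[OF mem(3,1)] by (simp add: scaleC_minus_left)
  have "norm (0 *\<^sub>C x + (\<Sum>j\<in>{1..n}. c j *\<^sub>C T j x))
      \<le> 1 * norm (complex_of_real k *\<^sub>C x + (\<Sum>j\<in>{1..n}. e j *\<^sub>C T j x))"
  proof (rule spectral_set_affine_bound[OF S _ _ x])
    fix s assume "s \<in> Gamma_set n"
    then obtain z where z: "z \<in> {1..n} \<rightarrow>\<^sub>E cball 0 1" "s = symm_map n z" unfolding Gamma_set_def by blast
    then have z1: "\<forall>j\<in>{1..n}. cmod (z j) \<le> 1" by (auto simp: PiE_iff)
    have s: "s j = esym n j z" if "j \<in> {1..n}" for j using that by (simp add: z(2) symm_map_esym)
    note bound = esym_moebius_bound[OF z1 _ b(1), of i]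
    have k: "complex_of_real k = 2 ^ n + 1" by (simp add: k_def)
    show "complex_of_real k + (\<Sum>j\<in>{1..n}. e j * s j) \<noteq> 0"
    proof
      assume "complex_of_real k + (\<Sum>j\<in>{1..n}. e j * s j) = 0"
      then have "cmod (b * esym n i z) = cmod (complex_of_real k)" unfolding e_sum s[OF mem(3)] by simp
      then have "cmod (esym n i z) = 2 ^ n + 1"
        using b(1) k0 unfolding norm_mult norm_of_real by (simp add: k_def)
      then show False using norm_esym_le[of n z i] z1 by auto
    qed
    show "cmod (0 + (\<Sum>j\<in>{1..n}. c j * s j)) \<le> 1 * cmod (complex_of_real k + (\<Sum>j\<in>{1..n}. e j * s j))"
      using bound i unfolding c_sum e_sum s[OF mem(1)] s[OF mem(2)] s[OF mem(3)] k by simp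
  qed
  then have "norm ((of_real k * b) *\<^sub>C T n x - T (n - i) x) \<le> norm (complex_of_real k *\<^sub>C x - b *\<^sub>C T i x)"
    unfolding c_op e_op by simp
  then have "(norm ((of_real k * b) *\<^sub>C T n x - T (n - i) x))\<^sup>2 \<le> (norm (complex_of_real k *\<^sub>C x - b *\<^sub>C T i x))\<^sup>2"
    by (rule power_mono) simp
  moreover define X Y where "X = Re (b * cinner (T i x) x)" and "Y = Re (b * cinner (T n x) (T (n - i) x))"
  moreover have "Re (cinner (complex_of_real k *\<^sub>C x) (b *\<^sub>C T i x)) = k * X"
  proof -
    have "cinner (complex_of_real k *\<^sub>C x) (b *\<^sub>C T i x) = cnj (of_real k * (b * cinner (T i x) x))"
      by (subst cinner_commute[of "T i x" x]) (simp add: cinner_scaleC_left cinner_scaleC_right)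
    then have "Re (cinner (complex_of_real k *\<^sub>C x) (b *\<^sub>C T i x)) = Re (of_real k * (b * cinner (T i x) x))"
      by (simp only: cnj.sel)
    then show ?thesis by (simp add: X_def)
  qed
  then have "(norm (complex_of_real k *\<^sub>C x - b *\<^sub>C T i x))\<^sup>2
      = k\<^sup>2 * (norm x)\<^sup>2 - 2 * (k * X) + (norm (T i x))\<^sup>2"
    unfolding norm_diff_square norm_scaleC b(1) norm_of_real power_mult_distrib by simp
  moreover have "Re (cinner ((of_real k * b) *\<^sub>C T n x) (T (n - i) x)) = k * Y"
    by (simp add: cinner_scaleC_left mult.assoc Y_def)
  then have "(norm ((of_real k * b) *\<^sub>C T n x - T (n - i) x))\<^sup>2
      = k\<^sup>2 * (norm (T n x))\<^sup>2 - 2 * (k * Y) + (norm (T (n - i) x))\<^sup>2"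
    unfolding norm_diff_square norm_scaleC norm_mult b(1) norm_of_real power_mult_distrib by simp
  moreover have "cmod w = Re (b * w)" using b(2) by simp
  then have "cmod w = X - Y"
    unfolding X_def Y_def w_def by (simp only: right_diff_distrib minus_complex.sel)
  then have "cmod w * k = k * X - k * Y" by (simp only: right_diff_distrib mult.commute[of _ k])
  ultimately show ?thesis unfolding w_def[symmetric] right_diff_distrib by linarith
qed

text \<open>The terms \<open>\<parallel>S\<^sub>i x\<parallel>\<^sup>2 - \<parallel>S\<^bsub>n-i\<^esub> x\<parallel>\<^sup>2\<close> cancel when the estimates for \<open>i\<close> and \<open>n - i\<close> are added.\<close>

lemma defect_bound:
  fixes T :: "nat \<Rightarrow> 'a \<Rightarrow> 'a :: complex_hilbert"
  assumes S: "spectral_set n M T (Gamma_set n)" and i: "1 \<le> i" "i < n" and x: "x \<in> M"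
  shows "cmod (cinner (T i x) x - cinner (T n x) (T (n - i) x))
    \<le> (2 ^ n + 1) * ((norm x)\<^sup>2 - (norm (T n x))\<^sup>2)"
proof -
  define k :: real where "k = 2 ^ n + 1"
  define D where "D = (norm x)\<^sup>2 - (norm (T n x))\<^sup>2"
  have k0: "k > 0" unfolding k_def by (simp add: add_pos_pos)
  have i': "1 \<le> n - i" "n - i < n" "n - (n - i) = i" using i by auto
  define u where "u = cmod (cinner (T i x) x - cinner (T n x) (T (n - i) x))"
  define v where "v = cmod (cinner (T (n - i) x) x - cinner (T n x) (T i x))"
  have "2 * u * k + 2 * v * k \<le> 2 * k\<^sup>2 * D"
    using moebius_operator_bound[OF S i x] moebius_operator_bound[OF S i'(1,2) x]
    unfolding i'(3) u_def v_def D_def k_def by linarith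
  moreover have "0 \<le> v * k" using k0 unfolding v_def by simp
  ultimately have "k * u \<le> k * (k * D)" by (simp add: power2_eq_square mult_ac)
  then show ?thesis using k0 unfolding u_def D_def k_def[symmetric] by simp
qed

text \<open>
  Along \<open>v = x + t y\<close> the right-hand side of \<open>\<bar>\<phi>(v, v)\<bar> \<le> k (\<parallel>v\<parallel>\<^sup>2 - \<parallel>P v\<parallel>\<^sup>2)\<close> is of order \<open>t\<^sup>2\<close>, because \<open>P\<close>
  preserves inner products with \<open>x\<close>.  So the coefficient \<open>\<phi>(x, y) + \<phi>(y, x)\<close> of \<open>t\<close> on the left vanishes,
  and replacing \<open>y\<close> by \<open>\<i> y\<close> separates the two terms.
\<close>

lemma fundamental_relation:
  fixes T :: "nat \<Rightarrow> 'a \<Rightarrow> 'a :: complex_hilbert"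
  assumes S: "spectral_set n UNIV T (Gamma_set n)"
    and T: "\<And>i. i \<in> {1..n} \<Longrightarrow> bounded_op_on UNIV (T i)"
    and i: "1 \<le> i" "i < n"
    and x: "\<And>y. cinner (T n x) (T n y) = cinner x y"
  shows "cinner (T i x) y = cinner (T n x) (T (n - i) y)"
    and "cinner (T i y) x = cinner (T n y) (T (n - i) x)"
proof -
  define \<phi> where "\<phi> u v = cinner (T i u) v - cinner (T n u) (T (n - i) v)" for u v
  have lin: "T j (u + v) = T j u + T j v" "T j (c *\<^sub>C u) = c *\<^sub>C T j u" if "j \<in> {1..n}" for j u v c
    using T[OF that] unfolding bounded_op_on_def clinear_on_def by auto
  have mem: "n \<in> {1..n}" "n - i \<in> {1..n}" "i \<in> {1..n}" using i by auto
  have phi_add: "\<phi> (u + u') v = \<phi> u v + \<phi> u' v" "\<phi> u (v + v') = \<phi> u v + \<phi> u v'" for u u' v v'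
    unfolding \<phi>_def by (simp_all add: lin[OF mem(1)] lin[OF mem(2)] lin[OF mem(3)] cinner_expand)
  have phi_scale: "\<phi> (c *\<^sub>C u) v = c * \<phi> u v" "\<phi> u (c *\<^sub>C v) = cnj c * \<phi> u v" for u v c
    unfolding \<phi>_def by (simp_all add: lin[OF mem(1)] lin[OF mem(2)] lin[OF mem(3)] cinner_expand algebra_simps)
  have bound: "cmod (\<phi> v v) \<le> (2 ^ n + 1) * ((norm v)\<^sup>2 - (norm (T n v))\<^sup>2)" for v
    using defect_bound[OF S i UNIV_I] unfolding \<phi>_def .
  have norm_x: "(norm (T n x))\<^sup>2 = (norm x)\<^sup>2"
    unfolding Re_cinner_self[symmetric] x ..
  have phi_xx: "\<phi> x x = 0" using bound[of x] norm_x by simp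
  have sum0: "\<phi> x y + \<phi> y x = 0" for y
  proof -
    define k :: real where "k = 2 ^ n + 1"
    have k0: "k > 0" unfolding k_def by (simp add: add_pos_pos)
    define B where "B = k * (norm y)\<^sup>2 + cmod (\<phi> y y)"
    have le: "cmod (\<phi> x y + \<phi> y x) \<le> t * B" if t: "t > 0" for t
    proof -
      let ?t = "complex_of_real t"
      have "\<phi> (x + ?t *\<^sub>C y) (x + ?t *\<^sub>C y) = ?t * (\<phi> x y + \<phi> y x) + ?t * (?t * \<phi> y y)"
        by (simp add: phi_add phi_scale phi_xx algebra_simps)
      then have "cmod (?t * (\<phi> x y + \<phi> y x)) \<le>
          cmod (\<phi> (x + ?t *\<^sub>C y) (x + ?t *\<^sub>C y)) + cmod (?t * (?t * \<phi> y y))"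
        by (metis add_diff_cancel_right' norm_triangle_ineq4)
      also have "cmod (\<phi> (x + ?t *\<^sub>C y) (x + ?t *\<^sub>C y))
          \<le> k * ((norm (x + ?t *\<^sub>C y))\<^sup>2 - (norm (T n (x + ?t *\<^sub>C y)))\<^sup>2)"
        using bound unfolding k_def .
      also have "(norm (x + ?t *\<^sub>C y))\<^sup>2 - (norm (T n (x + ?t *\<^sub>C y)))\<^sup>2
          = t\<^sup>2 * ((norm y)\<^sup>2 - (norm (T n y))\<^sup>2)"
        unfolding lin[OF mem(1)] norm_add_square norm_x
        by (simp add: cinner_scaleC_right x norm_scaleC power_mult_distrib algebra_simps)
      also have "k * (t\<^sup>2 * ((norm y)\<^sup>2 - (norm (T n y))\<^sup>2)) \<le> k * (t\<^sup>2 * (norm y)\<^sup>2)"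
        using k0 by (intro mult_left_mono) auto
      finally have "t * cmod (\<phi> x y + \<phi> y x) \<le> k * (t\<^sup>2 * (norm y)\<^sup>2) + t * (t * cmod (\<phi> y y))"
        unfolding norm_mult norm_of_real abs_of_pos[OF t] by simp
      also have "\<dots> = t * (t * B)"
        by (simp add: B_def power2_eq_square algebra_simps)
      finally have "t * cmod (\<phi> x y + \<phi> y x) \<le> t * (t * B)" .
      then show ?thesis using t by simp
    qed
    have "cmod (\<phi> x y + \<phi> y x) \<le> 0"
    proof (rule field_le_epsilon)
      fix e :: real assume e: "e > 0"
      have B: "0 \<le> B" using k0 by (simp add: B_def)
      have "e / (B + 1) * B \<le> e" using e B by (simp add: field_simps)
      moreover have "e / (B + 1) > 0" using e B by simp
      ultimately show "cmod (\<phi> x y + \<phi> y x) \<le> 0 + e" using le[of "e / (B + 1)"] by linarith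
    qed
    then show ?thesis by simp
  qed
  have diff0: "\<phi> x y - \<phi> y x = 0" for y
  proof -
    have "- (\<i> * (\<phi> x y - \<phi> y x)) = 0"
      using sum0[of "\<i> *\<^sub>C y"] by (simp add: phi_scale algebra_simps)
    then show ?thesis by simp
  qed
  have "\<phi> x y = 0" "\<phi> y x = 0" using sum0[of y] diff0[of y] by auto
  then show "cinner (T i x) y = cinner (T n x) (T (n - i) y)"
    and "cinner (T i y) x = cinner (T n y) (T (n - i) x)"
    unfolding \<phi>_def by auto
qed

section \<open>The isometric part reduces the commuting operators\<close>

text \<open>The equality case of \<open>\<parallel>P x\<parallel> \<le> \<parallel>x\<parallel>\<close>: expanding \<open>\<parallel>P* P x - x\<parallel>\<^sup>2\<close> gives at most \<open>\<parallel>P x\<parallel>\<^sup>2 - \<parallel>x\<parallel>\<^sup>2\<close>.\<close>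

lemma isometric_vector_adjoint:
  assumes P: "bounded_op_on UNIV P" and le: "\<And>x. norm (P x) \<le> norm x" and x: "norm (P x) = norm x"
  shows "adjoint_on UNIV P (P x) = x"
proof -
  let ?Pa = "adjoint_on UNIV P"
  have Pa: "norm (?Pa u) \<le> norm u" for u
  proof (cases "?Pa u = 0")
    case False
    have "(norm (?Pa u))\<^sup>2 = Re (cinner (P (?Pa u)) u)"
      unfolding Re_cinner_self[symmetric] cinner_adjoint_UNIV[OF P] ..
    also have "\<dots> \<le> norm (P (?Pa u)) * norm u" using Re_cinner_le[of "P (?Pa u)" u] by linarith
    also have "\<dots> \<le> norm (?Pa u) * norm u" by (intro mult_right_mono le) auto
    finally show ?thesis using False by (simp add: power2_eq_square)
  qed simp
  have "cinner (?Pa (P x)) x = of_real ((norm x)\<^sup>2)"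
    using cinner_adjoint_UNIV_left[OF P, of "P x" x] x by (simp add: cinner_self)
  then have "(norm (?Pa (P x) - x))\<^sup>2 = (norm (?Pa (P x)))\<^sup>2 - (norm x)\<^sup>2"
    unfolding norm_diff_square by (simp del: of_real_power)
  also have "\<dots> \<le> 0" using power_mono[OF Pa[of "P x"], of 2] x by simp
  finally show ?thesis by simp
qed

lemma image_commuting_invariant:
  assumes "\<And>x. f (g x) = g (f x)" "f ` L \<subseteq> L"
  shows "f ` g ` L \<subseteq> g ` L"
  using assms by (simp add: image_subset_iff)

text \<open>
  Let \<open>E\<close> be the projection onto the completely non-isometric summand.  It commutes with \<open>P\<close> and \<open>P*\<close>,
  so \<open>E L\<close> inherits the hypotheses on \<open>L\<close>, and its closure is a reducing subspace of \<open>H2\<close> on which \<open>P\<close>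
  is isometric; hence \<open>E L = 0\<close>.
\<close>

lemma levan_isometric_part_contains:
  fixes P :: "'a :: complex_hilbert \<Rightarrow> 'a"
  assumes P: "bounded_op_on UNIV P" and dec: "levan_decomposition UNIV P H1 H2"
    and L: "0 \<in> L" "\<And>x y. x \<in> L \<Longrightarrow> y \<in> L \<Longrightarrow> x + y \<in> L" "\<And>c x. x \<in> L \<Longrightarrow> c *\<^sub>C x \<in> L"
    and inv: "P ` L \<subseteq> L" "adjoint_on UNIV P ` L \<subseteq> L"
    and iso: "\<And>x. x \<in> L \<Longrightarrow> adjoint_on UNIV P (P x) = x"
  shows "L \<subseteq> H1"
proof
  let ?Pa = "adjoint_on UNIV P"
  note Pa = bounded_op_on_adjoint_UNIV[OF P]
  note blP = bounded_op_on_UNIV_bounded_linear[OF P] and blPa = bounded_op_on_UNIV_bounded_linear[OF Pa]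
  have D: "orthogonal_decomposition UNIV H2 H1"
    and R1: "reduces_on UNIV P H1" and R2: "reduces_on UNIV P H2" and cni: "cni_contraction_on H2 P"
    using dec orthogonal_decomposition_sym unfolding levan_decomposition_def by auto
  have H2: "closed_csubspace H2" and H2_inv: "P ` H2 \<subseteq> H2" "?Pa ` H2 \<subseteq> H2"
    and H1_inv: "P ` H1 \<subseteq> H1" "?Pa ` H1 \<subseteq> H1"
    using R1 R2 unfolding reduces_on_def by auto
  obtain E where E: "\<And>x. E x \<in> H2" "\<And>x. x - E x \<in> H1" "bounded_linear E"
    "\<And>x. x \<in> H2 \<Longrightarrow> E x = x" "\<And>c x. E (c *\<^sub>C x) = c *\<^sub>C E x"
    and comm: "\<And>T x. bounded_linear T \<Longrightarrow> T ` H2 \<subseteq> H2 \<Longrightarrow> T ` H1 \<subseteq> H1 \<Longrightarrow> E (T x) = T (E x)"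
    by (rule orthogonal_projection_exists[OF D]) (rule that)
  interpret E: bounded_linear E by (rule E(3))
  have EP: "E (P x) = P (E x)" and EPa: "E (?Pa x) = ?Pa (E x)" for x
    using comm[OF blP H2_inv(1) H1_inv(1)] comm[OF blPa H2_inv(2) H1_inv(2)] by auto
  define Y where "Y = closure (E ` L)"
  have Y: "closed_csubspace Y"
    unfolding Y_def
  proof (rule closed_csubspace_closure)
    show "0 \<in> E ` L" using L(1) E.zero by (metis image_eqI)
    show "x + y \<in> E ` L" if xy: "x \<in> E ` L" "y \<in> E ` L" for x y
    proof -
      obtain u v where "u \<in> L" "v \<in> L" "x = E u" "y = E v" using xy by blast
      then show ?thesis using L(2)[of u v] E.add[of u v] by (metis image_eqI)
    qed
    show "c *\<^sub>C x \<in> E ` L" if x: "x \<in> E ` L" for c x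
    proof -
      obtain u where "u \<in> L" "x = E u" using x by blast
      then show ?thesis using L(3)[of u c] E(5)[of c u] by (metis image_eqI)
    qed
  qed
  have "E ` L \<subseteq> H2" using E(1) by auto
  then have YH2: "Y \<subseteq> H2" unfolding Y_def using closed_csubspace_closed[OF H2] by (rule closure_minimal)
  have "P ` E ` L \<subseteq> E ` L" using EP inv(1) by (intro image_commuting_invariant) auto
  then have PY: "P ` Y \<subseteq> Y" unfolding Y_def by (rule bounded_linear_image_closure[OF blP])
  have "?Pa ` E ` L \<subseteq> E ` L" using EPa inv(2) by (intro image_commuting_invariant) auto
  then have PaY: "?Pa ` Y \<subseteq> Y" unfolding Y_def by (rule bounded_linear_image_closure[OF blPa])
  have adj: "adjoint_on H2 P y = ?Pa y" if "y \<in> H2" for y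
    using that H2_inv cinner_adjoint_UNIV[OF P] by (intro adjoint_on_eqI[OF H2]) auto
  have fixed: "?Pa (P y) = y" if "y \<in> Y" for y
  proof -
    have "closed {y. ?Pa (P y) = y}"
      using linear_continuous_on[OF bounded_linear_compose[OF blPa blP]]
      by (intro closed_Collect_eq continuous_intros)
    moreover have "E ` L \<subseteq> {y. ?Pa (P y) = y}"
      using iso EP EPa by (auto simp flip: EP EPa)
    ultimately have "Y \<subseteq> {y. ?Pa (P y) = y}" unfolding Y_def by (simp add: closure_minimal)
    then show ?thesis using that by blast
  qed
  have norm_P: "norm (P y) = norm y" if "y \<in> Y" for y
  proof -
    have "cinner (P y) (P y) = cinner y y" using cinner_adjoint_UNIV[OF P, of y "P y"] fixed[OF that] by simp
    then have "(norm (P y))\<^sup>2 = (norm y)\<^sup>2" unfolding Re_cinner_self[symmetric] by simp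
    then show ?thesis by simp
  qed
  have "isometry_on Y P"
    unfolding isometry_on_def using bounded_op_on_subspace[OF P PY] norm_P by simp
  moreover have "reduces_on H2 P Y"
    unfolding reduces_on_def
  proof (intro conjI Y YH2 PY)
    show "adjoint_on H2 P ` Y \<subseteq> Y"
    proof (rule image_subsetI)
      fix y assume y: "y \<in> Y"
      then have "adjoint_on H2 P y = ?Pa y" using YH2 by (intro adj) auto
      then show "adjoint_on H2 P y \<in> Y" using PaY y by auto
    qed
  qed
  ultimately have "Y = {0}" using cni unfolding cni_contraction_on_def by blast
  fix x assume "x \<in> L"
  then have "E x \<in> Y" unfolding Y_def by (intro subsetD[OF closure_subset]) auto
  then show "x \<in> H1" using E(2)[of x] \<open>Y = {0}\<close> by simp
qed

lemma range_restriction_subspace: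
  assumes R: "bounded_op_on UNIV R" and M: "closed_csubspace M"
  shows "0 \<in> R ` M" "x \<in> R ` M \<Longrightarrow> y \<in> R ` M \<Longrightarrow> x + y \<in> R ` M" "x \<in> R ` M \<Longrightarrow> c *\<^sub>C x \<in> R ` M"
proof -
  have lin: "R (u + v) = R u + R v" "R (c *\<^sub>C u) = c *\<^sub>C R u" for u v c
    using R unfolding bounded_op_on_def clinear_on_def by auto
  have "R 0 = 0" using lin(2)[of 0 0] by simp
  then show "0 \<in> R ` M" using closed_csubspace_zero[OF M] by (metis image_eqI)
  show "x + y \<in> R ` M" if xy: "x \<in> R ` M" "y \<in> R ` M" for x y
  proof -
    obtain u v where "u \<in> M" "v \<in> M" "x = R u" "y = R v" using xy by blast
    then show ?thesis using closed_csubspace_add[OF M, of u v] lin(1)[of u v] by (metis image_eqI)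
  qed
  show "c *\<^sub>C x \<in> R ` M" if x: "x \<in> R ` M" for c x
  proof -
    obtain u where "u \<in> M" "x = R u" using x by blast
    then show ?thesis using closed_csubspace_scaleC[OF M, of u c] lin(2)[of c u] by (metis image_eqI)
  qed
qed

lemma doubly_commuting_preserves_isometric_part:
  assumes P: "bounded_op_on UNIV P" and dec: "levan_decomposition UNIV P H1 H2"
    and iso: "\<And>x. x \<in> H1 \<Longrightarrow> adjoint_on UNIV P (P x) = x"
    and R: "bounded_op_on UNIV R" "\<And>x. P (R x) = R (P x)"
      "\<And>x. adjoint_on UNIV P (R x) = R (adjoint_on UNIV P x)"
  shows "R ` H1 \<subseteq> H1"
proof (rule levan_isometric_part_contains[OF P dec])
  have H1: "closed_csubspace H1" "P ` H1 \<subseteq> H1" "adjoint_on UNIV P ` H1 \<subseteq> H1"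
    using dec unfolding levan_decomposition_def reduces_on_def by auto
  show "P ` R ` H1 \<subseteq> R ` H1" "adjoint_on UNIV P ` R ` H1 \<subseteq> R ` H1" using H1 R(2,3) by auto
  show "adjoint_on UNIV P (P x) = x" if "x \<in> R ` H1" for x using that iso R(2,3) by auto
qed (use range_restriction_subspace[OF R(1)] dec in \<open>auto simp: levan_decomposition_def reduces_on_def\<close>)

text \<open>
  On the isometric part the fundamental relation reads \<open>S\<^sub>i x = P* S\<^sub>i P x\<close>, so \<open>P\<close> is isometric on the
  invariant subspace spanned by \<open>S\<^sub>i H1\<close>; maximality absorbs it into \<open>H1\<close>.  The adjoint is handled by
  \<open>S\<^sub>i* x = P* S\<^bsub>n-i\<^esub> x\<close>.
\<close>

lemma maximal_isometric_part_reduces: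
  fixes T :: "nat \<Rightarrow> 'a \<Rightarrow> 'a :: complex_hilbert"
  assumes S: "spectral_set n UNIV T (Gamma_set n)" and C: "commuting_tuple_on n UNIV T"
    and max: "maximal_isometric_subspace UNIV (T n) H1"
    and H1: "reduces_on UNIV (T n) H1"
    and iso: "\<And>x. x \<in> H1 \<Longrightarrow> adjoint_on UNIV (T n) (T n x) = x"
    and i: "1 \<le> i" "i < n"
  shows "reduces_on UNIV (T i) H1"
proof -
  let ?P = "T n" let ?Pa = "adjoint_on UNIV ?P"
  have mem: "i \<in> {1..n}" "n - i \<in> {1..n}" "n \<in> {1..n}" using i by auto
  have T: "bounded_op_on UNIV (T j)" if "j \<in> {1..n}" for j
    using C that unfolding commuting_tuple_on_def by auto
  note P = T[OF mem(3)]
  have comm: "T j (T l x) = T l (T j x)" if "j \<in> {1..n}" "l \<in> {1..n}" for j l x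
    using C that unfolding commuting_tuple_on_def by auto
  have sub: "closed_csubspace H1" and PH1: "?P ` H1 \<subseteq> H1" and PaH1: "?Pa ` H1 \<subseteq> H1"
    using H1 unfolding reduces_on_def by auto
  have x_iso: "cinner (?P x) (?P y) = cinner x y" if "x \<in> H1" for x y
    using cinner_adjoint_UNIV_left[OF P, of "?P x" y] iso[OF that] by simp
  have adj: "adjoint_on UNIV (T j) x = ?Pa (T (n - j) x)" if j: "1 \<le> j" "j < n" and x: "x \<in> H1" for j x
  proof (rule adjoint_on_eqI)
    show "cinner (T j y) x = cinner y (?Pa (T (n - j) x))" for y
      using fundamental_relation(2)[OF S T j x_iso[OF x]] cinner_adjoint_UNIV[OF P] by simp
  qed auto
  have inv: "T j ` H1 \<subseteq> H1" if j: "1 \<le> j" "j < n" for j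
  proof -
    have memj: "j \<in> {1..n}" "n - j \<in> {1..n}" "n \<in> {1..n}" using j by auto
    have PaPT: "?Pa (?P (T j x)) = T j x" if x: "x \<in> H1" for x
    proof -
      have Px: "?P x \<in> H1" using x PH1 by auto
      have "T j x = adjoint_on UNIV (T (n - j)) (?P x)"
      proof (rule cinner_ext_left)
        show "cinner (T j x) y = cinner (adjoint_on UNIV (T (n - j)) (?P x)) y" for y
          using fundamental_relation(1)[OF S T j x_iso[OF x]] cinner_adjoint_UNIV_left[OF T[OF memj(2)]]
          by simp
      qed
      also have "\<dots> = ?Pa (T j (?P x))" using adj[of "n - j" "?P x"] j Px by simp
      finally show ?thesis using comm[OF memj(1,3)] by simp
    qed
    define L where "L = closure (T j ` H1)"
    have L: "closed_csubspace L"
      unfolding L_def using range_restriction_subspace[OF T[OF memj(1)] sub] by (intro closed_csubspace_closure)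
    have "?P ` T j ` H1 \<subseteq> T j ` H1" using comm[OF memj(1,3)] PH1 by (intro image_commuting_invariant) auto
    then have PL: "?P ` L \<subseteq> L"
      unfolding L_def by (rule bounded_linear_image_closure[OF bounded_op_on_UNIV_bounded_linear[OF P]])
    have norm_P: "norm (?P y) = norm y" if "y \<in> L" for y
    proof -
      have "closed {y. norm (?P y) = norm y}"
        using linear_continuous_on[OF bounded_op_on_UNIV_bounded_linear[OF P]]
        by (intro closed_Collect_eq continuous_intros)
      moreover have "norm (?P (T j x)) = norm (T j x)" if "x \<in> H1" for x
      proof -
        have "cinner (?P (T j x)) (?P (T j x)) = cinner (T j x) (T j x)"
          using cinner_adjoint_UNIV[OF P, of "T j x" "?P (T j x)"] PaPT[OF that] by simp
        then have "(norm (?P (T j x)))\<^sup>2 = (norm (T j x))\<^sup>2" unfolding Re_cinner_self[symmetric] by simp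
        then show ?thesis by simp
      qed
      then have "T j ` H1 \<subseteq> {y. norm (?P y) = norm y}" by auto
      ultimately have "L \<subseteq> {y. norm (?P y) = norm y}" unfolding L_def by (simp add: closure_minimal)
      then show ?thesis using that by blast
    qed
    have "isometry_on L ?P"
      unfolding isometry_on_def using bounded_op_on_subspace[OF P PL] norm_P by simp
    then have "L \<subseteq> H1" using max L PL unfolding maximal_isometric_subspace_def by auto
    then show ?thesis unfolding L_def using closure_subset by blast
  qed
  have "adjoint_on UNIV (T i) ` H1 \<subseteq> H1"
  proof (rule image_subsetI)
    fix x assume x: "x \<in> H1"
    have "1 \<le> n - i" "n - i < n" using i by auto
    then have "T (n - i) x \<in> H1" using inv x by blast
    then show "adjoint_on UNIV (T i) x \<in> H1" using adj[OF i x] PaH1 by auto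
  qed
  then show ?thesis using inv[OF i] sub unfolding reduces_on_def by simp
qed

text \<open>The hypotheses on \<open>R\<close> are invariant under taking the adjoint of \<open>R\<close>.\<close>

lemma doubly_commuting_isometric_part_reduces:
  assumes P: "bounded_op_on UNIV P" and dec: "levan_decomposition UNIV P H1 H2"
    and iso: "\<And>x. x \<in> H1 \<Longrightarrow> adjoint_on UNIV P (P x) = x"
    and R: "bounded_op_on UNIV R" "\<And>x. P (R x) = R (P x)"
      "\<And>x. adjoint_on UNIV P (R x) = R (adjoint_on UNIV P x)"
  shows "reduces_on UNIV R H1"
proof -
  let ?Pa = "adjoint_on UNIV P" and ?Ra = "adjoint_on UNIV R"
  note adjs = cinner_adjoint_UNIV[OF P] cinner_adjoint_UNIV_left[OF P] cinner_adjoint_UNIV_left[OF R(1)]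
  have "P (?Ra x) = ?Ra (P x)" for x
    by (rule cinner_ext_left) (simp add: adjs R(3))
  moreover have "?Pa (?Ra x) = ?Ra (?Pa x)" for x
    by (rule cinner_ext_left) (simp add: adjs R(2))
  ultimately have "?Ra ` H1 \<subseteq> H1"
    by (intro doubly_commuting_preserves_isometric_part[OF P dec iso bounded_op_on_adjoint_UNIV[OF R(1)]])
  then show ?thesis
    using doubly_commuting_preserves_isometric_part[OF P dec iso R] dec
    unfolding levan_decomposition_def reduces_on_def by auto
qed

section \<open>Exactness of the Koszul complex\<close>

lemma clinear_onD:
  assumes "clinear_on M T"
  shows "x \<in> M \<Longrightarrow> y \<in> M \<Longrightarrow> T (x + y) = T x + T y" "x \<in> M \<Longrightarrow> T (c *\<^sub>C x) = c *\<^sub>C T x"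
    "x \<in> M \<Longrightarrow> T (r *\<^sub>R x) = r *\<^sub>R T x"
  using assms by (auto simp: clinear_on_def scaleR_scaleC)

lemma clinear_on_zero: "clinear_on M T \<Longrightarrow> closed_csubspace M \<Longrightarrow> T 0 = 0"
  using clinear_onD(2)[of M T 0 0] by (simp add: closed_csubspace_zero)

lemma clinear_on_diff:
  assumes "clinear_on M T" "closed_csubspace M" "x \<in> M" "y \<in> M"
  shows "T (x - y) = T x - T y"
  using clinear_onD(1)[OF assms(1), of "x - y" y] closed_csubspace_diff[OF assms(2-4)] assms(4)
  by (simp add: eq_diff_eq)

lemma clinear_on_sum:
  assumes T: "clinear_on M T" and M: "closed_csubspace M" and f: "\<And>i. i \<in> I \<Longrightarrow> f i \<in> M"
  shows "T (\<Sum>i\<in>I. f i) = (\<Sum>i\<in>I. T (f i))"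
  using f
proof (induction I rule: infinite_finite_induct)
  case (insert i I)
  then have "T (f i + (\<Sum>i\<in>I. f i)) = T (f i) + T (\<Sum>i\<in>I. f i)"
    by (intro clinear_onD(1)[OF T] closed_csubspace_sum[OF M]) auto
  then show ?case using insert by simp
qed (simp_all add: clinear_on_zero[OF T M])

lemma closed_csubspace_scaleR: "closed_csubspace M \<Longrightarrow> x \<in> M \<Longrightarrow> r *\<^sub>R x \<in> M"
  by (simp add: scaleR_scaleC closed_csubspace_scaleC)

lemma scaleR_scaleC_commute: "c *\<^sub>C r *\<^sub>R x = r *\<^sub>R c *\<^sub>C (x :: 'a :: complex_hilbert)"
  by (simp add: scaleR_scaleC scaleC_scaleC mult.commute)

definition koszul_sign :: "nat \<Rightarrow> nat set \<Rightarrow> real" where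
  "koszul_sign i I = (- 1) ^ card {j \<in> I. j < i}"

lemma koszul_sign_square: "koszul_sign i I * koszul_sign i I = 1"
  by (simp add: koszul_sign_def flip: power_mult_distrib)

lemma koszul_sign_remove_self: "koszul_sign i (I - {i}) = koszul_sign i I"
proof -
  have "{j \<in> I - {i}. j < i} = {j \<in> I. j < i}" by auto
  then show ?thesis by (simp add: koszul_sign_def)
qed

lemma koszul_sign_insert_self: "koszul_sign i (insert i I) = koszul_sign i I"
proof -
  have "{j \<in> insert i I. j < i} = {j \<in> I. j < i}" by auto
  then show ?thesis by (simp add: koszul_sign_def)
qed

lemma koszul_sign_exchange:
  assumes I: "finite I" "i \<in> I" "j \<notin> I"
  shows "koszul_sign j I * koszul_sign i (insert j I) = - (koszul_sign i I * koszul_sign j (I - {i}))"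
proof (cases "i < j")
  case True
  have "{l \<in> I. l < j} = insert i {l \<in> I - {i}. l < j}" using I True by auto
  then have "koszul_sign j I = - koszul_sign j (I - {i})" using I by (simp add: koszul_sign_def)
  moreover have "{l \<in> insert j I. l < i} = {l \<in> I. l < i}" using True by auto
  then have "koszul_sign i (insert j I) = koszul_sign i I" by (simp add: koszul_sign_def)
  ultimately show ?thesis by simp
next
  case False
  then have ji: "j < i" using I by (metis linorder_neqE_nat)
  have "{l \<in> insert j I. l < i} = insert j {l \<in> I. l < i}" using ji by auto
  then have "koszul_sign i (insert j I) = - koszul_sign i I" using I by (simp add: koszul_sign_def)
  moreover have "{l \<in> I - {i}. l < j} = {l \<in> I. l < j}" using ji by auto
  then have "koszul_sign j (I - {i}) = koszul_sign j I" by (simp add: koszul_sign_def)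
  ultimately show ?thesis by simp
qed

text \<open>Contraction of a chain with the linear form \<open>e\<^sub>j \<mapsto> c j\<close>.\<close>

definition koszul_contract ::
    "nat \<Rightarrow> (nat \<Rightarrow> complex) \<Rightarrow> (nat set \<Rightarrow> 'a :: complex_hilbert) \<Rightarrow> nat set \<Rightarrow> 'a" where
  "koszul_contract n c x = (\<lambda>I. if I \<subseteq> {1..n}
     then (\<Sum>j\<in>{1..n} - I. koszul_sign j I *\<^sub>R c j *\<^sub>C x (insert j I)) else 0)"

lemma koszul_diff_sign:
  "I \<subseteq> {1..n} \<Longrightarrow> koszul_diff n T x I = (\<Sum>i\<in>I. koszul_sign i I *\<^sub>R T i (x (I - {i})))"
  by (simp add: koszul_diff_def koszul_sign_def)

text \<open>
  Cartan's homotopy formula.  In both compositions the diagonal terms give \<open>c\<^sub>i T\<^sub>i x\<close>, over \<open>i \<in> I\<close>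
  in the first and over \<open>i \<notin> I\<close> in the second; the others exchange an element of \<open>I\<close> for one outside,
  and cancel by the sign rule.
\<close>

lemma koszul_homotopy:
  assumes M: "closed_csubspace M" and T: "\<And>i. i \<in> {1..n} \<Longrightarrow> clinear_on M (T i)"
    and x: "\<And>I. x I \<in> M" and I: "I \<subseteq> {1..n}"
  shows "koszul_diff n T (koszul_contract n c x) I + koszul_contract n c (koszul_diff n T x) I
    = (\<Sum>i\<in>{1..n}. c i *\<^sub>C T i (x I))"
proof -
  have fin: "finite I" using I finite_subset by blast
  let ?J = "{1..n} - I"
  define B where "B i j = (koszul_sign i I * koszul_sign j (I - {i})) *\<^sub>R c j *\<^sub>C T i (x (insert j (I - {i})))" for i j
  have "koszul_sign i I *\<^sub>R T i (koszul_contract n c x (I - {i})) = c i *\<^sub>C T i (x I) + (\<Sum>j\<in>?J. B i j)"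
    if i: "i \<in> I" for i
  proof -
    have set: "{1..n} - (I - {i}) = insert i ?J" "I - {i} \<subseteq> {1..n}" "i \<notin> ?J" "insert i (I - {i}) = I"
      using i I by auto
    have "koszul_contract n c x (I - {i})
        = (\<Sum>j\<in>insert i ?J. koszul_sign j (I - {i}) *\<^sub>R c j *\<^sub>C x (insert j (I - {i})))"
      unfolding koszul_contract_def set(1) using set(2) by simp
    also have "T i \<dots> = (\<Sum>j\<in>insert i ?J. T i (koszul_sign j (I - {i}) *\<^sub>R c j *\<^sub>C x (insert j (I - {i}))))"
      using i I by (intro clinear_on_sum[OF T M] closed_csubspace_scaleR[OF M] closed_csubspace_scaleC[OF M] x) auto
    also have "\<dots> = (\<Sum>j\<in>insert i ?J. koszul_sign j (I - {i}) *\<^sub>R c j *\<^sub>C T i (x (insert j (I - {i}))))"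
      using i I by (intro sum.cong refl)
        (simp add: clinear_onD(2,3)[OF T] subset_iff closed_csubspace_scaleC[OF M] x)
    finally have "koszul_sign i I *\<^sub>R T i (koszul_contract n c x (I - {i})) = (\<Sum>j\<in>insert i ?J. B i j)"
      by (simp add: B_def scaleR_sum_right del: sum.insert)
    also have "\<dots> = B i i + (\<Sum>j\<in>?J. B i j)" using set(3) by (intro sum.insert) auto
    also have "B i i = c i *\<^sub>C T i (x I)"
      unfolding B_def koszul_sign_remove_self koszul_sign_square set(4) by simp
    finally show ?thesis .
  qed
  then have first: "koszul_diff n T (koszul_contract n c x) I
      = (\<Sum>i\<in>I. c i *\<^sub>C T i (x I)) + (\<Sum>i\<in>I. \<Sum>j\<in>?J. B i j)"
    by (simp add: koszul_diff_sign[OF I] sum.distrib)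
  have "koszul_sign j I *\<^sub>R c j *\<^sub>C koszul_diff n T x (insert j I) = c j *\<^sub>C T j (x I) - (\<Sum>i\<in>I. B i j)"
    if j: "j \<in> ?J" for j
  proof -
    define B' where "B' i = (koszul_sign j I * koszul_sign i (insert j I)) *\<^sub>R c j *\<^sub>C T i (x (insert j I - {i}))" for i
    have sub: "insert j I \<subseteq> {1..n}" and jI: "j \<notin> I" using j I by auto
    have "koszul_sign j I *\<^sub>R c j *\<^sub>C koszul_diff n T x (insert j I) = (\<Sum>i\<in>insert j I. B' i)"
      unfolding koszul_diff_sign[OF sub] B'_def
      by (simp add: scaleC_sum_right scaleR_sum_right scaleR_scaleC_commute del: sum.insert)
    also have "\<dots> = B' j + (\<Sum>i\<in>I. B' i)" using jI fin by (intro sum.insert) auto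
    also have "B' j = c j *\<^sub>C T j (x I)"
      unfolding B'_def koszul_sign_insert_self koszul_sign_square using jI by simp
    also have "(\<Sum>i\<in>I. B' i) = (\<Sum>i\<in>I. - B i j)"
    proof (rule sum.cong[OF refl])
      fix i assume i: "i \<in> I"
      then have "insert j I - {i} = insert j (I - {i})" using jI by auto
      then show "B' i = - B i j"
        unfolding B'_def B_def koszul_sign_exchange[OF fin i jI] by simp
    qed
    finally show ?thesis by (simp add: sum_negf)
  qed
  then have second: "koszul_contract n c (koszul_diff n T x) I
      = (\<Sum>j\<in>?J. c j *\<^sub>C T j (x I)) - (\<Sum>j\<in>?J. \<Sum>i\<in>I. B i j)"
    using I by (simp add: koszul_contract_def sum_subtractf)
  have "(\<Sum>i\<in>I. c i *\<^sub>C T i (x I)) + (\<Sum>j\<in>?J. c j *\<^sub>C T j (x I)) = (\<Sum>i\<in>{1..n}. c i *\<^sub>C T i (x I))"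
    using sum.subset_diff[OF I, of "\<lambda>i. c i *\<^sub>C T i (x I)"] by simp
  then show ?thesis
    unfolding first second sum.swap[of _ ?J I] by (simp add: algebra_simps)
qed

text \<open>
  If some linear combination \<open>Q = \<Sum> c\<^sub>i T\<^sub>i\<close> is invertible, the homotopy formula shows every cycle
  \<open>x\<close> to be the boundary of the contraction of \<open>Q\<inverse> x\<close>.
\<close>

lemma koszul_exact_if_combination_invertible:
  assumes M: "closed_csubspace M"
    and T: "\<And>i. i \<in> {1..n} \<Longrightarrow> clinear_on M (T i)" "\<And>i x. i \<in> {1..n} \<Longrightarrow> x \<in> M \<Longrightarrow> T i x \<in> M"
    and comm: "\<And>i j x. i \<in> {1..n} \<Longrightarrow> j \<in> {1..n} \<Longrightarrow> x \<in> M \<Longrightarrow> T i (T j x) = T j (T i x)"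
    and R: "\<And>x. x \<in> M \<Longrightarrow> R x \<in> M"
      "\<And>x. x \<in> M \<Longrightarrow> R (\<Sum>i\<in>{1..n}. c i *\<^sub>C T i x) = x"
      "\<And>x. x \<in> M \<Longrightarrow> (\<Sum>i\<in>{1..n}. c i *\<^sub>C T i (R x)) = x"
  shows "koszul_exact n M T"
proof -
  define Q where "Q x = (\<Sum>i\<in>{1..n}. c i *\<^sub>C T i x)" for x
  have Q_mem: "Q x \<in> M" if "x \<in> M" for x
    unfolding Q_def using that T(2) by (intro closed_csubspace_sum[OF M] closed_csubspace_scaleC[OF M])
  have RQ: "R (Q x) = x" and QR: "Q (R x) = x" if "x \<in> M" for x
    using R(2,3)[OF that] unfolding Q_def by auto
  have Q_add: "Q (x + y) = Q x + Q y" if "x \<in> M" "y \<in> M" for x y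
    unfolding Q_def using that by (simp add: clinear_onD(1)[OF T(1)] scaleC_add_right sum.distrib)
  have Q_scale: "Q (a *\<^sub>C x) = a *\<^sub>C Q x" if "x \<in> M" for a x
    unfolding Q_def using that
    by (simp add: clinear_onD(2)[OF T(1)] scaleC_sum_right scaleC_scaleC mult.commute)
  have Q_T: "Q (T j x) = T j (Q x)" if j: "j \<in> {1..n}" and x: "x \<in> M" for j x
  proof -
    have "T j (Q x) = (\<Sum>i\<in>{1..n}. T j (c i *\<^sub>C T i x))"
      unfolding Q_def using x T(2) by (intro clinear_on_sum[OF T(1)[OF j] M] closed_csubspace_scaleC[OF M])
    then show ?thesis
      unfolding Q_def using x T(2) comm j clinear_onD(2)[OF T(1)[OF j]] by (auto intro!: sum.cong)
  qed
  have R_eqI: "R y = x" if "x \<in> M" "Q x = y" for x y using RQ that by blast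
  have lin_R: "clinear_on M R"
    unfolding clinear_on_def
  proof (intro conjI ballI allI)
    fix x y assume xy: "x \<in> M" "y \<in> M"
    show "R (x + y) = R x + R y"
      using xy R(1) QR Q_add by (intro R_eqI closed_csubspace_add[OF M]) auto
  next
    fix a x assume x: "x \<in> M"
    show "R (a *\<^sub>C x) = a *\<^sub>C R x"
      using x R(1) QR Q_scale by (intro R_eqI closed_csubspace_scaleC[OF M]) auto
  qed
  have R0: "R 0 = 0" by (rule clinear_on_zero[OF lin_R M])
  have R_T: "R (T j x) = T j (R x)" if j: "j \<in> {1..n}" and x: "x \<in> M" for j x
    using j x R(1) T(2) Q_T QR by (intro R_eqI) auto
  have chain_mem: "x I \<in> M" if "x \<in> koszul_chain n k M" for x k I
  proof -
    have "if I \<subseteq> {1..n} \<and> card I = k then x I \<in> M else x I = 0"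
      using that unfolding koszul_chain_def by blast
    then show ?thesis by (auto split: if_splits intro: closed_csubspace_zero[OF M])
  qed
  have chain_zero: "x I = 0" if "x \<in> koszul_chain n k M" "card I \<noteq> k \<or> \<not> I \<subseteq> {1..n}" for x k I
  proof -
    have "if I \<subseteq> {1..n} \<and> card I = k then x I \<in> M else x I = 0"
      using that(1) unfolding koszul_chain_def by blast
    then show ?thesis using that(2) by (auto split: if_splits)
  qed
  have contract_zero: "koszul_contract n c y I = 0"
    if y: "\<And>J. card J \<noteq> k \<Longrightarrow> y J = 0" and I: "I \<subseteq> {1..n} \<Longrightarrow> Suc (card I) \<noteq> k" for y :: "nat set \<Rightarrow> 'a" and k I
  proof (cases "I \<subseteq> {1..n}")
    case True
    then have "finite I" using finite_subset by blast
    then have "y (insert j I) = 0" if "j \<in> {1..n} - I" for j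
      using that I[OF True] by (intro y) simp
    then show ?thesis by (simp add: koszul_contract_def)
  qed (simp add: koszul_contract_def)
  show ?thesis
    unfolding koszul_exact_def
  proof (intro conjI ballI allI impI)
    fix x assume x: "x \<in> koszul_chain n 0 M" and dx: "koszul_diff n T x = (\<lambda>_. 0)"
    have "x I = 0" for I
    proof (cases "I \<subseteq> {1..n}")
      case True
      have "koszul_contract n c x = (\<lambda>_. 0)"
        using chain_zero[OF x] by (intro ext contract_zero[of 0]) auto
      then have "koszul_diff n T (koszul_contract n c x) I = 0"
        unfolding koszul_diff_def using True
        by (auto intro!: sum.neutral simp: clinear_on_zero[OF T(1) M] subset_iff)
      moreover have "koszul_contract n c (koszul_diff n T x) I = 0"
        unfolding dx koszul_contract_def by simp
      ultimately have "Q (x I) = 0"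
        using koszul_homotopy[where T = T and x = x and c = c, OF M T(1) chain_mem[OF x] True] unfolding Q_def by simp
      then show ?thesis using RQ[OF chain_mem[OF x], of I] R0 by simp
    qed (use chain_zero[OF x] in auto)
    then show "x = (\<lambda>_. 0)" by auto
  next
    fix k x assume k: "k < n" and x: "x \<in> koszul_chain n (Suc k) M" and dx: "koszul_diff n T x = (\<lambda>_. 0)"
    define Rx where "Rx I = R (x I)" for I
    have Rx_mem: "Rx I \<in> M" for I unfolding Rx_def using R(1) chain_mem[OF x] by auto
    have dRx: "koszul_diff n T Rx = (\<lambda>_. 0)"
    proof
      fix I
      have "koszul_diff n T Rx I = R (koszul_diff n T x I)" if I: "I \<subseteq> {1..n}"
      proof -
        have "R (koszul_diff n T x I) = (\<Sum>i\<in>I. R (koszul_sign i I *\<^sub>R T i (x (I - {i}))))"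
          unfolding koszul_diff_sign[OF I] using I chain_mem[OF x] T(2)
          by (intro clinear_on_sum[OF lin_R M] closed_csubspace_scaleR[OF M]) auto
        also have "\<dots> = (\<Sum>i\<in>I. koszul_sign i I *\<^sub>R T i (Rx (I - {i})))"
        proof (rule sum.cong[OF refl])
          fix i assume i: "i \<in> I"
          then have i': "i \<in> {1..n}" using I by auto
          show "R (koszul_sign i I *\<^sub>R T i (x (I - {i}))) = koszul_sign i I *\<^sub>R T i (Rx (I - {i}))"
            unfolding Rx_def clinear_onD(3)[OF lin_R T(2)[OF i' chain_mem[OF x]]]
              R_T[OF i' chain_mem[OF x]] ..
        qed
        finally show ?thesis unfolding koszul_diff_sign[OF I] by simp
      qed
      then show "koszul_diff n T Rx I = 0"
        unfolding dx R0 by (cases "I \<subseteq> {1..n}") (auto simp: koszul_diff_def)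
    qed
    define y where "y = koszul_contract n c Rx"
    have y0: "y I = 0" if "card I \<noteq> k \<or> \<not> I \<subseteq> {1..n}" for I
      unfolding y_def
      by (rule contract_zero[of "Suc k"]) (use chain_zero[OF x] R0 that in \<open>auto simp: Rx_def\<close>)
    have "y I \<in> M" for I
      unfolding y_def koszul_contract_def using Rx_mem
      by (auto intro!: closed_csubspace_sum[OF M] closed_csubspace_scaleR[OF M] closed_csubspace_scaleC[OF M]
          closed_csubspace_zero[OF M])
    then have "y \<in> koszul_chain n k M" using y0 unfolding koszul_chain_def by auto
    moreover have "koszul_diff n T y I = x I" for I
    proof (cases "I \<subseteq> {1..n}")
      case True
      have "koszul_contract n c (koszul_diff n T Rx) I = 0"
        unfolding dRx koszul_contract_def by simp
      then have "koszul_diff n T y I = Q (Rx I)"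
        using koszul_homotopy[where T = T and x = Rx and c = c, OF M T(1) Rx_mem True] unfolding Q_def y_def by simp
      then show ?thesis unfolding Rx_def using QR[OF chain_mem[OF x]] by simp
    qed (use chain_zero[OF x] in \<open>auto simp: koszul_diff_def\<close>)
    ultimately show "\<exists>y\<in>koszul_chain n k M. koszul_diff n T y = x" by (intro bexI[of _ y]) auto
  qed
qed

section \<open>Extending operators along a unitary extension of an isometry\<close>

lemma norm_eq_if_cinner_self_eq:
  assumes "cinner x x = cinner y y"
  shows "norm x = norm y"
proof -
  have "(norm x)\<^sup>2 = (norm y)\<^sup>2" unfolding Re_cinner_self[symmetric] assms ..
  then show ?thesis by simp
qed

text \<open>
  \<open>U\<close> is a unitary operator on \<open>K\<close>, with inverse \<open>U'\<close>, that extends the isometry \<open>P\<close> on the isometric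
  copy \<open>V M\<close> of \<open>M\<close>; minimality of the extension is used in the form that the iterates \<open>U\<^sup>k f\<close> of any
  vector approach \<open>V M\<close>.
\<close>

locale unitary_extension =
  fixes M :: "'a :: complex_hilbert set" and P :: "'a \<Rightarrow> 'a"
    and K :: "'b :: complex_hilbert set" and U U' :: "'b \<Rightarrow> 'b" and V :: "'a \<Rightarrow> 'b"
  assumes M: "closed_csubspace M" and K: "closed_csubspace K"
    and P_mem: "x \<in> M \<Longrightarrow> P x \<in> M"
    and U_mem: "f \<in> K \<Longrightarrow> U f \<in> K" and U'_mem: "f \<in> K \<Longrightarrow> U' f \<in> K"
    and U_lin: "clinear_on K U" and U'_lin: "clinear_on K U'"
    and UU': "f \<in> K \<Longrightarrow> U (U' f) = f" and U'U: "f \<in> K \<Longrightarrow> U' (U f) = f"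
    and U_inner: "f \<in> K \<Longrightarrow> g \<in> K \<Longrightarrow> cinner (U f) (U g) = cinner f g"
    and V_mem: "x \<in> M \<Longrightarrow> V x \<in> K" and V_lin: "clinear_on M V"
    and V_inner: "x \<in> M \<Longrightarrow> y \<in> M \<Longrightarrow> cinner (V x) (V y) = cinner x y"
    and UV: "x \<in> M \<Longrightarrow> U (V x) = V (P x)"
    and approximable: "f \<in> K \<Longrightarrow> \<exists>h. (\<forall>k. h k \<in> M) \<and> (\<lambda>k. (U ^^ k) f - V (h k)) \<longlonglongrightarrow> 0"
begin

definition approximates :: "(nat \<Rightarrow> 'a) \<Rightarrow> 'b \<Rightarrow> bool" where
  "approximates h f \<longleftrightarrow> f \<in> K \<and> (\<forall>k. h k \<in> M) \<and> (\<lambda>k. (U ^^ k) f - V (h k)) \<longlonglongrightarrow> 0"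

definition commutant_op :: "('a \<Rightarrow> 'a) \<Rightarrow> bool" where
  "commutant_op X \<longleftrightarrow> bounded_op_on M X \<and> (\<forall>x\<in>M. X (P x) = P (X x))"

text \<open>
  On vectors \<open>U'\<^sup>k V x\<close>, which are dense in \<open>K\<close>, the extension of \<open>X\<close> has to be \<open>U'\<^sup>k V X x\<close>.  The choice of
  the approximating sequence is immaterial by \<open>extend_tendsto\<close> below.
\<close>

definition extend :: "('a \<Rightarrow> 'a) \<Rightarrow> 'b \<Rightarrow> 'b" where
  "extend X f = lim (\<lambda>k. (U' ^^ k) (V (X ((SOME h. approximates h f) k))))"

lemma norm_V: "x \<in> M \<Longrightarrow> norm (V x) = norm x"
  by (rule norm_eq_if_cinner_self_eq) (simp add: V_inner)

lemma Uk_mem: "f \<in> K \<Longrightarrow> (U ^^ k) f \<in> K"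
  by (induction k) (auto simp: U_mem)

lemma U'k_mem: "f \<in> K \<Longrightarrow> (U' ^^ k) f \<in> K"
  by (induction k) (auto simp: U'_mem)

lemma Pk_mem: "x \<in> M \<Longrightarrow> (P ^^ k) x \<in> M"
  by (induction k) (auto simp: P_mem)

lemma U_commutes_Uk: "U ((U ^^ k) f) = (U ^^ k) (U f)"
  by (simp add: funpow_swap1)

lemma U'k_Uk: "f \<in> K \<Longrightarrow> (U' ^^ k) ((U ^^ k) f) = f"
proof (induction k arbitrary: f)
  case (Suc k)
  then show ?case by (simp add: funpow_swap1[of U'] U'U U_mem Uk_mem)
qed simp

lemma Uk_U'k: "f \<in> K \<Longrightarrow> (U ^^ k) ((U' ^^ k) f) = f"
proof (induction k arbitrary: f)
  case (Suc k)
  then show ?case by (simp add: funpow_swap1[of U] UU' U'_mem U'k_mem)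
qed simp

lemma U'_inner: "f \<in> K \<Longrightarrow> g \<in> K \<Longrightarrow> cinner (U' f) (U' g) = cinner f g"
  using U_inner[OF U'_mem U'_mem] by (simp add: UU')

lemma U'k_inner: "f \<in> K \<Longrightarrow> g \<in> K \<Longrightarrow> cinner ((U' ^^ k) f) ((U' ^^ k) g) = cinner f g"
  by (induction k) (auto simp: U'_inner U'k_mem)

lemma Uk_inner: "f \<in> K \<Longrightarrow> g \<in> K \<Longrightarrow> cinner ((U ^^ k) f) ((U ^^ k) g) = cinner f g"
  by (induction k) (auto simp: U_inner Uk_mem)

lemma norm_U'k: "f \<in> K \<Longrightarrow> norm ((U' ^^ k) f) = norm f"
  by (rule norm_eq_if_cinner_self_eq) (simp add: U'k_inner)

lemma norm_Uk: "f \<in> K \<Longrightarrow> norm ((U ^^ k) f) = norm f"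
  by (rule norm_eq_if_cinner_self_eq) (simp add: Uk_inner)

lemma U'k_lin: "clinear_on K (U' ^^ k)"
  using clinear_onD(1,2)[OF U'_lin] U'k_mem
  by (induction k) (auto simp: clinear_on_def)

lemma Uk_lin: "clinear_on K (U ^^ k)"
  using clinear_onD(1,2)[OF U_lin] Uk_mem
  by (induction k) (auto simp: clinear_on_def)

lemma UkV: "x \<in> M \<Longrightarrow> (U ^^ k) (V x) = V ((P ^^ k) x)"
  by (induction k) (auto simp: UV Pk_mem)

lemma commutant_opD:
  assumes "commutant_op X"
  shows "x \<in> M \<Longrightarrow> X x \<in> M" "x \<in> M \<Longrightarrow> X (P x) = P (X x)" "clinear_on M X"
  using assms unfolding commutant_op_def bounded_op_on_def by auto

lemma commutant_op_bound:
  assumes "commutant_op X"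
  obtains C where "C \<ge> 0" "\<And>x. x \<in> M \<Longrightarrow> norm (X x) \<le> C * norm x"
proof -
  obtain C where C: "\<And>x. x \<in> M \<Longrightarrow> norm (X x) \<le> C * norm x"
    using assms unfolding commutant_op_def bounded_op_on_def by auto
  have "norm (X x) \<le> max 0 C * norm x" if "x \<in> M" for x
    using C[OF that] mult_right_mono[of C "max 0 C" "norm x"] by simp
  then show ?thesis using that[of "max 0 C"] by simp
qed

lemma commutant_op_Pk: "commutant_op X \<Longrightarrow> x \<in> M \<Longrightarrow> X ((P ^^ k) x) = (P ^^ k) (X x)"
  by (induction k) (auto simp: commutant_opD Pk_mem)

lemma approximatesD:
  assumes "approximates h f"
  shows "f \<in> K" "h k \<in> M" "(\<lambda>k. norm ((U ^^ k) f - V (h k))) \<longlonglongrightarrow> 0"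
  using assms unfolding approximates_def by (auto intro: tendsto_norm_zero)

lemma approximates_exists: "f \<in> K \<Longrightarrow> \<exists>h. approximates h f"
  using approximable unfolding approximates_def by auto

lemma approximates_iff_pullback:
  assumes "f \<in> K" "\<And>k. h k \<in> M"
  shows "approximates h f \<longleftrightarrow> (\<lambda>k. (U' ^^ k) (V (h k))) \<longlonglongrightarrow> f"
proof -
  have "norm ((U ^^ k) f - V (h k)) = norm ((U' ^^ k) (V (h k)) - f)" for k
  proof -
    have "norm ((U ^^ k) f - V (h k)) = norm ((U' ^^ k) ((U ^^ k) f - V (h k)))"
      using assms by (intro norm_U'k[symmetric] closed_csubspace_diff[OF K] Uk_mem V_mem)
    also have "(U' ^^ k) ((U ^^ k) f - V (h k)) = f - (U' ^^ k) (V (h k))"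
      using assms by (simp add: clinear_on_diff[OF U'k_lin K] Uk_mem V_mem U'k_Uk)
    finally show ?thesis by (simp add: norm_minus_commute)
  qed
  then show ?thesis
    using assms unfolding approximates_def LIM_zero_iff[of _ f, symmetric]
    by (simp add: tendsto_norm_zero_iff[of "\<lambda>k. (U ^^ k) f - V (h k)", symmetric]
        tendsto_norm_zero_iff[of "\<lambda>k. (U' ^^ k) (V (h k)) - f", symmetric])
qed

text \<open>The key estimate: pulling \<open>V X h\<^sub>k\<close> back by \<open>U'\<^sup>k\<close> gives a sequence whose increments are controlled
  by the approximation errors, since \<open>X\<close> commutes with \<open>P\<close>.\<close>

lemma pullback_difference:
  assumes X: "commutant_op X" and C: "C \<ge> 0" "\<And>x. x \<in> M \<Longrightarrow> norm (X x) \<le> C * norm x"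
    and h: "approximates h f" and h': "approximates h' f" and kl: "k \<le> l"
  shows "norm ((U' ^^ l) (V (X (h l))) - (U' ^^ k) (V (X (h' k))))
    \<le> C * (norm ((U ^^ l) f - V (h l)) + norm ((U ^^ k) f - V (h' k)))"
proof -
  obtain j where l: "l = j + k" using kl by (metis le_Suc_ex add.commute)
  note mem = approximatesD(1,2)[OF h] approximatesD(1,2)[OF h'] commutant_opD(1)[OF X]
  have "(U' ^^ k) (V (X (h' k))) = (U' ^^ k) ((U' ^^ j) ((U ^^ j) (V (X (h' k)))))"
    by (simp add: U'k_Uk V_mem mem)
  also have "\<dots> = (U' ^^ l) (V (X ((P ^^ j) (h' k))))"
    by (simp add: l funpow_add[symmetric] add.commute UkV mem commutant_op_Pk[OF X] flip: comp_apply[of "U' ^^ k"])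
  finally have "norm ((U' ^^ l) (V (X (h l))) - (U' ^^ k) (V (X (h' k))))
      = norm ((U' ^^ l) (V (X (h l)) - V (X ((P ^^ j) (h' k)))))"
    by (simp add: clinear_on_diff[OF U'k_lin K] V_mem mem Pk_mem)
  also have "\<dots> = norm (V (X (h l - (P ^^ j) (h' k))))"
    by (simp add: norm_U'k closed_csubspace_diff[OF K] closed_csubspace_diff[OF M] V_mem mem Pk_mem
        clinear_on_diff[OF commutant_opD(3)[OF X] M] clinear_on_diff[OF V_lin M])
  also have "\<dots> \<le> C * norm (h l - (P ^^ j) (h' k))"
    by (simp add: norm_V C mem closed_csubspace_diff[OF M] Pk_mem)
  also have "norm (h l - (P ^^ j) (h' k)) = norm (V (h l - (P ^^ j) (h' k)))"
    by (simp add: norm_V closed_csubspace_diff[OF M] mem Pk_mem)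
  also have "V (h l - (P ^^ j) (h' k)) = (U ^^ j) ((U ^^ k) f - V (h' k)) - ((U ^^ l) f - V (h l))"
    by (simp add: clinear_on_diff[OF V_lin M] clinear_on_diff[OF Uk_lin K] UkV mem Pk_mem Uk_mem V_mem l funpow_add)
  also have "norm \<dots> \<le> norm ((U ^^ j) ((U ^^ k) f - V (h' k))) + norm ((U ^^ l) f - V (h l))"
    by (rule norm_triangle_ineq4)
  also have "norm ((U ^^ j) ((U ^^ k) f - V (h' k))) = norm ((U ^^ k) f - V (h' k))"
    by (intro norm_Uk closed_csubspace_diff[OF K] Uk_mem V_mem mem)
  finally show ?thesis using C(1) by (simp add: mult_left_mono add.commute)
qed

lemma extend_tendsto:
  assumes X: "commutant_op X" and h: "approximates h f"
  shows "(\<lambda>k. (U' ^^ k) (V (X (h k)))) \<longlonglongrightarrow> extend X f"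
proof -
  obtain C where C: "C \<ge> 0" "\<And>x. x \<in> M \<Longrightarrow> norm (X x) \<le> C * norm x"
    using commutant_op_bound[OF X] by blast
  define h' where "h' = (SOME h. approximates h f)"
  have h': "approximates h' f"
    unfolding h'_def using approximates_exists[OF approximatesD(1)[OF h]] by (rule someI_ex)
  define c where "c k = (U' ^^ k) (V (X (h' k)))" for k
  define e where "e k = norm ((U ^^ k) f - V (h' k))" for k
  have e: "e \<longlonglongrightarrow> 0" unfolding e_def by (rule approximatesD(3)[OF h'])
  have "Cauchy c"
  proof (rule CauchyI')
    fix r :: real assume r: "r > 0"
    then have "\<forall>\<^sub>F k in sequentially. e k < r / (2 * (C + 1))"
      using C(1) by (intro order_tendstoD(2)[OF e]) simp
    then obtain N where N: "\<And>k. k \<ge> N \<Longrightarrow> e k < r / (2 * (C + 1))"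
      unfolding eventually_sequentially by blast
    have "dist (c k) (c l) < r" if kl: "k \<ge> N" "l > k" for k l
    proof -
      have "norm (c l - c k) \<le> C * (e l + e k)"
        unfolding c_def e_def using pullback_difference[OF X C h' h'] kl(2) by simp
      also have "\<dots> \<le> (C + 1) * (e l + e k)" by (rule mult_right_mono) (auto simp: e_def)
      also have "\<dots> < (C + 1) * (r / (2 * (C + 1)) + r / (2 * (C + 1)))"
        using N[of k] N[of l] kl C(1) by (intro mult_strict_left_mono add_strict_mono) auto
      also have "\<dots> = r"
      proof -
        have "C + 1 \<noteq> 0" using C(1) by simp
        then have "(C + 1) * (r / (2 * (C + 1))) = r / 2"
          by (metis nonzero_mult_divide_mult_cancel_right mult.commute times_divide_eq_right)
        then show ?thesis by (simp only: distrib_left)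
      qed
      finally show ?thesis by (simp add: dist_norm norm_minus_commute)
    qed
    then show "\<exists>N. \<forall>k\<ge>N. \<forall>l>k. dist (c k) (c l) < r" by blast
  qed
  then have "c \<longlonglongrightarrow> extend X f"
    unfolding extend_def h'_def[symmetric] c_def by (simp add: Cauchy_convergent_iff convergent_LIMSEQ_iff)
  moreover have "(\<lambda>k. (U' ^^ k) (V (X (h k))) - c k) \<longlonglongrightarrow> 0"
  proof (rule Lim_null_comparison)
    show "\<forall>\<^sub>F k in sequentially. norm ((U' ^^ k) (V (X (h k))) - c k) \<le> C * (norm ((U ^^ k) f - V (h k)) + e k)"
      unfolding c_def e_def using pullback_difference[OF X C h h'] by simp
    show "(\<lambda>k. C * (norm ((U ^^ k) f - V (h k)) + e k)) \<longlonglongrightarrow> 0"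
      using tendsto_mult[OF tendsto_const tendsto_add[OF approximatesD(3)[OF h] e], of C] by simp
  qed
  ultimately show ?thesis using tendsto_add by fastforce
qed

lemma extend_mem:
  assumes X: "commutant_op X" and f: "f \<in> K"
  shows "extend X f \<in> K"
proof -
  obtain h where h: "approximates h f" using approximates_exists[OF f] by blast
  show ?thesis
    using closed_sequentially[OF closed_csubspace_closed[OF K] _ extend_tendsto[OF X h]]
      approximatesD(2)[OF h] commutant_opD(1)[OF X] by (simp add: U'k_mem V_mem)
qed

text \<open>Applying \<open>X\<close> to approximants gives approximants of the image; this is what makes \<open>extend\<close>
  multiplicative.\<close>

lemma approximates_extend:
  assumes X: "commutant_op X" and h: "approximates h f"
  shows "approximates (\<lambda>k. X (h k)) (extend X f)"
  using extend_tendsto[OF X h] extend_mem[OF X approximatesD(1)[OF h]] approximatesD(2)[OF h] commutant_opD(1)[OF X]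
  by (subst approximates_iff_pullback) auto

lemma extend_eqI:
  assumes "commutant_op X" "approximates h f" "(\<lambda>k. (U' ^^ k) (V (X (h k)))) \<longlonglongrightarrow> g"
  shows "extend X f = g"
  using extend_tendsto[OF assms(1,2)] assms(3) by (rule LIMSEQ_unique)

lemma approximates_add:
  assumes h: "approximates h f" and h': "approximates h' g"
  shows "approximates (\<lambda>k. h k + h' k) (f + g)"
proof -
  note mem = approximatesD(1,2)[OF h] approximatesD(1,2)[OF h']
  have "(\<lambda>k. ((U ^^ k) f - V (h k)) + ((U ^^ k) g - V (h' k))) \<longlonglongrightarrow> 0 + 0"
    using h h' unfolding approximates_def by (intro tendsto_add) auto
  also have "(\<lambda>k. ((U ^^ k) f - V (h k)) + ((U ^^ k) g - V (h' k))) = (\<lambda>k. (U ^^ k) (f + g) - V (h k + h' k))"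
    by (simp add: clinear_onD(1)[OF Uk_lin] clinear_onD(1)[OF V_lin] mem algebra_simps)
  finally show ?thesis
    unfolding approximates_def by (simp add: mem closed_csubspace_add[OF K] closed_csubspace_add[OF M])
qed

lemma approximates_scaleC:
  assumes h: "approximates h f"
  shows "approximates (\<lambda>k. a *\<^sub>C h k) (a *\<^sub>C f)"
proof -
  note mem = approximatesD(1,2)[OF h]
  have "(\<lambda>k. a *\<^sub>C ((U ^^ k) f - V (h k))) \<longlonglongrightarrow> a *\<^sub>C 0"
    using h unfolding approximates_def by (intro tendsto_scaleC) auto
  also have "(\<lambda>k. a *\<^sub>C ((U ^^ k) f - V (h k))) = (\<lambda>k. (U ^^ k) (a *\<^sub>C f) - V (a *\<^sub>C h k))"
    by (simp add: clinear_onD(2)[OF Uk_lin] clinear_onD(2)[OF V_lin] mem scaleC_diff_right)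
  finally show ?thesis
    unfolding approximates_def by (simp add: mem closed_csubspace_scaleC[OF K] closed_csubspace_scaleC[OF M])
qed

lemma extend_linear:
  assumes X: "commutant_op X"
  shows "clinear_on K (extend X)"
  unfolding clinear_on_def
proof (intro conjI ballI allI)
  fix f g assume "f \<in> K" "g \<in> K"
  then obtain h h' where h: "approximates h f" "approximates h' g" using approximates_exists by meson
  note mem = approximatesD(2)[OF h(1)] approximatesD(2)[OF h(2)] commutant_opD(1)[OF X]
  have "(\<lambda>k. (U' ^^ k) (V (X (h k))) + (U' ^^ k) (V (X (h' k)))) \<longlonglongrightarrow> extend X f + extend X g"
    by (intro tendsto_add extend_tendsto X h)
  then show "extend X (f + g) = extend X f + extend X g"
    by (intro extend_eqI[OF X approximates_add[OF h]])
      (simp add: clinear_onD(1)[OF U'k_lin] clinear_onD(1)[OF V_lin] clinear_onD(1)[OF commutant_opD(3)[OF X]] mem V_mem)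
next
  fix a f assume "f \<in> K"
  then obtain h where h: "approximates h f" using approximates_exists by meson
  note mem = approximatesD(2)[OF h] commutant_opD(1)[OF X]
  have "(\<lambda>k. a *\<^sub>C (U' ^^ k) (V (X (h k)))) \<longlonglongrightarrow> a *\<^sub>C extend X f"
    by (intro tendsto_scaleC extend_tendsto X h)
  then show "extend X (a *\<^sub>C f) = a *\<^sub>C extend X f"
    by (intro extend_eqI[OF X approximates_scaleC[OF h]])
      (simp add: clinear_onD(2)[OF U'k_lin] clinear_onD(2)[OF V_lin] clinear_onD(2)[OF commutant_opD(3)[OF X]] mem V_mem)
qed

lemma commutant_op_id: "commutant_op (\<lambda>x. x)"
  unfolding commutant_op_def bounded_op_on_def clinear_on_def by (auto intro!: exI[of _ 1])

lemma extend_id: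
  assumes f: "f \<in> K"
  shows "extend (\<lambda>x. x) f = f"
proof -
  obtain h where h: "approximates h f" using approximates_exists[OF f] by blast
  show ?thesis
    using h approximates_iff_pullback[OF f approximatesD(2)[OF h]] by (intro extend_eqI[OF commutant_op_id h]) simp
qed

lemma extend_bounded:
  assumes X: "commutant_op X"
  shows "bounded_op_on K (extend X)"
proof -
  obtain C where C: "C \<ge> 0" "\<And>x. x \<in> M \<Longrightarrow> norm (X x) \<le> C * norm x"
    using commutant_op_bound[OF X] by blast
  have "norm (extend X f) \<le> C * norm f" if f: "f \<in> K" for f
  proof -
    obtain h where h: "approximates h f" using approximates_exists[OF f] by blast
    note mem = approximatesD(2)[OF h] commutant_opD(1)[OF X]
    have "(\<lambda>k. (U' ^^ k) (V (h k))) \<longlonglongrightarrow> f" using h approximates_iff_pullback[OF f mem(1)] by simp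
    then have "(\<lambda>k. C * norm ((U' ^^ k) (V (h k)))) \<longlonglongrightarrow> C * norm f" by (intro tendsto_intros)
    moreover have "norm ((U' ^^ k) (V (X (h k)))) \<le> C * norm ((U' ^^ k) (V (h k)))" for k
      using C(2)[OF mem(1)] by (simp add: norm_U'k V_mem mem norm_V)
    ultimately show ?thesis
      by (intro LIMSEQ_le[OF tendsto_norm[OF extend_tendsto[OF X h]]]) auto
  qed
  then show ?thesis
    unfolding bounded_op_on_def using extend_mem[OF X] extend_linear[OF X] by auto
qed

lemma extend_cong:
  assumes "\<And>x. x \<in> M \<Longrightarrow> X x = Y x" "f \<in> K"
  shows "extend X f = extend Y f"
proof -
  have "approximates (SOME h. approximates h f) f" using approximates_exists[OF assms(2)] by (rule someI_ex)
  then show ?thesis unfolding extend_def using assms(1) approximatesD(2) by simp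
qed

lemma commutant_op_comp:
  assumes X: "commutant_op X" and Y: "commutant_op Y"
  shows "commutant_op (\<lambda>x. X (Y x))"
proof -
  obtain C D where C: "C \<ge> 0" "\<And>x. x \<in> M \<Longrightarrow> norm (X x) \<le> C * norm x"
    and D: "D \<ge> 0" "\<And>x. x \<in> M \<Longrightarrow> norm (Y x) \<le> D * norm x"
    using commutant_op_bound[OF X] commutant_op_bound[OF Y] by metis
  have "norm (X (Y x)) \<le> (C * D) * norm x" if "x \<in> M" for x
    using C(2)[OF commutant_opD(1)[OF Y that]] mult_left_mono[OF D(2)[OF that] C(1)] by (simp add: mult.assoc)
  then show ?thesis
    unfolding commutant_op_def bounded_op_on_def clinear_on_def
    using commutant_opD[OF X] commutant_opD[OF Y] clinear_onD(1,2)[OF commutant_opD(3)[OF X]]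
      clinear_onD(1,2)[OF commutant_opD(3)[OF Y]] by auto
qed

lemma extend_comp:
  assumes X: "commutant_op X" and Y: "commutant_op Y" and f: "f \<in> K"
  shows "extend X (extend Y f) = extend (\<lambda>x. X (Y x)) f"
proof -
  obtain h where h: "approximates h f" using approximates_exists[OF f] by blast
  show ?thesis
    using extend_tendsto[OF commutant_op_comp[OF X Y] h]
    by (rule extend_eqI[OF X approximates_extend[OF Y h]])
qed

lemma extend_V:
  assumes X: "commutant_op X" and x: "x \<in> M"
  shows "extend X (V x) = V (X x)"
proof -
  have "approximates (\<lambda>k. (P ^^ k) x) (V x)"
    unfolding approximates_def using x by (simp add: V_mem Pk_mem UkV)
  moreover have "(U' ^^ k) (V (X ((P ^^ k) x))) = V (X x)" for k
    using x commutant_opD(1)[OF X x] by (simp add: commutant_op_Pk[OF X] U'k_Uk V_mem flip: UkV)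
  ultimately show ?thesis by (intro extend_eqI[OF X]) auto
qed

lemma extend_P:
  assumes P: "commutant_op P" and f: "f \<in> K"
  shows "extend P f = U f"
proof -
  obtain h where h: "approximates h f" using approximates_exists[OF f] by blast
  note mem = approximatesD(2)[OF h]
  have "(\<lambda>k. U ((U' ^^ k) (V (h k)))) \<longlonglongrightarrow> U f"
  proof (rule LIM_zero_cancel, rule tendsto_norm_zero_cancel)
    have "(\<lambda>k. (U' ^^ k) (V (h k)) - f) \<longlonglongrightarrow> 0"
      using h approximates_iff_pullback[OF f mem] by (simp add: LIM_zero)
    then have "(\<lambda>k. norm ((U' ^^ k) (V (h k)) - f)) \<longlonglongrightarrow> 0" by (rule tendsto_norm_zero)
    moreover have "norm (U ((U' ^^ k) (V (h k))) - U f) = norm ((U' ^^ k) (V (h k)) - f)" for k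
      using norm_Uk[of "(U' ^^ k) (V (h k)) - f" 1] f
      by (simp add: clinear_on_diff[OF U_lin K] U'k_mem V_mem mem closed_csubspace_diff[OF K])
    ultimately show "(\<lambda>k. norm (U ((U' ^^ k) (V (h k))) - U f)) \<longlonglongrightarrow> 0" by simp
  qed
  moreover have "U ((U' ^^ k) (V (h k))) = (U' ^^ k) (V (P (h k)))" for k
  proof -
    have "(U' ^^ k) (V (P (h k))) = (U' ^^ k) (U (V (h k)))" using UV mem by simp
    also have "U (V (h k)) = (U ^^ k) (U ((U' ^^ k) (V (h k))))"
      by (simp add: Uk_U'k V_mem mem flip: U_commutes_Uk)
    finally show ?thesis by (simp add: U'k_Uk U_mem U'k_mem V_mem mem)
  qed
  ultimately show ?thesis by (intro extend_eqI[OF P h]) simp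
qed

lemma extend_combination:
  assumes X: "\<And>i. i \<in> I \<Longrightarrow> commutant_op (X i)"
    and Y: "commutant_op (\<lambda>x. a *\<^sub>C x + (\<Sum>i\<in>I. c i *\<^sub>C X i x))" and f: "f \<in> K"
  shows "extend (\<lambda>x. a *\<^sub>C x + (\<Sum>i\<in>I. c i *\<^sub>C X i x)) f = a *\<^sub>C f + (\<Sum>i\<in>I. c i *\<^sub>C extend (X i) f)"
proof -
  obtain h where h: "approximates h f" using approximates_exists[OF f] by blast
  note mem = approximatesD(2)[OF h] commutant_opD(1)[OF X]
  have "(\<lambda>k. a *\<^sub>C (U' ^^ k) (V (h k)) + (\<Sum>i\<in>I. c i *\<^sub>C (U' ^^ k) (V (X i (h k)))))
      \<longlonglongrightarrow> a *\<^sub>C f + (\<Sum>i\<in>I. c i *\<^sub>C extend (X i) f)"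
    using h approximates_iff_pullback[OF f mem(1)]
    by (intro tendsto_add tendsto_sum tendsto_scaleC extend_tendsto X) auto
  moreover have "(U' ^^ k) (V (a *\<^sub>C h k + (\<Sum>i\<in>I. c i *\<^sub>C X i (h k))))
      = a *\<^sub>C (U' ^^ k) (V (h k)) + (\<Sum>i\<in>I. c i *\<^sub>C (U' ^^ k) (V (X i (h k))))" for k
  proof -
    have lin: "clinear_on M (\<lambda>x. (U' ^^ k) (V x))"
      unfolding clinear_on_def
      by (auto simp: clinear_onD[OF V_lin] clinear_onD[OF U'k_lin] V_mem)
    show ?thesis
      by (simp add: clinear_onD(1)[OF lin] clinear_on_sum[OF lin M] clinear_onD(2)[OF lin] mem
          closed_csubspace_scaleC[OF M] closed_csubspace_sum[OF M])
  qed
  ultimately show ?thesis by (intro extend_eqI[OF Y h]) simp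
qed

lemma extend_adjoint_relation:
  assumes P: "commutant_op P" and X: "commutant_op X" and Y: "commutant_op Y"
    and XY: "\<And>x y. x \<in> M \<Longrightarrow> y \<in> M \<Longrightarrow> cinner (X x) y = cinner (P x) (Y y)"
    and f: "f \<in> K" and g: "g \<in> K"
  shows "cinner (extend X f) g = cinner (U f) (extend Y g)"
proof -
  obtain h h' where h: "approximates h f" "approximates h' g" using approximates_exists f g by meson
  note mem = approximatesD(2)[OF h(1)] approximatesD(2)[OF h(2)] commutant_opD(1)[OF X] commutant_opD(1)[OF Y]
  have g_lim: "(\<lambda>k. (U' ^^ k) (V (h' k))) \<longlonglongrightarrow> g" using h(2) approximates_iff_pullback[OF g mem(2)] by simp
  have "(\<lambda>k. cinner ((U' ^^ k) (V (X (h k)))) ((U' ^^ k) (V (h' k)))) \<longlonglongrightarrow> cinner (extend X f) g"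
    by (intro tendsto_cinner extend_tendsto X h g_lim)
  moreover have "(\<lambda>k. cinner ((U' ^^ k) (V (P (h k)))) ((U' ^^ k) (V (Y (h' k))))) \<longlonglongrightarrow> cinner (extend P f) (extend Y g)"
    by (intro tendsto_cinner extend_tendsto P Y h)
  then have "(\<lambda>k. cinner ((U' ^^ k) (V (X (h k)))) ((U' ^^ k) (V (h' k)))) \<longlonglongrightarrow> cinner (extend P f) (extend Y g)"
    by (simp add: U'k_inner V_mem V_inner mem P_mem XY)
  ultimately have "cinner (extend X f) g = cinner (extend P f) (extend Y g)" by (rule LIMSEQ_unique)
  then show ?thesis unfolding extend_P[OF P f] .
qed

lemma extend_U':
  assumes P: "commutant_op P" and X: "commutant_op X" and f: "f \<in> K"
  shows "extend X (U' f) = U' (extend X f)"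
proof -
  have "U (extend X (U' f)) = extend P (extend X (U' f))"
    by (rule extend_P[OF P, symmetric]) (intro extend_mem X U'_mem f)
  also have "\<dots> = extend (\<lambda>x. X (P x)) (U' f)"
    unfolding extend_comp[OF P X U'_mem[OF f]]
    by (rule extend_cong) (simp_all add: commutant_opD(2)[OF X] U'_mem f)
  also have "\<dots> = extend X (U (U' f))"
    using extend_comp[OF X P U'_mem[OF f]] extend_P[OF P U'_mem[OF f]] by simp
  finally have "U' (U (extend X (U' f))) = U' (extend X f)" using UU'[OF f] by simp
  then show ?thesis by (simp add: U'U extend_mem[OF X] U'_mem f)
qed

text \<open>The adjoint of the extension of \<open>X\<close> is \<open>U\<inverse>\<close> times the extension of its companion \<open>Y\<close>, which lies
  in the same commutative algebra.\<close>

lemma extend_normal: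
  assumes P: "commutant_op P" and X: "commutant_op X" and Y: "commutant_op Y"
    and XY: "\<And>x y. x \<in> M \<Longrightarrow> y \<in> M \<Longrightarrow> cinner (X x) y = cinner (P x) (Y y)"
    and comm: "\<And>x. x \<in> M \<Longrightarrow> X (Y x) = Y (X x)"
  shows "normal_on K (extend X)"
proof -
  have adj: "adjoint_on K (extend X) g = U' (extend Y g)" if g: "g \<in> K" for g
  proof (rule adjoint_on_eqI[OF K])
    show "U' (extend Y g) \<in> K" by (intro U'_mem extend_mem Y g)
    fix f assume f: "f \<in> K"
    have "cinner (extend X f) g = cinner (U f) (U (U' (extend Y g)))"
      using extend_adjoint_relation[OF P X Y XY f g] UU'[OF extend_mem[OF Y g]] by simp
    also have "\<dots> = cinner f (U' (extend Y g))" by (intro U_inner f U'_mem extend_mem Y g)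
    finally show "cinner (extend X f) g = cinner f (U' (extend Y g))" .
  qed
  have "extend Y (extend X f) = extend X (extend Y f)" if "f \<in> K" for f
    unfolding extend_comp[OF X Y that] extend_comp[OF Y X that]
    by (rule extend_cong) (simp_all add: comm that)
  then have "adjoint_on K (extend X) (extend X f) = extend X (adjoint_on K (extend X) f)" if "f \<in> K" for f
    using that by (simp add: adj extend_mem[OF X] extend_mem[OF Y] extend_U'[OF P X])
  then show ?thesis unfolding normal_on_def using extend_bounded[OF X] by simp
qed

text \<open>The equation \<open>(U - l) g = f\<close> is the fixed point equation \<open>g = U' (f + l g)\<close>, whose right-hand side
  contracts by the factor \<open>\<bar>l\<bar>\<close>.\<close>

lemma contraction_resolvent:
  assumes l: "cmod l < 1"
  shows "\<exists>R. \<forall>f\<in>K. R f \<in> K \<and> R (U f - l *\<^sub>C f) = f \<and> U (R f) - l *\<^sub>C R f = f"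
proof -
  have ex: "\<exists>!g. g \<in> K \<and> U' (f + l *\<^sub>C g) = g" if f: "f \<in> K" for f
  proof -
    have "\<exists>!g. g \<in> K \<and> (\<lambda>g. U' (f + l *\<^sub>C g)) g = g"
    proof (rule Banach_fix)
      show "complete K" using closed_csubspace_closed[OF K] by (simp add: complete_eq_closed)
      show "K \<noteq> {}" using closed_csubspace_zero[OF K] by auto
      show "0 \<le> cmod l" "cmod l < 1" using l by auto
      show "(\<lambda>g. U' (f + l *\<^sub>C g)) ` K \<subseteq> K"
        using f by (auto intro!: U'_mem closed_csubspace_add[OF K] closed_csubspace_scaleC[OF K])
      fix g g' assume g: "g \<in> K" "g' \<in> K"
      have "U' (f + l *\<^sub>C g) - U' (f + l *\<^sub>C g') = U' ((f + l *\<^sub>C g) - (f + l *\<^sub>C g'))"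
        using f g by (intro clinear_on_diff[OF U'_lin K, symmetric] closed_csubspace_add[OF K] closed_csubspace_scaleC[OF K])
      also have "(f + l *\<^sub>C g) - (f + l *\<^sub>C g') = l *\<^sub>C (g - g')" by (simp add: scaleC_diff_right)
      also have "norm (U' (l *\<^sub>C (g - g'))) = norm (l *\<^sub>C (g - g'))"
        using norm_U'k[of "l *\<^sub>C (g - g')" 1] g
        by (simp add: closed_csubspace_scaleC[OF K] closed_csubspace_diff[OF K])
      finally show "dist (U' (f + l *\<^sub>C g)) (U' (f + l *\<^sub>C g')) \<le> cmod l * dist g g'"
        by (simp add: dist_norm norm_scaleC)
    qed
    then show ?thesis by simp
  qed
  define R where "R f = (THE g. g \<in> K \<and> U' (f + l *\<^sub>C g) = g)" for f
  have R: "R f \<in> K" "U' (f + l *\<^sub>C R f) = R f" if "f \<in> K" for f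
    using theI'[OF ex[OF that]] unfolding R_def by auto
  have "R (U f - l *\<^sub>C f) = f" if f: "f \<in> K" for f
    unfolding R_def
  proof (rule the1_equality[OF ex])
    show "U f - l *\<^sub>C f \<in> K" by (intro closed_csubspace_diff[OF K] U_mem closed_csubspace_scaleC[OF K] f)
    show "f \<in> K \<and> U' (U f - l *\<^sub>C f + l *\<^sub>C f) = f" using f by (simp add: U'U)
  qed
  moreover have "U (R f) - l *\<^sub>C R f = f" if f: "f \<in> K" for f
  proof -
    have "U (R f) = U (U' (f + l *\<^sub>C R f))" using R(2)[OF f] by simp
    also have "\<dots> = f + l *\<^sub>C R f"
      by (intro UU' closed_csubspace_add[OF K] closed_csubspace_scaleC[OF K] R(1) f)
    finally show ?thesis by simp
  qed
  ultimately show ?thesis using R(1) by blast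
qed

end

section \<open>The extension is unitary over the distinguished boundary\<close>

lemma scaleC_sum_left: "(\<Sum>i\<in>I. c i) *\<^sub>C x = (\<Sum>i\<in>I. c i *\<^sub>C (x :: 'a :: complex_hilbert))"
  by (induction I rule: infinite_finite_induct) (auto simp: scaleC_add_left)

lemma bounded_op_on_combination:
  assumes M: "closed_csubspace M" and T: "\<And>i. i \<in> I \<Longrightarrow> bounded_op_on M (T i)" and fin: "finite I"
  shows "bounded_op_on M (\<lambda>x. a *\<^sub>C x + (\<Sum>i\<in>I. c i *\<^sub>C T i x))"
proof -
  have mem: "T i x \<in> M" if "i \<in> I" "x \<in> M" for i x
    using T[OF that(1)] that(2) unfolding bounded_op_on_def by auto
  have lin: "clinear_on M (T i)" if "i \<in> I" for i using T[OF that] unfolding bounded_op_on_def by auto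
  have "\<forall>i\<in>I. \<exists>C. \<forall>x\<in>M. norm (T i x) \<le> C * norm x" using T unfolding bounded_op_on_def by auto
  then obtain C where C: "\<And>i x. i \<in> I \<Longrightarrow> x \<in> M \<Longrightarrow> norm (T i x) \<le> C i * norm x" by metis
  have "norm (a *\<^sub>C x + (\<Sum>i\<in>I. c i *\<^sub>C T i x)) \<le> (cmod a + (\<Sum>i\<in>I. cmod (c i) * C i)) * norm x"
    if x: "x \<in> M" for x
  proof -
    have "norm (\<Sum>i\<in>I. c i *\<^sub>C T i x) \<le> (\<Sum>i\<in>I. cmod (c i) * (C i * norm x))"
      by (rule sum_norm_le) (simp add: norm_scaleC mult_left_mono C x)
    then show ?thesis
      using norm_triangle_ineq[of "a *\<^sub>C x" "\<Sum>i\<in>I. c i *\<^sub>C T i x"]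
      by (simp add: norm_scaleC distrib_right sum_distrib_right mult.assoc)
  qed
  moreover have "clinear_on M (\<lambda>x. a *\<^sub>C x + (\<Sum>i\<in>I. c i *\<^sub>C T i x))"
    unfolding clinear_on_def
  proof (intro conjI ballI allI)
    fix x y assume "x \<in> M" "y \<in> M"
    then show "a *\<^sub>C (x + y) + (\<Sum>i\<in>I. c i *\<^sub>C T i (x + y))
        = a *\<^sub>C x + (\<Sum>i\<in>I. c i *\<^sub>C T i x) + (a *\<^sub>C y + (\<Sum>i\<in>I. c i *\<^sub>C T i y))"
      by (simp add: clinear_onD(1)[OF lin] scaleC_add_right sum.distrib)
  next
    fix b x assume "x \<in> M"
    then show "a *\<^sub>C b *\<^sub>C x + (\<Sum>i\<in>I. c i *\<^sub>C T i (b *\<^sub>C x))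
        = b *\<^sub>C (a *\<^sub>C x + (\<Sum>i\<in>I. c i *\<^sub>C T i x))"
      by (simp add: clinear_onD(2)[OF lin] scaleC_add_right scaleC_sum_right scaleC_scaleC mult.commute)
  qed
  ultimately show ?thesis
    unfolding bounded_op_on_def
    by (auto intro!: closed_csubspace_add[OF M] closed_csubspace_scaleC[OF M] closed_csubspace_sum[OF M] mem)
qed

lemma bounded_op_on_inverse:
  assumes M: "closed_csubspace M" and Q: "bounded_op_on M Q" "bij_betw Q M M"
    and below: "\<And>x. x \<in> M \<Longrightarrow> norm x \<le> C * norm (Q x)"
  shows "bounded_op_on M (inv_into M Q)"
proof -
  let ?R = "inv_into M Q"
  have lin: "clinear_on M Q" using Q(1) unfolding bounded_op_on_def by auto
  have R: "?R x \<in> M" "Q (?R x) = x" if "x \<in> M" for x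
    using Q(2) that by (auto simp: bij_betw_def inv_into_into f_inv_into_f)
  have eqI: "?R y = x" if "x \<in> M" "Q x = y" for x y
    using Q(2) that by (auto simp: bij_betw_def)
  have "clinear_on M ?R"
    unfolding clinear_on_def
  proof (intro conjI ballI allI)
    show "?R (x + y) = ?R x + ?R y" if "x \<in> M" "y \<in> M" for x y
      by (rule eqI) (simp_all add: that R closed_csubspace_add[OF M] clinear_onD(1)[OF lin])
    show "?R (c *\<^sub>C x) = c *\<^sub>C ?R x" if "x \<in> M" for c x
      by (rule eqI) (simp_all add: that R closed_csubspace_scaleC[OF M] clinear_onD(2)[OF lin])
  qed
  moreover have "norm (?R x) \<le> C * norm x" if "x \<in> M" for x using below[of "?R x"] R that by simp
  ultimately show ?thesis using R(1) unfolding bounded_op_on_def by auto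
qed

lemma root_form_eval:
  "w ^ n + (\<Sum>k\<in>{1..n}. (- 1) ^ k * w ^ (n - k) * symm_map n v k) = (\<Prod>i\<in>{1..n}. w - v i)"
proof -
  have "{..n} = insert 0 {1..n}" by auto
  then have "(\<Sum>k\<le>n. (- 1) ^ k * w ^ (n - k) * esym n k v)
      = w ^ n + (\<Sum>k\<in>{1..n}. (- 1) ^ k * w ^ (n - k) * esym n k v)" by simp
  then show ?thesis unfolding prod_diff_esym by (simp add: symm_map_esym)
qed

text \<open>
  For \<open>\<bar>w\<bar> > 1\<close> the affine function \<open>s \<mapsto> \<Prod>(w - z\<^sub>i)\<close>, where \<open>s = \<pi>(z)\<close>, is bounded below by
  \<open>(\<bar>w\<bar> - 1)\<^sup>n\<close> on the symmetrized polydisc, so that its value at the tuple is invertible.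
\<close>

lemma root_form_invertible:
  assumes M: "closed_csubspace M" and T: "commuting_tuple_on n M T"
    and S: "spectral_set n M T (Gamma_set n)" and w: "cmod w > 1"
  defines "Q \<equiv> \<lambda>x. w ^ n *\<^sub>C x + (\<Sum>k\<in>{1..n}. ((- 1) ^ k * w ^ (n - k)) *\<^sub>C T k x)"
  shows "bounded_op_on M Q" "bij_betw Q M M" "bounded_op_on M (inv_into M Q)"
proof -
  have lower: "(cmod w - 1) ^ n \<le> cmod (w ^ n + (\<Sum>k\<in>{1..n}. (- 1) ^ k * w ^ (n - k) * s k))"
    if s: "s \<in> Gamma_set n" for s
  proof -
    obtain v where v: "v \<in> {1..n} \<rightarrow>\<^sub>E cball 0 1" "s = symm_map n v" using s unfolding Gamma_set_def by blast
    have "(\<Prod>i\<in>{1..n}. cmod w - 1) \<le> (\<Prod>i\<in>{1..n}. cmod (w - v i))"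
    proof (rule prod_mono)
      fix i assume i: "i \<in> {1..n}"
      then have "cmod (v i) \<le> 1" using v(1) by (auto simp: PiE_iff)
      then show "0 \<le> cmod w - 1 \<and> cmod w - 1 \<le> cmod (w - v i)"
        using w norm_triangle_ineq2[of w "v i"] by simp
    qed
    then show ?thesis unfolding v(2) root_form_eval prod_norm by simp
  qed
  have pos: "(cmod w - 1) ^ n > 0" using w by simp
  show Qb: "bounded_op_on M Q"
    unfolding Q_def using T by (intro bounded_op_on_combination[OF M]) (auto simp: commuting_tuple_on_def)
  let ?q = "affine_poly n (w ^ n) (\<lambda>k. (- 1) ^ k * w ^ (n - k))"
  have "\<forall>s\<in>Gamma_set n. poly_at n ?q s \<noteq> 0"
    using lower pos by (fastforce simp: poly_at_affine)
  then have "bij_betw (poly_op n ?q T) M M"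
    using S affine_poly_in_cpolys[of n] unfolding spectral_set_def by blast
  moreover have "poly_op n ?q T = Q" unfolding Q_def by (rule ext) (rule poly_op_affine)
  ultimately show bij: "bij_betw Q M M" by simp
  have "norm x \<le> (1 / (cmod w - 1) ^ n) * norm (Q x)" if x: "x \<in> M" for x
  proof -
    have "norm (1 *\<^sub>C x + (\<Sum>k\<in>{1..n}. 0 *\<^sub>C T k x)) \<le> (1 / (cmod w - 1) ^ n) * norm (Q x)"
      unfolding Q_def
    proof (rule spectral_set_affine_bound[OF S _ _ x])
      show "w ^ n + (\<Sum>k\<in>{1..n}. (- 1) ^ k * w ^ (n - k) * s k) \<noteq> 0" if "s \<in> Gamma_set n" for s
        using lower[OF that] pos by auto
      show "cmod (1 + (\<Sum>k\<in>{1..n}. 0 * s k))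
          \<le> 1 / (cmod w - 1) ^ n * cmod (w ^ n + (\<Sum>k\<in>{1..n}. (- 1) ^ k * w ^ (n - k) * s k))"
        if "s \<in> Gamma_set n" for s
        using lower[OF that] pos by (simp add: field_simps)
    qed
    then show ?thesis by simp
  qed
  then show "bounded_op_on M (inv_into M Q)" by (rule bounded_op_on_inverse[OF M Qb bij])
qed

text \<open>
  A point \<open>z = \<pi>(w)\<close> off the distinguished boundary has a coordinate \<open>\<bar>w\<^sub>j\<bar> > 1\<close>, or has all
  \<open>\<bar>w\<^sub>j\<bar> \<le> 1\<close> and \<open>\<bar>z\<^sub>n\<bar> < 1\<close>.  In the first case the form with root \<open>w\<^sub>j\<close> vanishes at \<open>z\<close> and is
  invertible at the tuple; in the second \<open>U - z\<^sub>n\<close> is invertible.  Either way a linear combination of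
  the \<open>N\<^sub>i - z\<^sub>i\<close> is invertible, and the Koszul complex is exact.
\<close>

lemma (in unitary_extension) extend_Gamma_unitary:
  assumes n: "1 \<le> n" and T: "commuting_tuple_on n M T" and TP: "T n = P"
    and S: "spectral_set n M T (Gamma_set n)"
    and rel: "\<And>i x y. 1 \<le> i \<Longrightarrow> i < n \<Longrightarrow> x \<in> M \<Longrightarrow> y \<in> M \<Longrightarrow> cinner (T i x) y = cinner (P x) (T (n - i) y)"
  shows "Gamma_unitary n K (\<lambda>i. extend (T i))"
proof -
  have n_mem: "n \<in> {1..n}" using n by simp
  have Tb: "bounded_op_on M (T i)" if "i \<in> {1..n}" for i
    using T that unfolding commuting_tuple_on_def by auto
  have comm: "T i (T j x) = T j (T i x)" if "i \<in> {1..n}" "j \<in> {1..n}" "x \<in> M" for i j x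
    using T that unfolding commuting_tuple_on_def by blast
  have op: "commutant_op (T i)" if "i \<in> {1..n}" for i
    unfolding commutant_op_def using Tb[OF that] comm[OF that n_mem] TP by simp
  have opP: "commutant_op P" using op[OF n_mem] TP by simp
  have extend_comm: "extend (T i) (extend (T j) f) = extend (T j) (extend (T i) f)"
    if "i \<in> {1..n}" "j \<in> {1..n}" "f \<in> K" for i j f
    unfolding extend_comp[OF op[OF that(1)] op[OF that(2)] that(3)] extend_comp[OF op[OF that(2)] op[OF that(1)] that(3)]
    by (rule extend_cong) (use that comm in auto)
  have tuple: "commuting_tuple_on n K (\<lambda>i. extend (T i))"
    unfolding commuting_tuple_on_def using extend_bounded[OF op] extend_comm by auto
  have normal: "normal_on K (extend (T i))" if i: "i \<in> {1..n}" for i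
  proof (cases "i = n")
    case True
    show ?thesis
      unfolding True TP
      by (rule extend_normal[OF opP opP commutant_op_id]) auto
  next
    case False
    then have i': "1 \<le> i" "i < n" "n - i \<in> {1..n}" using i by auto
    show ?thesis
      by (rule extend_normal[OF opP op[OF i] op[OF i'(3)] rel[OF i'(1,2)] comm[OF i i'(3)]])
  qed
  have "koszul_exact n K (\<lambda>i f. extend (T i) f - z i *\<^sub>C f)" if z: "z \<in> Cn n" "z \<notin> bGamma_set n" for z
  proof -
    let ?A = "\<lambda>i f. extend (T i) f - z i *\<^sub>C f"
    have lin: "clinear_on K (?A i)" if "i \<in> {1..n}" for i
      using clinear_onD(1,2)[OF extend_linear[OF op[OF that]]]
      by (simp add: clinear_on_def scaleC_add_right scaleC_diff_right scaleC_scaleC mult.commute)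
    have A_mem: "?A i f \<in> K" if "i \<in> {1..n}" "f \<in> K" for i f
      using that by (intro closed_csubspace_diff[OF K] closed_csubspace_scaleC[OF K] extend_mem op)
    have A_comm: "?A i (?A j f) = ?A j (?A i f)" if "i \<in> {1..n}" "j \<in> {1..n}" "f \<in> K" for i j f
      using that extend_comm[OF that]
      by (simp add: clinear_on_diff[OF extend_linear[OF op] K] clinear_onD(2)[OF extend_linear[OF op]]
          extend_mem[OF op] closed_csubspace_scaleC[OF K] scaleC_diff_right scaleC_scaleC algebra_simps)
    note exact = koszul_exact_if_combination_invertible[where T = ?A, OF K lin A_mem A_comm]
    obtain w where w: "w \<in> {1..n} \<rightarrow>\<^sub>E UNIV" "symm_map n w = z" using symm_map_surj[OF z(1)] by blast
    show ?thesis
    proof (cases "\<exists>j\<in>{1..n}. cmod (w j) > 1")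
      case True
      then obtain j where j: "j \<in> {1..n}" "cmod (w j) > 1" by blast
      define a where "a = w j ^ n"
      define c where "c k = (- 1) ^ k * w j ^ (n - k)" for k
      define Q where "Q x = a *\<^sub>C x + (\<Sum>k\<in>{1..n}. c k *\<^sub>C T k x)" for x
      define R where "R = inv_into M Q"
      have Q: "bounded_op_on M Q" "bij_betw Q M M" "bounded_op_on M R"
        using root_form_invertible[OF M T S j(2)] unfolding R_def Q_def[abs_def] a_def c_def by auto
      have QR: "R x \<in> M" "Q (R x) = x" "R (Q x) = x" if "x \<in> M" for x
        using Q(2) that by (auto simp: R_def bij_betw_def inv_into_into f_inv_into_f)
      have Q_P: "Q (P x) = P (Q x)" if x: "x \<in> M" for x
      proof -
        have lin: "clinear_on M P" using commutant_opD(3)[OF opP] .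
        have "P (Q x) = a *\<^sub>C P x + (\<Sum>k\<in>{1..n}. c k *\<^sub>C P (T k x))"
        proof -
          have mem: "c k *\<^sub>C T k x \<in> M" "T k x \<in> M" if "k \<in> {1..n}" for k
            using commutant_opD(1)[OF op[OF that] x] closed_csubspace_scaleC[OF M] by auto
          have "P (Q x) = P (a *\<^sub>C x) + P (\<Sum>k\<in>{1..n}. c k *\<^sub>C T k x)"
            unfolding Q_def using mem x
            by (intro clinear_onD(1)[OF lin] closed_csubspace_scaleC[OF M] closed_csubspace_sum[OF M]) auto
          also have "P (\<Sum>k\<in>{1..n}. c k *\<^sub>C T k x) = (\<Sum>k\<in>{1..n}. P (c k *\<^sub>C T k x))"
            using mem by (intro clinear_on_sum[OF lin M]) auto
          also have "\<dots> = (\<Sum>k\<in>{1..n}. c k *\<^sub>C P (T k x))"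
            using mem by (intro sum.cong refl clinear_onD(2)[OF lin]) auto
          finally show ?thesis using clinear_onD(2)[OF lin x] by simp
        qed
        then show ?thesis
          unfolding Q_def using x commutant_opD(2)[OF op] by simp
      qed
      have Qop: "commutant_op Q" using Q(1) Q_P unfolding commutant_op_def by simp
      have "R (P x) = P (R x)" if "x \<in> M" for x
        using QR(3)[OF P_mem[OF QR(1)[OF that]]] Q_P[OF QR(1)[OF that]] QR(2)[OF that] by simp
      then have Rop: "commutant_op R" using Q(3) unfolding commutant_op_def by simp
      have root: "a + (\<Sum>k\<in>{1..n}. c k * z k) = 0"
        unfolding a_def c_def w(2)[symmetric] root_form_eval using j(1) by auto
      have ext_Q: "(\<Sum>k\<in>{1..n}. c k *\<^sub>C ?A k f) = extend Q f" if f: "f \<in> K" for f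
      proof -
        have "(\<Sum>k\<in>{1..n}. c k *\<^sub>C ?A k f)
            = (\<Sum>k\<in>{1..n}. c k *\<^sub>C extend (T k) f) - (\<Sum>k\<in>{1..n}. c k * z k) *\<^sub>C f"
          by (simp add: scaleC_diff_right sum_subtractf scaleC_sum_left scaleC_scaleC)
        also have "(\<Sum>k\<in>{1..n}. c k * z k) = - a" using root by (simp add: eq_neg_iff_add_eq_0 add.commute)
        also have "(\<Sum>k\<in>{1..n}. c k *\<^sub>C extend (T k) f) - (- a) *\<^sub>C f = extend Q f"
          using extend_combination[where X = T and I = "{1..n}" and a = a and c = c, OF op _ f] Qop
          unfolding Q_def[abs_def] by (simp add: scaleC_minus_left)
        finally show ?thesis .
      qed
      have RQ_id: "extend R (extend Q f) = f" "extend Q (extend R f) = f" if f: "f \<in> K" for f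
        using extend_comp[OF Rop Qop f] extend_comp[OF Qop Rop f] extend_id[OF f]
          extend_cong[of "\<lambda>x. R (Q x)" "\<lambda>x. x" f] extend_cong[of "\<lambda>x. Q (R x)" "\<lambda>x. x" f] QR f by auto
      show ?thesis
        by (rule exact[where R = "extend R" and c = c]) (simp_all only: ext_Q extend_mem[OF Rop] RQ_id)
    next
      case False
      then have le: "cmod (w j) \<le> 1" if "j \<in> {1..n}" for j using that by force
      have "\<exists>j\<in>{1..n}. cmod (w j) \<noteq> 1"
      proof (rule ccontr)
        assume "\<not> (\<exists>j\<in>{1..n}. cmod (w j) \<noteq> 1)"
        then have "w \<in> {1..n} \<rightarrow>\<^sub>E sphere 0 1" using w(1) by (auto simp: PiE_iff)
        then show False using z(2) w(2) unfolding bGamma_set_def by blast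
      qed
      then obtain j where j: "j \<in> {1..n}" "cmod (w j) < 1" using le by force
      have "cmod (z n) = (\<Prod>i\<in>{1..n}. cmod (w i))"
        unfolding w(2)[symmetric] symm_map_esym[OF n_mem] esym_n by (simp add: prod_norm)
      also have "\<dots> = cmod (w j) * (\<Prod>i\<in>{1..n} - {j}. cmod (w i))" using j(1) by (intro prod.remove) auto
      also have "\<dots> \<le> cmod (w j)"
        using le by (intro mult_left_le prod_le_1) auto
      finally have zn: "cmod (z n) < 1" using j(2) by simp
      obtain R where R: "\<And>f. f \<in> K \<Longrightarrow> R f \<in> K" "\<And>f. f \<in> K \<Longrightarrow> R (U f - z n *\<^sub>C f) = f"
        "\<And>f. f \<in> K \<Longrightarrow> U (R f) - z n *\<^sub>C R f = f"
        using contraction_resolvent[OF zn] by metis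
      define c where "c k = (if k = n then 1 else 0 :: complex)" for k
      have ext_U: "(\<Sum>k\<in>{1..n}. c k *\<^sub>C ?A k f) = U f - z n *\<^sub>C f" if f: "f \<in> K" for f
      proof -
        have "(\<Sum>k\<in>{1..n}. c k *\<^sub>C ?A k f) = (\<Sum>k\<in>{1..n}. if k = n then ?A k f else 0)"
          by (rule sum.cong) (auto simp: c_def)
        then show ?thesis using n_mem extend_P[OF opP f] TP by simp
      qed
      show ?thesis
        by (rule exact[where R = R and c = c]) (simp_all only: ext_U R)
    qed
  qed
  then have "taylor_spectrum n K (\<lambda>i. extend (T i)) \<subseteq> bGamma_set n"
    unfolding taylor_spectrum_def by auto
  then show ?thesis unfolding Gamma_unitary_def using K tuple normal by auto
qed

section \<open>The minimal unitary extension of an isometry inside the space of sequences\<close>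

text \<open>
  For an isometry \<open>P\<close> on \<open>M\<close> with adjoint \<open>P'\<close>, the space \<open>M \<oplus> ker P' \<oplus> ker P' \<oplus> \<dots>\<close> carries the
  unitary operator that acts as \<open>P\<close> on \<open>M\<close> and shifts the copies of \<open>ker P'\<close>, the first of them onto
  the orthogonal complement of \<open>P M\<close> in \<open>M\<close>.
\<close>

definition extension_space :: "'a :: complex_hilbert set \<Rightarrow> ('a \<Rightarrow> 'a) \<Rightarrow> 'a ell2 set" where
  "extension_space M P' = {f. (\<forall>m. Rep_ell2 f m \<in> M) \<and> (\<forall>m. P' (Rep_ell2 f (Suc m)) = 0)}"

definition extension_embed :: "'a :: complex_hilbert \<Rightarrow> 'a ell2" where
  "extension_embed x = Abs_ell2 (\<lambda>m. if m = 0 then x else 0)"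

definition extension_shift :: "('a \<Rightarrow> 'a) \<Rightarrow> 'a :: complex_hilbert ell2 \<Rightarrow> 'a ell2" where
  "extension_shift P f = Abs_ell2 (\<lambda>m. if m = 0 then P (Rep_ell2 f 0) + Rep_ell2 f 1 else Rep_ell2 f (Suc m))"

definition extension_unshift ::
    "('a \<Rightarrow> 'a) \<Rightarrow> ('a \<Rightarrow> 'a) \<Rightarrow> 'a :: complex_hilbert ell2 \<Rightarrow> 'a ell2" where
  "extension_unshift P P' f = Abs_ell2 (\<lambda>m. if m = 0 then P' (Rep_ell2 f 0)
     else if m = 1 then Rep_ell2 f 0 - P (P' (Rep_ell2 f 0)) else Rep_ell2 f (m - 1))"

lemma summable_Rep_ell2: "summable (\<lambda>m. (norm (Rep_ell2 f m))\<^sup>2)"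
  using Rep_ell2[of f] by simp

lemma Rep_ell2_Abs:
  assumes "summable (\<lambda>m. (norm (F (m + k)))\<^sup>2)"
  shows "Rep_ell2 (Abs_ell2 F) = F"
proof -
  have "summable (\<lambda>m. (norm (F m))\<^sup>2)"
    using assms summable_iff_shift[of "\<lambda>m. (norm (F m))\<^sup>2" k] by simp
  then show ?thesis by (simp add: Abs_ell2_inverse)
qed

lemma Rep_extension_embed: "Rep_ell2 (extension_embed x) = (\<lambda>m. if m = 0 then x else 0)"
  unfolding extension_embed_def by (rule Rep_ell2_Abs[of _ 1]) simp

lemma Rep_extension_shift:
  "Rep_ell2 (extension_shift P f) = (\<lambda>m. if m = 0 then P (Rep_ell2 f 0) + Rep_ell2 f 1 else Rep_ell2 f (Suc m))"
  unfolding extension_shift_def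
proof (rule Rep_ell2_Abs[of _ 1])
  have "summable (\<lambda>m. (norm (Rep_ell2 f (m + 2)))\<^sup>2)"
    using summable_Rep_ell2[of f] summable_iff_shift[of "\<lambda>m. (norm (Rep_ell2 f m))\<^sup>2" 2] by simp
  then show "summable (\<lambda>m. (norm (if m + 1 = 0 then P (Rep_ell2 f 0) + Rep_ell2 f 1 else Rep_ell2 f (Suc (m + 1))))\<^sup>2)"
    by (simp add: numeral_2_eq_2)
qed

lemma Rep_extension_unshift:
  "Rep_ell2 (extension_unshift P P' f) = (\<lambda>m. if m = 0 then P' (Rep_ell2 f 0)
     else if m = 1 then Rep_ell2 f 0 - P (P' (Rep_ell2 f 0)) else Rep_ell2 f (m - 1))"
  unfolding extension_unshift_def
proof (rule Rep_ell2_Abs[of _ 2])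
  have "summable (\<lambda>m. (norm (Rep_ell2 f (m + 1)))\<^sup>2)"
    using summable_Rep_ell2[of f] summable_iff_shift[of "\<lambda>m. (norm (Rep_ell2 f m))\<^sup>2" 1] by simp
  then show "summable (\<lambda>m. (norm (if m + 2 = 0 then P' (Rep_ell2 f 0)
     else if m + 2 = 1 then Rep_ell2 f 0 - P (P' (Rep_ell2 f 0)) else Rep_ell2 f (m + 2 - 1)))\<^sup>2)"
    by (simp add: numeral_2_eq_2)
qed

lemma ell2_eqI: "(\<And>m. Rep_ell2 f m = Rep_ell2 g m) \<Longrightarrow> f = g"
  by (simp add: Rep_ell2_inject[symmetric] fun_eq_iff)

lemma bounded_linear_Rep_ell2: "bounded_linear (\<lambda>f :: 'a :: complex_hilbert ell2. Rep_ell2 f m)"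
proof (rule bounded_linear_intro[of _ 1])
  fix f :: "'a ell2"
  have "(norm (Rep_ell2 f m))\<^sup>2 = (\<Sum>i\<in>{m}. (norm (Rep_ell2 f i))\<^sup>2)" by simp
  also have "\<dots> \<le> (suminf (\<lambda>i. (norm (Rep_ell2 f i))\<^sup>2))"
    by (rule sum_le_suminf[OF summable_Rep_ell2]) auto
  finally have "norm (Rep_ell2 f m) \<le> norm f"
    unfolding norm_ell2.rep_eq by (rule real_le_rsqrt)
  then show "norm (Rep_ell2 f m) \<le> norm f * 1" by simp
qed (simp_all add: plus_ell2.rep_eq scaleR_ell2.rep_eq)

lemma cinner_ell2_split:
  "cinner f g = (suminf (\<lambda>m. cinner (Rep_ell2 f (m + k)) (Rep_ell2 g (m + k)))) + (\<Sum>m<k. cinner (Rep_ell2 f m) (Rep_ell2 g m))"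
  unfolding cinner_ell2.rep_eq
  by (rule suminf_split_initial_segment) (intro summable_cinner summable_Rep_ell2)

lemma ell2_tail_tendsto_zero:
  fixes f :: "'a :: complex_hilbert ell2"
  shows "(\<lambda>k. suminf (\<lambda>m. (norm (Rep_ell2 f (m + k)))\<^sup>2)) \<longlonglongrightarrow> 0"
proof -
  let ?a = "\<lambda>m. (norm (Rep_ell2 f m))\<^sup>2"
  have "(suminf (\<lambda>m. ?a (m + k))) = suminf ?a - (\<Sum>m<k. ?a m)" for k
    using suminf_split_initial_segment[OF summable_Rep_ell2, of f k] by simp
  moreover have "(\<lambda>k. suminf ?a - (\<Sum>m<k. ?a m)) \<longlonglongrightarrow> suminf ?a - suminf ?a"
    by (intro tendsto_diff tendsto_const summable_LIMSEQ summable_Rep_ell2)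
  ultimately show ?thesis by simp
qed

lemma closed_csubspace_extension_space:
  assumes M: "closed_csubspace M" and P': "bounded_op_on UNIV P'"
  shows "closed_csubspace (extension_space M P')"
proof -
  note bl = bounded_op_on_UNIV_bounded_linear[OF P']
  have lin: "P' (x + y) = P' x + P' y" "P' (c *\<^sub>C x) = c *\<^sub>C P' x" for x y c
    using P' unfolding bounded_op_on_def clinear_on_def by auto
  have "P' 0 = 0" using lin(2)[of 0 0] by simp
  have "closed {f. Rep_ell2 f m \<in> M}" for m
  proof -
    have "isCont (\<lambda>f :: 'a ell2. Rep_ell2 f m) f" for f
      by (rule linear_continuous_at[OF bounded_linear_Rep_ell2])
    then show ?thesis
      using continuous_closed_vimage[OF closed_csubspace_closed[OF M], of "\<lambda>f. Rep_ell2 f m"]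
      by (simp add: vimage_def)
  qed
  moreover have "closed {f. P' (Rep_ell2 f (Suc m)) = 0}" for m
    using linear_continuous_on[OF bounded_linear_compose[OF bl bounded_linear_Rep_ell2]]
    by (intro closed_Collect_eq continuous_on_const)
  ultimately have "closed ((\<Inter>m. {f. Rep_ell2 f m \<in> M}) \<inter> (\<Inter>m. {f. P' (Rep_ell2 f (Suc m)) = 0}))"
    by (intro closed_Int closed_INT) auto
  also have "(\<Inter>m. {f. Rep_ell2 f m \<in> M}) \<inter> (\<Inter>m. {f. P' (Rep_ell2 f (Suc m)) = 0}) = extension_space M P'"
    unfolding extension_space_def by auto
  finally show ?thesis
    unfolding closed_csubspace_def
    using \<open>P' 0 = 0\<close> closed_csubspace_zero[OF M] closed_csubspace_add[OF M] closed_csubspace_scaleC[OF M]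
    by (simp add: extension_space_def zero_ell2.rep_eq plus_ell2.rep_eq scaleC_ell2.rep_eq lin)
qed

text \<open>The iterate \<open>U\<^sup>k f\<close> differs from the embedding of its entry at \<open>0\<close> by the tail of \<open>f\<close> beyond \<open>k\<close>.\<close>

lemma isometry_unitary_extension:
  fixes M :: "'a :: complex_hilbert set"
  assumes M: "closed_csubspace M" and P: "bounded_op_on UNIV P" and P': "bounded_op_on UNIV P'"
    and mem: "\<And>x. x \<in> M \<Longrightarrow> P x \<in> M" "\<And>x. x \<in> M \<Longrightarrow> P' x \<in> M"
    and iso: "\<And>x. x \<in> M \<Longrightarrow> P' (P x) = x"
    and adj: "\<And>x y. cinner (P x) y = cinner x (P' y)"
  shows "unitary_extension M P (extension_space M P') (extension_shift P) (extension_unshift P P') extension_embed"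
proof -
  let ?K = "extension_space M P'" and ?U = "extension_shift P" and ?U' = "extension_unshift P P'"
  have linP: "P (x + y) = P x + P y" "P (c *\<^sub>C x) = c *\<^sub>C P x" for x y c
    using P unfolding bounded_op_on_def clinear_on_def by auto
  have linP': "P' (x + y) = P' x + P' y" "P' (c *\<^sub>C x) = c *\<^sub>C P' x" for x y c
    using P' unfolding bounded_op_on_def clinear_on_def by auto
  have diffP': "P' (x - y) = P' x - P' y" for x y
    using linP'(1)[of "x - y" y] by simp
  have P0: "P 0 = 0" "P' 0 = 0" using linP(2)[of 0 0] linP'(2)[of 0 0] by auto
  have K: "Rep_ell2 f m \<in> M" "P' (Rep_ell2 f (Suc m)) = 0" if "f \<in> ?K" for f m
    using that unfolding extension_space_def by auto
  note rep = Rep_extension_embed Rep_extension_shift Rep_extension_unshift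
    plus_ell2.rep_eq minus_ell2.rep_eq scaleC_ell2.rep_eq zero_ell2.rep_eq
  have iter: "Rep_ell2 ((?U ^^ k) f) (Suc m) = Rep_ell2 f (Suc m + k)" for k f m
    by (induction k arbitrary: m) (simp_all add: rep)
  show ?thesis
  proof
    show "closed_csubspace M" by (rule M)
    show "closed_csubspace ?K" by (rule closed_csubspace_extension_space[OF M P'])
    show "P x \<in> M" if "x \<in> M" for x using mem that by simp
    show "?U f \<in> ?K" if f: "f \<in> ?K" for f
      using K[OF f] mem closed_csubspace_add[OF M] by (simp add: extension_space_def rep)
    show "?U' f \<in> ?K" if f: "f \<in> ?K" for f
    proof -
      have "P' (Rep_ell2 (?U' f) (Suc m)) = 0" for m
        using K[OF f] mem iso by (cases m) (simp_all add: rep diffP')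
      moreover have "Rep_ell2 (?U' f) m \<in> M" for m
        using K[OF f] mem closed_csubspace_diff[OF M] by (simp add: rep)
      ultimately show ?thesis by (simp add: extension_space_def)
    qed
    show "clinear_on ?K ?U"
      unfolding clinear_on_def
      by (intro conjI ballI allI ell2_eqI) (simp_all add: rep linP scaleC_add_right algebra_simps)
    show "clinear_on ?K ?U'"
      unfolding clinear_on_def
      by (intro conjI ballI allI ell2_eqI) (simp_all add: rep linP linP' scaleC_diff_right algebra_simps)
    show "?U (?U' f) = f" for f
      by (rule ell2_eqI) (simp add: rep)
    show "?U' (?U f) = f" if f: "f \<in> ?K" for f
    proof (rule ell2_eqI)
      have "P' (P (Rep_ell2 f 0) + Rep_ell2 f 1) = Rep_ell2 f 0"
        using K[OF f, of 0] iso by (simp add: linP')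
      then show "Rep_ell2 (?U' (?U f)) m = Rep_ell2 f m" for m by (simp add: rep)
    qed
    show "cinner (?U f) (?U g) = cinner f g" if f: "f \<in> ?K" and g: "g \<in> ?K" for f g
    proof -
      have "cinner (P (Rep_ell2 f 0)) (Rep_ell2 g 1) = 0" using K(2)[OF g, of 0] by (simp add: adj)
      moreover have "cinner (Rep_ell2 f 1) (P (Rep_ell2 g 0)) = 0"
        using adj[of "Rep_ell2 g 0" "Rep_ell2 f 1"] K(2)[OF f, of 0]
        by (subst cinner_commute) simp
      moreover have "cinner (P (Rep_ell2 f 0)) (P (Rep_ell2 g 0)) = cinner (Rep_ell2 f 0) (Rep_ell2 g 0)"
        using iso[OF K(1)[OF g]] by (simp add: adj)
      ultimately show ?thesis
        unfolding cinner_ell2_split[of "?U f" _ 1] cinner_ell2_split[of f g 2]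
        by (simp add: rep cinner_add_left cinner_add_right numeral_2_eq_2)
    qed
    show "extension_embed x \<in> ?K" if "x \<in> M" for x
      using that by (simp add: extension_space_def rep P0 closed_csubspace_zero[OF M])
    show "clinear_on M extension_embed"
      unfolding clinear_on_def by (intro conjI ballI allI ell2_eqI) (simp_all add: rep)
    show "cinner (extension_embed x) (extension_embed y) = cinner x y" for x y
      unfolding cinner_ell2_split[of _ _ 1] by (simp add: rep)
    show "?U (extension_embed x) = extension_embed (P x)" for x
      by (rule ell2_eqI) (simp add: rep)
    show "\<exists>h. (\<forall>k. h k \<in> M) \<and> (\<lambda>k. (?U ^^ k) f - extension_embed (h k)) \<longlonglongrightarrow> 0" if f: "f \<in> ?K" for f
    proof (intro exI conjI allI)
      show "Rep_ell2 ((?U ^^ k) f) 0 \<in> M" for k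
      proof -
        have "(?U ^^ k) f \<in> ?K"
        proof (induction k)
          case (Suc k)
          then show ?case using K[OF Suc] mem closed_csubspace_add[OF M] by (simp add: extension_space_def rep)
        qed (use f in simp)
        then show ?thesis by (rule K(1))
      qed
      have "norm ((?U ^^ k) f - extension_embed (Rep_ell2 ((?U ^^ k) f) 0))
          = sqrt (suminf (\<lambda>m. (norm (Rep_ell2 f (m + Suc k)))\<^sup>2))" (is "norm ?d = _") for k
      proof -
        have "(suminf (\<lambda>m. (norm (Rep_ell2 ?d m))\<^sup>2)) = (suminf (\<lambda>m. (norm (Rep_ell2 ?d (m + 1)))\<^sup>2)) + (\<Sum>m<1. (norm (Rep_ell2 ?d m))\<^sup>2)"
          by (rule suminf_split_initial_segment[OF summable_Rep_ell2])
        also have "\<dots> = (suminf (\<lambda>m. (norm (Rep_ell2 f (m + Suc k)))\<^sup>2))"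
          by (simp add: minus_ell2.rep_eq Rep_extension_embed iter)
        finally show ?thesis unfolding norm_ell2.rep_eq by simp
      qed
      moreover have "(\<lambda>k. sqrt (suminf (\<lambda>m. (norm (Rep_ell2 f (m + Suc k)))\<^sup>2))) \<longlonglongrightarrow> sqrt 0"
        by (intro tendsto_real_sqrt LIMSEQ_Suc[OF ell2_tail_tendsto_zero])
      ultimately show "(\<lambda>k. (?U ^^ k) f - extension_embed (Rep_ell2 ((?U ^^ k) f) 0)) \<longlonglongrightarrow> 0"
        by (subst tendsto_norm_zero_iff[symmetric]) simp
    qed
  qed
qed

lemma isometric_part_Gamma_isometry:
  fixes T :: "nat \<Rightarrow> 'a \<Rightarrow> 'a :: complex_hilbert"
  assumes n: "1 \<le> n" and M: "closed_csubspace M"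
    and T: "commuting_tuple_on n M T" and S: "spectral_set n M T (Gamma_set n)"
    and P: "bounded_op_on UNIV (T n)" and red: "reduces_on UNIV (T n) M"
    and iso: "\<And>x. x \<in> M \<Longrightarrow> adjoint_on UNIV (T n) (T n x) = x"
    and rel: "\<And>i x y. 1 \<le> i \<Longrightarrow> i < n \<Longrightarrow> x \<in> M \<Longrightarrow> y \<in> M \<Longrightarrow> cinner (T i x) y = cinner (T n x) (T (n - i) y)"
  shows "Gamma_isometry n M T"
proof -
  let ?P' = "adjoint_on UNIV (T n)"
  let ?K = "extension_space M ?P'"
  have mem: "T n x \<in> M" "?P' x \<in> M" if "x \<in> M" for x
    using red that unfolding reduces_on_def by auto
  interpret ue: unitary_extension M "T n" ?K "extension_shift (T n)" "extension_unshift (T n) ?P'" extension_embed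
    by (rule isometry_unitary_extension[OF M P bounded_op_on_adjoint_UNIV[OF P] mem iso cinner_adjoint_UNIV[OF P]])
  have Tb: "bounded_op_on M (T i)" if "i \<in> {1..n}" for i
    using T that unfolding commuting_tuple_on_def by auto
  have op: "ue.commutant_op (T i)" if "i \<in> {1..n}" for i
    using T that n unfolding ue.commutant_op_def commuting_tuple_on_def by auto
  have "Gamma_unitary n ?K (\<lambda>i. ue.extend (T i))"
    by (rule ue.extend_Gamma_unitary[OF n T refl S rel])
  moreover have "\<forall>i\<in>{1..n}. \<forall>x\<in>M. ue.extend (T i) (extension_embed x) = extension_embed (T i x)"
    using ue.extend_V[OF op] by blast
  ultimately show ?thesis
    unfolding Gamma_isometry_def using M Tb ue.V_mem ue.V_lin ue.norm_V by blast
qed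

theorem theorem4p3:
  fixes n :: nat
    and S :: "nat \<Rightarrow> 'a :: complex_hilbert \<Rightarrow> 'a" and P :: "'a \<Rightarrow> 'a"
    and H1 H2 :: "'a set"
  assumes "2 \<le> n"
    and "cnu_Gamma_contraction n UNIV (S(n := P))"
    and "levan_decomposition UNIV P H1 H2"
    and "(\<forall>i\<in>{1..n - 1}. \<forall>x. adjoint_on UNIV P (S i x) = S i (adjoint_on UNIV P x)) \<or>
      maximal_isometric_subspace UNIV P H1"
  shows "(\<forall>i\<in>{1..n - 1}. reduces_on UNIV (S i) H1 \<and> reduces_on UNIV (S i) H2) \<and>
    cnu_Gamma_isometry n H1 (S(n := P)) \<and>
    cni_Gamma_contraction n H2 (S(n := P))"
proof -
  define T where "T = S(n := P)"
  let ?Pa = "adjoint_on UNIV P"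
  have Tn: "T n = P" by (simp add: T_def)
  have Ti: "T i = S i" if "i < n" for i using that by (simp add: T_def)
  have "cnu_Gamma_contraction n UNIV T" using assms(2) by (simp only: T_def)
  then have spec: "spectral_set n UNIV T (Gamma_set n)" and comm: "commuting_tuple_on n UNIV T"
    and contr: "contraction_on UNIV P"
    unfolding cnu_Gamma_contraction_def Gamma_contraction_def cnu_contraction_on_def Tn by blast+
  have Tb: "bounded_op_on UNIV (T i)" if "i \<in> {1..n}" for i
    using comm that unfolding commuting_tuple_on_def by blast
  have T_comm: "T i (T j x) = T j (T i x)" if "i \<in> {1..n}" "j \<in> {1..n}" for i j x
    using comm that unfolding commuting_tuple_on_def by blast
  have n_mem: "n \<in> {1..n}" using assms(1) by simp
  have Pb: "bounded_op_on UNIV P" using Tb[OF n_mem] Tn by simp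
  note dec = assms(3)
  have D: "orthogonal_decomposition UNIV H1 H2" and R1: "reduces_on UNIV P H1" and R2: "reduces_on UNIV P H2"
    and cnu: "cnu_contraction_on H1 P" and iso1: "isometry_on H1 P" and cni: "cni_contraction_on H2 P"
    using dec unfolding levan_decomposition_def by auto
  have H1: "closed_csubspace H1" and H2: "closed_csubspace H2"
    using D unfolding orthogonal_decomposition_def by auto
  have iso: "?Pa (P x) = x" if "x \<in> H1" for x
    using isometric_vector_adjoint[OF Pb] contr iso1 that unfolding contraction_on_def isometry_on_def by auto
  have P_inner: "cinner (T n x) (T n y) = cinner x y" if "x \<in> H1" for x y
    using cinner_adjoint_UNIV_left[OF Pb, of "P x" y] iso[OF that] by (simp add: Tn)
  have red1: "reduces_on UNIV (T i) H1" if i: "1 \<le> i" "i < n" for i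
    using assms(4)
  proof
    assume *: "\<forall>i\<in>{1..n - 1}. \<forall>x. ?Pa (S i x) = S i (?Pa x)"
    have i_mem: "i \<in> {1..n}" "i \<in> {1..n - 1}" using i by auto
    show ?thesis
    proof (rule doubly_commuting_isometric_part_reduces[OF Pb dec iso Tb[OF i_mem(1)]])
      show "P (T i x) = T i (P x)" for x using T_comm[OF n_mem i_mem(1), of x] Tn by simp
      show "?Pa (T i x) = T i (?Pa x)" for x using * i_mem(2) Ti[OF i(2)] by simp
    qed
  next
    assume "maximal_isometric_subspace UNIV P H1"
    then show ?thesis
      using maximal_isometric_part_reduces[OF spec comm _ _ _ i, of H1] R1 iso by (simp add: Tn)
  qed
  have red: "reduces_on UNIV (T i) H1" "reduces_on UNIV (T i) H2" if "i \<in> {1..n}" for i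
  proof -
    show *: "reduces_on UNIV (T i) H1"
      using red1[of i] R1 Tn that by (cases "i = n") auto
    show "reduces_on UNIV (T i) H2" by (rule reduces_on_UNIV_orthogonal[OF Tb[OF that] D *])
  qed
  have inv1: "T i ` H1 \<subseteq> H1" and inv2: "T i ` H2 \<subseteq> H2" if "i \<in> {1..n}" for i
    using red[OF that] unfolding reduces_on_def by auto
  have tuple1: "commuting_tuple_on n H1 T" and tuple2: "commuting_tuple_on n H2 T"
    unfolding commuting_tuple_on_def
    using bounded_op_on_subspace[OF Tb inv1] bounded_op_on_subspace[OF Tb inv2] T_comm by auto
  have spec1: "spectral_set n H1 T (Gamma_set n)"
    by (rule spectral_set_restrict[OF D Tb inv1 inv2 spec])
  have spec2: "spectral_set n H2 T (Gamma_set n)"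
    by (rule spectral_set_restrict[OF orthogonal_decomposition_sym[OF D] Tb inv2 inv1 spec])
  have "Gamma_isometry n H1 T"
  proof (rule isometric_part_Gamma_isometry[OF _ H1 tuple1 spec1])
    show "cinner (T i x) y = cinner (T n x) (T (n - i) y)" if "1 \<le> i" "i < n" "x \<in> H1" for i x y
      by (rule fundamental_relation(1)[OF spec Tb that(1,2) P_inner[OF that(3)]])
  qed (use assms(1) Pb R1 iso Tn in auto)
  then have "cnu_Gamma_isometry n H1 T" unfolding cnu_Gamma_isometry_def using cnu Tn by simp
  moreover have "cni_Gamma_contraction n H2 T"
    unfolding cni_Gamma_contraction_def Gamma_contraction_def using H2 tuple2 spec2 cni Tn by simp
  moreover have "\<forall>i\<in>{1..n - 1}. reduces_on UNIV (S i) H1 \<and> reduces_on UNIV (S i) H2"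
  proof
    fix i assume "i \<in> {1..n - 1}"
    then have "i \<in> {1..n}" "i < n" using assms(1) by auto
    then show "reduces_on UNIV (S i) H1 \<and> reduces_on UNIV (S i) H2" using red[of i] Ti[of i] by simp
  qed
  ultimately show ?thesis unfolding T_def by blast
qed

end
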